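(* Let $T>0$, $\frac12\le\alpha<1$, $\frac1\alpha<p\le\infty$, and $0<q\le\infty$ if $\alpha>\frac12$, while $0<q\le2$ if $\alpha=\frac12$. Let $X\in B^\alpha_{pq}([0,T];\mathbb R^n)$ and let $f:\mathbb R^m\to\mathbb R^m\otimes\mathbb R^n$ satisfy: if $\alpha>\frac12$, $f\in C^{1,\delta}$ for some $\delta\in(0,1]$ with $(1+\delta)\alpha>1$ and $\delta\alpha>\frac1p$; if $\alpha=\frac12$, $f\in C^2$. Then for every $y\in\mathbb R^m$ there exists a unique solution $Y\in B^\alpha_{pq}([0,T];\mathbb R^m)$ of $$dY_t=f(Y_t)\cdot dX_t\ \text{ in }[0,T],\qquad Y_0=y .$$ Moreover, there exists a constant $M$ depending only on $\alpha$, $p$, $q$, $T$, $\|f\|_{C^1}$ and $[X]_{B^\alpha_{pq}}$ such that $[Y]_{B^\alpha_{pq}}\le M$.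
   Context: For measurable $f:[0,T]\to\mathbb R^m$, $\omega_p(f,\tau)=\sup_{0\le h\le\tau}\big(\int_0^{T-h}|f_{s+h}-f_s|^p\,ds\big)^{1/p}$, $[f]_{B^\alpha_{pq}([0,T])}=\big[\int_0^T(\omega_p(f,\tau)/\tau^\alpha)^q\frac{d\tau}\tau\big]^{1/q}$ (suprema when an exponent is $\infty$), and $f\in B^\alpha_{pq}([0,T])$ iff $f\in L^p$ and $[f]_{B^\alpha_{pq}}<\infty$. Since $\alpha>1/p$, elements of $B^\alpha_{pq}$ have (Hölder-)continuous versions, which are used throughout. $C^{k}$, $C^{k,\delta}$ denote spaces of bounded functions with bounded continuous derivatives up to order $k$ (and $\delta$-Hölder $k$-th derivative), with the usual norms. Meaning of solution: $Y\in B^\alpha_{pq}([0,T];\mathbb R^m)$ is a solution if $Y_t=y+\int_0^tf(Y_s)\cdot dX_s$ for all $t\in[0,T]$, where the integral is the Young integral: the unique continuous path $\mathscr I$ with $\mathscr I_0=0$ whose increments $\delta\mathscr I_{st}=\mathscr I_t-\mathscr I_s$ are the limit, as the mesh of partitions $P=\{0=\tau_0<\dots<\tau_N=1\}$ of $[0,1]$ tends to $0$, of $$\mathscr I^P_{st}=\sum_{k=1}^Nf(Y_{s+\tau_{k-1}(t-s)})\cdot\big(X_{s+\tau_k(t-s)}-X_{s+\tau_{k-1}(t-s)}\big),\quad 0\le s\le t\le T,$$ in $\mathbb B^{2\alpha}_{p/2,\infty}$, i.e. $\sup_{0<\tau\le T}\tau^{-2\alpha}\sup_{0\le h\le\tau}\|(\mathscr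 I^P-\delta\mathscr I)_{\cdot,\cdot+h}\|_{L^{p/2}([0,T-h])}\to0$ (this limit exists for $Y\in B^\alpha_{pq}([0,T];\mathbb R^m)$, $X\in B^\alpha_{pq}([0,T];\mathbb R^n)$ and $f:\mathbb R^m\to\mathbb R^m\otimes\mathbb R^n$ when $\frac12\le\alpha<1$, $\frac1\alpha<p\le\infty$, and either $\alpha>\frac12$, $0<q\le\infty$ and $f\in C^{1,\delta}$ for some $\delta\in(0,1]$ with $(1+\delta)\alpha>1$ and $\delta\alpha>\frac1p$, or $\alpha=\frac12$, $0<q\le2$ and $f\in C^2$). Here "$\cdot$" is contraction of the $\mathbb R^n$ factor. *)

theory Defs
  imports "HOL-Analysis.Analysis" "HOL-Probability.Essential_Supremum"
begin

subsection \<open>Lebesgue and Besov (quasi-)norms with exponents in (0, \<infinity>]\<close>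

(* Only used for r > 0; then 0 is mapped to 0 and top to top. *)
definition enn_powr :: "ennreal \<Rightarrow> real \<Rightarrow> ennreal" where
  "enn_powr x r = (if x = top then top else ennreal (enn2real x powr r))"

definition Lp_norm :: "ennreal \<Rightarrow> 'a measure \<Rightarrow> ('a \<Rightarrow> 'b::real_normed_vector) \<Rightarrow> ennreal" where
  "Lp_norm p M f =
     (if p = top then esssup M (\<lambda>x. ennreal (norm (f x)))
      else enn_powr (\<integral>\<^sup>+x. ennreal (norm (f x) powr enn2real p) \<partial>M) (1 / enn2real p))"

definition incr :: "(real \<Rightarrow> 'b::real_normed_vector) \<Rightarrow> real \<Rightarrow> real \<Rightarrow> 'b" where
  "incr f s t = f t - f s"

(* For A = incr f this is the integral modulus of continuity of f in L^p([0,T]). *)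
definition modulus2 ::
    "real \<Rightarrow> ennreal \<Rightarrow> (real \<Rightarrow> real \<Rightarrow> 'b::real_normed_vector) \<Rightarrow> real \<Rightarrow> ennreal" where
  "modulus2 T p A \<tau> = (SUP h\<in>{0..\<tau>}. Lp_norm p (lebesgue_on {0..T - h}) (\<lambda>s. A s (s + h)))"

definition besov2 ::
    "real \<Rightarrow> real \<Rightarrow> ennreal \<Rightarrow> ennreal \<Rightarrow> (real \<Rightarrow> real \<Rightarrow> 'b::real_normed_vector) \<Rightarrow> ennreal" where
  "besov2 T \<alpha> p q A =
     (if q = top then (SUP \<tau>\<in>{0<..T}. modulus2 T p A \<tau> / ennreal (\<tau> powr \<alpha>))
      else enn_powr
        (\<integral>\<^sup>+\<tau>\<in>{0<..T}. (enn_powr (modulus2 T p A \<tau> / ennreal (\<tau> powr \<alpha>)) (enn2real q)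
            / ennreal \<tau>) \<partial>lborel) (1 / enn2real q))"

definition besov_seminorm ::
    "real \<Rightarrow> real \<Rightarrow> ennreal \<Rightarrow> ennreal \<Rightarrow> (real \<Rightarrow> 'b::real_normed_vector) \<Rightarrow> ennreal" where
  "besov_seminorm T \<alpha> p q f = besov2 T \<alpha> p q (incr f)"

(* Only the values of f on {0..T} matter. *)
definition besov_space ::
    "real \<Rightarrow> real \<Rightarrow> ennreal \<Rightarrow> ennreal \<Rightarrow> (real \<Rightarrow> 'b::real_normed_vector) set" where
  "besov_space T \<alpha> p q =
     {f. f \<in> borel_measurable (lebesgue_on {0..T}) \<and>
         Lp_norm p (lebesgue_on {0..T}) f < top \<and> besov_seminorm T \<alpha> p q f < top}"

subsection \<open>Bounded functions with bounded continuous derivatives\<close>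

definition Deriv :: "('a::real_normed_vector \<Rightarrow> 'b::real_normed_vector) \<Rightarrow> 'a \<Rightarrow> 'a \<Rightarrow>\<^sub>L 'b" where
  "Deriv f x = Blinfun (frechet_derivative f (at x))"

definition Cb1 :: "('a::real_normed_vector \<Rightarrow> 'b::real_normed_vector) \<Rightarrow> bool" where
  "Cb1 f \<longleftrightarrow> (\<forall>x. f differentiable (at x)) \<and> continuous_on UNIV (Deriv f) \<and>
     bounded (range f) \<and> bounded (range (Deriv f))"

definition Cb1_Hoelder ::
    "real \<Rightarrow> ('a::real_normed_vector \<Rightarrow> 'b::real_normed_vector) \<Rightarrow> bool" where
  "Cb1_Hoelder \<delta> f \<longleftrightarrow> Cb1 f \<and>
     (\<exists>C. \<forall>x y. norm (Deriv f x - Deriv f y) \<le> C * norm (x - y) powr \<delta>)"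

definition Cb2 :: "('a::real_normed_vector \<Rightarrow> 'b::real_normed_vector) \<Rightarrow> bool" where
  "Cb2 f \<longleftrightarrow> Cb1 f \<and> Cb1 (Deriv f)"

definition C1_norm :: "('a::real_normed_vector \<Rightarrow> 'b::real_normed_vector) \<Rightarrow> real" where
  "C1_norm f = (SUP x. norm (f x)) + (SUP x. norm (Deriv f x))"

subsection \<open>Young integral and Young differential equation\<close>

definition unit_partition :: "nat \<Rightarrow> (nat \<Rightarrow> real) \<Rightarrow> bool" where
  "unit_partition N \<tau> \<longleftrightarrow> \<tau> 0 = 0 \<and> \<tau> N = 1 \<and> (\<forall>k<N. \<tau> k < \<tau> (Suc k))"

definition mesh :: "nat \<Rightarrow> (nat \<Rightarrow> real) \<Rightarrow> real" where
  "mesh N \<tau> = Max ((\<lambda>k. \<tau> (Suc k) - \<tau> k) ` {..<N})"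

(* The tensor product of R^m and R^n is represented by matrices with m rows and n columns, so that
   contraction of the R^n factor is the matrix-vector product. *)
definition riemann_sum ::
    "nat \<Rightarrow> (nat \<Rightarrow> real) \<Rightarrow> (real \<Rightarrow> real^'n^'m) \<Rightarrow> (real \<Rightarrow> real^'n) \<Rightarrow> real \<Rightarrow> real \<Rightarrow> real^'m" where
  "riemann_sum N \<tau> F X s t =
     (\<Sum>k<N. F (s + \<tau> k * (t - s)) *v (X (s + \<tau> (Suc k) * (t - s)) - X (s + \<tau> k * (t - s))))"

(* A relation rather than a function, because I is determined only on {0..T}. The convergence is that
   of the Riemann sums to the increments of I, as the mesh tends to 0, in the two-parameter space
   with regularity 2 \<alpha>, integrability p/2 and third index \<infinity>. *)
definition has_young_integral ::
    "real \<Rightarrow> real \<Rightarrow> ennreal \<Rightarrow> (real \<Rightarrow> real^'n^'m) \<Rightarrow> (real \<Rightarrow> real^'n) \<Rightarrow> (real \<Rightarrow> real^'m) \<Rightarrow> bool" where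
  "has_young_integral T \<alpha> p F X I \<longleftrightarrow>
     continuous_on {0..T} I \<and> I 0 = 0 \<and>
     (\<forall>\<epsilon>>0. \<exists>\<eta>>0. \<forall>N \<tau>. unit_partition N \<tau> \<and> mesh N \<tau> < \<eta> \<longrightarrow>
        besov2 T (2 * \<alpha>) (p / 2) top (\<lambda>s t. riemann_sum N \<tau> F X s t - incr I s t) < ennreal \<epsilon>)"

definition young_solution ::
    "real \<Rightarrow> real \<Rightarrow> ennreal \<Rightarrow> ennreal \<Rightarrow> (real^'m \<Rightarrow> real^'n^'m) \<Rightarrow> (real \<Rightarrow> real^'n) \<Rightarrow> real^'m
       \<Rightarrow> (real \<Rightarrow> real^'m) \<Rightarrow> bool" where
  "young_solution T \<alpha> p q f X y Y \<longleftrightarrow>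
     Y \<in> besov_space T \<alpha> p q \<and> continuous_on {0..T} Y \<and>
     (\<exists>I. has_young_integral T \<alpha> p (\<lambda>t. f (Y t)) X I \<and> (\<forall>t\<in>{0..T}. Y t = y + I t))"

end

theory Submission
  imports Defs "HOL-Complex_Analysis.Great_Picard"
begin

text \<open>
  Everything is read off the remainder \<open>R s h = \<delta>Y - f (Y s) \<delta>X\<close> over the interval \<open>[s, s + h]\<close>.
  Splitting the interval at its midpoint gives
  \<open>R I = R I' + R I'' + (f (Y u) - f (Y s)) \<delta>X\<^sub>I\<^sub>'\<^sub>'\<close>, and since \<open>\<delta>Y = f (Y s) \<delta>X + R\<close> the last term is at most
  \<open>F\<^sup>2 \<bar>\<delta>X\<^sub>I\<^sub>'\<bar> \<bar>\<delta>X\<^sub>I\<^sub>'\<^sub>'\<bar> + F \<bar>\<delta>X\<^sub>I\<^sub>'\<^sub>'\<bar> \<bar>R I'\<bar>\<close>. Iterating along the dyadic tree below \<open>I\<close>, a discrete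
  Gronwall argument bounds \<open>R I\<close> by a constant times the sum of \<open>\<bar>\<delta>X\<^sub>J\<bar>\<^sup>2\<close> over all dyadic subintervals \<open>J\<close>
  of \<open>I\<close>, as soon as the remainders over the subintervals of level \<open>k\<close> have a sum tending to 0 as
  \<open>k\<close> grows (predicate \<open>sewn\<close>). This bound involves \<open>X\<close> alone, so no smallness of the time interval is
  needed, and the constant depends only on \<open>F = C1_norm f\<close> and a Hoelder constant of \<open>X\<close>.

  Sampling along a grid of mesh \<open>\<eta>\<close> the increments of a continuous path in the Besov space is controlled,
  uniformly in the position of the grid, by the integral moduli at the scales \<open>\<eta>/2, \<eta>/4, \<dots>\<close>; this makes
  the dyadic sums of \<open>\<bar>\<delta>X\<bar>\<^sup>r\<close> finite when \<open>\<alpha> r > 1\<close>, or when \<open>\<alpha> r = 1\<close> and \<open>q \<le> r\<close>. Taking \<open>L\<^sup>p\<^sup>/\<^sup>2\<close> norms of the dyadic sums gives the rate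
  \<open>h\<^sup>2\<^sup>\<alpha>\<close> for \<open>R\<close>, hence the convergence of the Riemann sums along all partitions, and interpolation with the
  supremum bound gives the \<open>L\<^sup>p\<close> rate \<open>h\<^sup>2\<^sup>\<alpha>\<^sup>-\<^sup>1\<^sup>/\<^sup>p\<close>, hence the a priori bound. The same tree
  argument for the difference of two solutions, now with exponent \<open>r = 1 + \<delta>\<close>, gives uniqueness. For existence,
  \<open>X\<close> is replaced by moving averages, whose dyadic sums are no larger, and the solutions of the resulting
  ordinary differential equations converge along a subsequence by the Arzela-Ascoli theorem.
\<close>

subsection \<open>Dyadic sums over subintervals\<close>

text \<open>The obstacle is the endpoint \<open>\<alpha> = 1/2\<close>. There the level-k sums of
  squared increments of \<open>X\<close> need not decay geometrically in k, so no power of h is left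
  over for a classical sewing argument; only their summability over k survives, and
  \<open>q \<le> 2\<close> is what provides it. Estimates are therefore kept as sums over levels,
  and at the endpoint smallness comes from the tail of a convergent series. The Gronwall product is
  bounded for another reason: \<open>X\<close> is Hoelder of exponent
  \<open>\<gamma> = \<alpha> - 1/p > 0\<close>, so its factors 1 + b(h/2^i) approach 1
  geometrically.

  Young solutions are described by L^{p/2} convergence, while the tree argument is pointwise. The
  two are joined by continuity in the left endpoint s: a nonnegative continuous function with
  vanishing norm is zero. At h = T the norm lives on a single point and carries no information,
  whence the recurring restriction h < T. Finally p/2 may be smaller than 1; only a power of the
  norm is then subadditive, and this power is the source of the exponents \<open>kap\<close> and
  \<open>kp\<close>.\<close>

text \<open>Intervals are given by their left endpoint and their length; \<open>lev g k s h\<close> sums \<open>g\<close> over the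
  \<open>2^k\<close> dyadic subintervals of \<open>[s, s + h]\<close> of level \<open>k\<close>.\<close>

primrec lev :: "(real \<Rightarrow> real \<Rightarrow> 'a::comm_monoid_add) \<Rightarrow> nat \<Rightarrow> real \<Rightarrow> real \<Rightarrow> 'a" where
  "lev g 0 s h = g s h"
| "lev g (Suc k) s h = lev g k s (h/2) + lev g k (s + h/2) (h/2)"

text \<open>The recursion suits inductive estimates, the equidistant grid suits limits and
  integrals. In the induction the first \<open>2^k\<close> grid points belong to the left half and
  the others, shifted by \<open>2^k\<close>, to the right half.\<close>

lemma lev_eq_sum: "lev g k s h = (\<Sum>j<2^k. g (s + real j * (h/2^k)) (h/2^k))"
proof (induction k arbitrary: s h)
  case 0
  show ?case by simp
next
  case (Suc k)
  have U: "{..<2 ^ Suc k} = {..<2^k} \<union> {2^k..<2 ^ Suc k :: nat}" by auto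
  have "(\<Sum>j<2^Suc k. g (s + real j * (h/2^Suc k)) (h/2^Suc k))
     = (\<Sum>j<2^k. g (s + real j * (h/2^Suc k)) (h/2^Suc k)) +
       (\<Sum>j=2^k..<2^Suc k. g (s + real j * (h/2^Suc k)) (h/2^Suc k))"
    unfolding U by (rule sum.union_disjoint) auto
  also have "(\<Sum>j=2^k..<2^Suc k. g (s + real j * (h/2^Suc k)) (h/2^Suc k)) =
     (\<Sum>j<2^k. g (s + real (j + 2^k) * (h/2^Suc k)) (h/2^Suc k))"
    using sum.shift_bounds_nat_ivl[of "\<lambda>j. g (s + real j * (h/2^Suc k)) (h/2^Suc k)" 0 "2^k" "2^k"]
    unfolding lessThan_atLeast0 power_Suc mult_2 add_0 .
  finally have eq: "(\<Sum>j<2^Suc k. g (s + real j * (h/2^Suc k)) (h/2^Suc k)) =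
     (\<Sum>j<2^k. g (s + real j * (h/2^Suc k)) (h/2^Suc k)) +
     (\<Sum>j<2^k. g (s + real (j + 2^k) * (h/2^Suc k)) (h/2^Suc k))" .
  have "s + real (j + 2^k) * (h/2^Suc k) = s + h/2 + real j * (h/2/2^k)" "h/2^Suc k = h/2/2^k" for j
    by (simp_all add: field_simps)
  then show ?case
    unfolding lev.simps Suc.IH eq by (simp add: add.assoc)
qed

text \<open>Bisecting the level-\<open>k\<close> subintervals \<open>n\<close> more times. This lets
  an estimate for a single interval be applied on every subinterval of a level and summed.\<close>

lemma lev_lev: "lev (lev g n) k s h = lev g (n + k) s h"
  by (induction k arbitrary: s h) auto

lemma lev_add: "lev (\<lambda>s h. g s h + g' s h) k s h = lev g k s h + lev g' k s h"
  by (induction k arbitrary: s h) (auto simp: algebra_simps)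

lemma lev_cmult: "lev (\<lambda>s h. c * g s h) k s h = c * lev g k s h" for c :: real
  by (induction k arbitrary: s h) (auto simp: algebra_simps)

lemma lev_sum: "lev (\<lambda>s h. \<Sum>i\<in>A. g i s h) k s h = (\<Sum>i\<in>A. lev (g i) k s h)"
  by (induction k arbitrary: s h) (auto simp: sum.distrib)

lemma norm_lev_le: "norm (lev g k s h) \<le> lev (\<lambda>s h. norm (g s h)) k s h"
  by (induction k arbitrary: s h) (auto intro: norm_triangle_mono)

lemma lev_mono:
  fixes g g' :: "real \<Rightarrow> real \<Rightarrow> real"
  assumes "h > 0" "\<And>s' h'. s \<le> s' \<Longrightarrow> s' + h' \<le> s + h \<Longrightarrow> 0 < h' \<Longrightarrow> g s' h' \<le> g' s' h'"
  shows "lev g k s h \<le> lev g' k s h"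
  using assms
proof (induction k arbitrary: s h)
  case (Suc k)
  have "lev g k s (h/2) \<le> lev g' k s (h/2)" "lev g k (s + h/2) (h/2) \<le> lev g' k (s + h/2) (h/2)"
    by (rule Suc.IH; use Suc.prems in \<open>auto intro!: Suc.prems(2)\<close>)+
  then show ?case by auto
qed auto

lemma lev_nonneg: "(\<And>s h. g s h \<ge> (0::real)) \<Longrightarrow> lev g k s h \<ge> 0"
  by (induction k arbitrary: s h) auto

text \<open>\<open>a\<close> is the defect of additivity under one bisection. Unlike
  \<open>tree_bound\<close>, this exact form keeps the cancellations inside
  \<open>lev g N s h\<close>; it serves where the defect is bounded independently of
  \<open>g\<close>.\<close>

lemma lev_telescope:
  fixes g a :: "real \<Rightarrow> real \<Rightarrow> 'a::ab_group_add"
  assumes "\<And>s h. g s h = g s (h/2) + g (s + h/2) (h/2) + a s h"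
  shows "g s h = lev g N s h + (\<Sum>k<N. lev a k s h)"
proof (induction N)
  case (Suc N)
  have "g s h = lev g 1 s h + a s h" for s h
    unfolding One_nat_def lev.simps by (rule assms)
  then have "g = (\<lambda>s h. lev g 1 s h + a s h)"
    by (intro ext)
  then have "lev g N s h = lev (\<lambda>s h. lev g 1 s h + a s h) N s h"
    by (rule arg_cong)
  also have "\<dots> = lev g (Suc N) s h + lev a N s h"
    unfolding lev_add lev_lev by simp
  finally show ?case using Suc by simp
qed simp

text \<open>Discrete Gronwall inequality. The factor \<open>1 + b (h'/2)\<close> depends on the
  length alone, so it is common to all intervals of one level, and the factors of successive levels
  multiply. A defect from an upper level would need only part of the product; it is charged the
  whole of it, since every factor is at least 1.\<close>

lemma tree_bound:
  fixes g a :: "real \<Rightarrow> real \<Rightarrow> real"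
  assumes "h > 0" "\<And>s' h'. s \<le> s' \<Longrightarrow> s' + h' \<le> s + h \<Longrightarrow> 0 < h' \<Longrightarrow>
      g s' h' \<le> (1 + b (h'/2)) * (g s' (h'/2) + g (s' + h'/2) (h'/2)) + a s' h'"
    and nn: "\<And>s h. g s h \<ge> 0" "\<And>s h. a s h \<ge> 0" "\<And>h. b h \<ge> 0"
  shows "g s h \<le> (\<Prod>i<N. 1 + b (h/2^Suc i)) * (lev g N s h + (\<Sum>k<N. lev a k s h))"
  using assms(1,2)
proof (induction N arbitrary: s h)
  case 0
  show ?case by simp
next
  case (Suc N)
  define P where "P = (\<Prod>i<N. 1 + b (h/2/2^Suc i))"
  have P: "P \<ge> 1" unfolding P_def using nn by (intro prod_ge_1) auto
  have 1: "g s (h/2) \<le> P * (lev g N s (h/2) + (\<Sum>k<N. lev a k s (h/2)))"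
    unfolding P_def by (rule Suc.IH) (use Suc.prems(1) in \<open>auto intro!: Suc.prems(2)\<close>)
  have 2: "g (s+h/2) (h/2) \<le> P * (lev g N (s+h/2) (h/2) + (\<Sum>k<N. lev a k (s+h/2) (h/2)))"
    unfolding P_def by (rule Suc.IH) (use Suc.prems(1) in \<open>auto intro!: Suc.prems(2)\<close>)
  \<comment> \<open>The factor of the root is split off; the remaining ones are those of the two
    halves.\<close>
  have 3: "(\<Prod>i<Suc N. 1 + b (h/2^Suc i)) = (1 + b (h/2)) * P"
    unfolding P_def prod.lessThan_Suc_shift by (simp add: field_simps)
  have "g s h \<le> (1 + b (h/2)) * (g s (h/2) + g (s + h/2) (h/2)) + a s h"
    using Suc.prems(1) by (intro Suc.prems(2)) auto
  also have "\<dots> \<le> (1 + b (h/2)) * (P * (lev g N s (h/2) + (\<Sum>k<N. lev a k s (h/2)))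
       + P * (lev g N (s+h/2) (h/2) + (\<Sum>k<N. lev a k (s+h/2) (h/2)))) + ((1 + b (h/2)) * P) * a s h"
  proof (intro add_mono mult_left_mono 1 2)
    have "1 \<le> (1 + b (h/2)) * P" using mult_mono[of 1 "1 + b (h/2)" 1 P] P nn(3)[of "h/2"] by simp
    then show "a s h \<le> ((1 + b (h/2)) * P) * a s h"
      using nn(2)[of s h] by (metis mult_le_cancel_right1 not_less)
  qed (use nn in auto)
  also have "\<dots> = (\<Prod>i<Suc N. 1 + b (h/2^Suc i)) *
      (lev g (Suc N) s h + (\<Sum>k<Suc N. lev a k s h))"
    unfolding 3 sum.lessThan_Suc_shift by (simp add: algebra_simps sum.distrib)
  finally show ?case .
qed

text \<open>From \<open>1 + x \<le> exp x\<close> and a geometric series of ratio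
  \<open>2 powr - \<gamma>\<close>, so that the bound does not depend on the depth
  \<open>N\<close>.\<close>

lemma prod_le_exp_geom:
  fixes c \<gamma> h :: real
  assumes "c \<ge> 0" "\<gamma> > 0" "h > 0"
  shows "(\<Prod>i<N. 1 + c * (h/2^Suc i) powr \<gamma>) \<le> exp (c * h powr \<gamma> / (1 - 2 powr - \<gamma>))"
proof -
  define x where "x = 2 powr - \<gamma>"
  have x: "0 < x" "x < 1" using assms by (auto simp: x_def powr_less_one)
  have e: "(h/2^Suc i) powr \<gamma> = h powr \<gamma> * x ^ Suc i" for i
  proof -
    have "((2::real) ^ Suc i) powr \<gamma> = 2 powr (\<gamma> * real (Suc i))"
      using powr_realpow[of 2 "Suc i"] by (metis mult.commute powr_powr zero_less_numeral)
    moreover have "x ^ Suc i = 2 powr - (\<gamma> * real (Suc i))"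
      unfolding x_def by (subst powr_realpow[symmetric]) (auto simp: powr_powr)
    ultimately show ?thesis using assms by (simp add: powr_divide del: power_Suc) (simp add: powr_minus divide_inverse)
  qed
  have "(\<Prod>i<N. 1 + c * (h/2^Suc i) powr \<gamma>) \<le> (\<Prod>i<N. exp (c * (h/2^Suc i) powr \<gamma>))"
    using assms by (intro prod_mono) (auto intro: add_nonneg_nonneg)
  also have "\<dots> = exp (\<Sum>i<N. c * h powr \<gamma> * x * x ^ i)"
    unfolding e by (simp add: exp_sum mult_ac)
  also have "(\<Sum>i<N. c * h powr \<gamma> * x * x ^ i) = c * h powr \<gamma> * x * ((1 - x^N) / (1 - x))"
    unfolding sum_distrib_left[symmetric] using x by (simp add: sum_gp_strict)
  also have "\<dots> \<le> c * h powr \<gamma> * 1 * (1 / (1 - x))"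
    using x assms by (intro mult_mono divide_right_mono) (auto intro!: divide_nonneg_pos power_le_one)
  finally show ?thesis by (simp add: x_def)
qed

subsection \<open>Remainders along a driven path\<close>

text \<open>Cauchy-Schwarz in each row; the norm on matrices is the Euclidean norm of all
  entries.\<close>

lemma norm_matrix_vector_mult_le: "norm (A *v x) \<le> norm A * norm x" for A :: "real^'n^'m"
proof -
  have "norm (A *v x) \<le> L2_set (\<lambda>i. norm (A $ i) * norm x) UNIV"
    unfolding norm_vec_def[of "A *v x"]
    by (rule L2_set_mono) (auto simp: matrix_vector_mul_component Cauchy_Schwarz_ineq2)
  also have "\<dots> = norm A * norm x"
    by (simp add: L2_set_left_distrib[symmetric] norm_vec_def)
  finally show ?thesis .
qed

lemma bounded_bilinear_matrix_vector_mult: "bounded_bilinear ((*v) :: real^'n^'m \<Rightarrow> real^'n \<Rightarrow> real^'m)"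
  by unfold_locales (auto simp: matrix_vector_right_distrib matrix_vector_mult_add_rdistrib
      scaleR_matrix_vector_assoc matrix_vector_mult_scaleR intro!: exI[of _ 1] norm_matrix_vector_mult_le)

lemma tendsto_0_le_real:
  fixes f g :: "nat \<Rightarrow> real"
  assumes "\<And>n. 0 \<le> f n" "\<And>n. f n \<le> g n" "g \<longlonglongrightarrow> 0"
  shows "f \<longlonglongrightarrow> 0"
  by (rule tendsto_sandwich[of "\<lambda>_. 0" f sequentially g]) (use assms in auto)

lemma suminf_tail_tendsto_0:
  fixes c :: "nat \<Rightarrow> real"
  assumes "summable c"
  shows "(\<lambda>N. suminf c - (\<Sum>k<N. c k)) \<longlonglongrightarrow> 0"
  using tendsto_diff[OF tendsto_const summable_LIMSEQ[OF assms], of "suminf c"] by simp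

lemma mult_le_sum_squares:
  fixes x y :: real
  assumes "0 \<le> x" "0 \<le> y"
  shows "x * y \<le> x\<^sup>2 + y\<^sup>2"
  using sum_squares_bound[of x y] mult_nonneg_nonneg[OF assms] by linarith

definition dpow :: "real \<Rightarrow> (real \<Rightarrow> 'a::real_normed_vector) \<Rightarrow> real \<Rightarrow> real \<Rightarrow> real" where
  "dpow r X s h = norm (X (s + h) - X s) powr r"

lemma dpow_nonneg [simp]: "0 \<le> dpow r X s h"
  by (simp add: dpow_def)

lemma dpow_2: "dpow 2 X s h = (norm (X (s + h) - X s))\<^sup>2"
  by (simp add: dpow_def)

text \<open>Partial sums replace a series, so no summability has to be carried along. Level 0 is
  included, which makes the bound contain a Hoelder estimate of exponent
  \<open>\<gamma>\<close>.\<close>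

definition dyadic_var :: "real \<Rightarrow> real \<Rightarrow> real \<Rightarrow> real \<Rightarrow> (real \<Rightarrow> 'a::real_normed_vector) \<Rightarrow> bool" where
  "dyadic_var T r \<gamma> C X \<longleftrightarrow> (\<forall>s h N. 0 \<le> s \<and> 0 < h \<and> s + h \<le> T \<longrightarrow>
     (\<Sum>k<N. lev (dpow r X) k s h) \<le> C * h powr (r * \<gamma>))"

lemma dyadic_var_sum:
  "dyadic_var T r \<gamma> C X \<Longrightarrow> 0 \<le> s \<Longrightarrow> 0 < h \<Longrightarrow> s + h \<le> T \<Longrightarrow>
    (\<Sum>k<N. lev (dpow r X) k s h) \<le> C * h powr (r * \<gamma>)"
  unfolding dyadic_var_def by blast

lemma dyadic_var_sum_Suc:
  assumes "dyadic_var T r \<gamma> C X" "0 \<le> s" "0 < h" "s + h \<le> T"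
  shows "(\<Sum>k<N. lev (dpow r X) (Suc k) s h) \<le> C * h powr (r * \<gamma>)"
  using dyadic_var_sum[OF assms, of "Suc N"] unfolding sum.lessThan_Suc_shift
  by (rule order_trans[rotated]) simp

lemma dyadic_var_hoelder:
  assumes "dyadic_var T 2 \<gamma> C X" "0 \<le> s" "0 < h" "s + h \<le> T"
  shows "norm (X (s + h) - X s) \<le> sqrt C * h powr \<gamma>"
proof -
  have "(norm (X (s + h) - X s))\<^sup>2 \<le> C * h powr (2 * \<gamma>)"
    using dyadic_var_sum[OF assms, of 1] by (simp add: dpow_2)
  also have "h powr (2 * \<gamma>) = (h powr \<gamma>)\<^sup>2"
    using assms by (simp add: powr_add[symmetric] power2_eq_square)
  finally show ?thesis
    by (metis norm_ge_zero powr_ge_zero real_le_rsqrt real_sqrt_mult real_sqrt_abs abs_of_nonneg)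
qed

lemma dyadic_var_nonneg:
  assumes "dyadic_var T r \<gamma> C X" "0 < T"
  shows "0 \<le> C"
proof -
  have "0 \<le> C * T powr (r * \<gamma>)"
    using dyadic_var_sum[OF assms(1), of 0 T 0] assms(2) by simp
  then show ?thesis using assms(2) by (simp add: zero_le_mult_iff)
qed

definition rem :: "(real^'m \<Rightarrow> real^'n^'m) \<Rightarrow> (real \<Rightarrow> real^'n) \<Rightarrow> (real \<Rightarrow> real^'m) \<Rightarrow> real \<Rightarrow> real \<Rightarrow> real^'m" where
  "rem f X Y s h = Y (s + h) - Y s - f (Y s) *v (X (s + h) - X s)"

lemma rem_midpoint:
  "rem f X Y s h = rem f X Y s (h/2) + rem f X Y (s + h/2) (h/2)
     + (f (Y (s + h/2)) - f (Y s)) *v (X (s + h) - X (s + h/2))"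
  by (simp add: rem_def algebra_simps matrix_vector_mult_diff_distrib matrix_vector_mult_diff_rdistrib)

text \<open>The length h = T is excluded: the only left endpoint is then 0, and an L^{p/2} norm over
  \<open>[0, 0]\<close> does not see the remainder there. Shorter intervals suffice for all later
  conclusions.\<close>

definition sewn :: "real \<Rightarrow> (real \<Rightarrow> real \<Rightarrow> 'a::real_normed_vector) \<Rightarrow> bool" where
  "sewn T R \<longleftrightarrow> (\<forall>s h. 0 \<le> s \<and> 0 < h \<and> s + h \<le> T \<and> h < T \<longrightarrow>
      (\<lambda>k. lev (\<lambda>s h. norm (R s h)) k s h) \<longlonglongrightarrow> 0)"

locale bounded_lipschitz =
  fixes f :: "real^'m \<Rightarrow> real^'n^'m" and F :: real
  assumes bound: "norm (f x) \<le> F" and lipschitz: "norm (f x - f y) \<le> F * norm (x - y)"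
begin

lemma F_nonneg: "F \<ge> 0"
  using bound[of 0] norm_ge_zero order_trans by blast

lemma rem_le_levels:
  fixes X :: "real \<Rightarrow> real^'n" and Y :: "real \<Rightarrow> real^'m"
  assumes X: "dyadic_var T 2 \<gamma> C X" and "\<gamma> > 0" "0 \<le> s" "0 < h" "s + h \<le> T"
  shows "norm (rem f X Y s h) \<le> exp (F * sqrt C * T powr \<gamma> / (1 - 2 powr - \<gamma>)) *
    (lev (\<lambda>s h. norm (rem f X Y s h)) N s h + F\<^sup>2 * (\<Sum>k<N. lev (dpow 2 X) (Suc k) s h))"
proof -
  let ?R = "rem f X Y" and ?b = "\<lambda>h. F * sqrt C * h powr \<gamma>"
  \<comment> \<open>The midpoint defect contains the product of the increments of \<open>X\<close>
    over the two halves. Bounding it by the sum of their squares gives a level-1 sum, hence the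
    index \<open>Suc k\<close> in the statement.\<close>
  let ?a = "\<lambda>s h. F\<^sup>2 * lev (dpow 2 X) 1 s h"
  have T: "T > 0" using assms by auto
  have C: "C \<ge> 0" using dyadic_var_nonneg[OF X T] .
  have step: "norm (?R s' h') \<le> (1 + ?b (h'/2)) * (norm (?R s' (h'/2)) + norm (?R (s' + h'/2) (h'/2))) + ?a s' h'"
    if "s \<le> s'" "s' + h' \<le> s + h" "0 < h'" for s' h'
  proof -
    define x y where "x = norm (X (s' + h'/2) - X s')" and "y = norm (X (s' + h') - X (s' + h'/2))"
    let ?u = "s' + h'/2"
    \<comment> \<open>Hoelder continuity is spent on the right half only; it supplies the Gronwall
      coefficient.\<close>
    have y: "y \<le> sqrt C * (h'/2) powr \<gamma>"
      using dyadic_var_hoelder[OF X, of ?u "h'/2"] that assms by (simp add: y_def add_ac)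
    have Yn: "norm (Y ?u - Y s') \<le> F * x + norm (?R s' (h'/2))"
    proof -
      have "Y ?u - Y s' = ?R s' (h'/2) + f (Y s') *v (X ?u - X s')" by (simp add: rem_def)
      then have "norm (Y ?u - Y s') \<le> norm (?R s' (h'/2)) + norm (f (Y s') *v (X ?u - X s'))"
        by (metis norm_triangle_ineq)
      also have "norm (f (Y s') *v (X ?u - X s')) \<le> F * x"
        using norm_matrix_vector_mult_le[of "f (Y s')" "X ?u - X s'"] mult_right_mono[OF bound norm_ge_zero]
        unfolding x_def by (rule order_trans)
      finally show ?thesis by simp
    qed
    have "norm ((f (Y ?u) - f (Y s')) *v (X (s' + h') - X ?u)) \<le> norm (f (Y ?u) - f (Y s')) * y"
      unfolding y_def by (rule norm_matrix_vector_mult_le)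
    also have "\<dots> \<le> (F * norm (Y ?u - Y s')) * y"
      by (intro mult_right_mono lipschitz) (simp add: y_def)
    also have "\<dots> \<le> (F * (F * x + norm (?R s' (h'/2)))) * y"
      by (intro mult_right_mono mult_left_mono Yn F_nonneg) (simp add: y_def)
    also have "\<dots> = F\<^sup>2 * (x * y) + F * y * norm (?R s' (h'/2))"
      by (simp add: algebra_simps power2_eq_square)
    also have "\<dots> \<le> F\<^sup>2 * (x\<^sup>2 + y\<^sup>2) + ?b (h'/2) * norm (?R s' (h'/2))"
    proof (intro add_mono mult_left_mono mult_right_mono)
      show "x * y \<le> x\<^sup>2 + y\<^sup>2"
        by (rule mult_le_sum_squares) (simp_all add: x_def y_def)
      show "F * y \<le> F * sqrt C * (h'/2) powr \<gamma>"
        using mult_left_mono[OF y F_nonneg] by (simp add: mult.assoc)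
    qed auto
    finally have *: "norm ((f (Y ?u) - f (Y s')) *v (X (s' + h') - X ?u)) \<le>
       F\<^sup>2 * (x\<^sup>2 + y\<^sup>2) + ?b (h'/2) * norm (?R s' (h'/2))" .
    have "norm (?R s' h') \<le> norm (?R s' (h'/2)) + norm (?R ?u (h'/2)) +
       norm ((f (Y ?u) - f (Y s')) *v (X (s' + h') - X ?u))"
      unfolding rem_midpoint[of f X Y s' h'] by (intro norm_triangle_mono order_refl)
    moreover have "?a s' h' = F\<^sup>2 * (x\<^sup>2 + y\<^sup>2)"
      by (simp add: dpow_2 x_def y_def add_ac)
    \<comment> \<open>Only the left remainder carries the coefficient; adding this nonnegative term
      gives the symmetric form that \<open>tree_bound\<close> expects.\<close>
    moreover have "0 \<le> ?b (h'/2) * norm (?R ?u (h'/2))"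
      using F_nonneg C by simp
    ultimately show ?thesis using * by (simp add: algebra_simps)
  qed
  have nn: "0 \<le> lev (\<lambda>s h. norm (?R s h)) N s h + (\<Sum>k<N. lev ?a k s h)"
    by (intro add_nonneg_nonneg lev_nonneg sum_nonneg mult_nonneg_nonneg) auto
  have "norm (?R s h) \<le> (\<Prod>i<N. 1 + ?b (h/2^Suc i)) *
      (lev (\<lambda>s h. norm (?R s h)) N s h + (\<Sum>k<N. lev ?a k s h))"
    by (rule tree_bound) (use assms F_nonneg C step in \<open>auto intro!: mult_nonneg_nonneg lev_nonneg add_nonneg_nonneg\<close>)
  also have "\<dots> \<le> exp (F * sqrt C * T powr \<gamma> / (1 - 2 powr - \<gamma>)) *
      (lev (\<lambda>s h. norm (?R s h)) N s h + (\<Sum>k<N. lev ?a k s h))"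
  proof (rule mult_right_mono[OF _ nn])
    have "(\<Prod>i<N. 1 + ?b (h/2^Suc i)) \<le> exp (F * sqrt C * h powr \<gamma> / (1 - 2 powr - \<gamma>))"
      using prod_le_exp_geom[of "F * sqrt C" \<gamma> h N] F_nonneg C assms by simp
    also have "\<dots> \<le> exp (F * sqrt C * T powr \<gamma> / (1 - 2 powr - \<gamma>))"
      using assms F_nonneg C
      by (auto intro!: divide_right_mono mult_left_mono powr_mono2 simp: powr_less_one less_imp_le)
    finally show "(\<Prod>i<N. 1 + ?b (h/2^Suc i)) \<le> exp (F * sqrt C * T powr \<gamma> / (1 - 2 powr - \<gamma>))" .
  qed
  also have "(\<Sum>k<N. lev ?a k s h) = F\<^sup>2 * (\<Sum>k<N. lev (dpow 2 X) (Suc k) s h)"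
    unfolding lev_cmult lev_lev by (simp add: sum_distrib_left)
  finally show ?thesis .
qed

end

section \<open>Comparison of two solutions\<close>

lemma powr_mult_le_add:
  fixes x y \<delta> :: real
  assumes "0 \<le> x" "0 \<le> y" "0 < \<delta>"
  shows "x powr \<delta> * y \<le> x powr (1 + \<delta>) + y powr (1 + \<delta>)"
proof -
  define m where "m = max x y"
  have "x powr \<delta> * y \<le> m powr \<delta> * m"
    using assms by (intro mult_mono powr_mono2) (auto simp: m_def)
  also have "\<dots> = m powr (1 + \<delta>)"
    using assms by (cases "m = 0") (auto simp: powr_add m_def max_def split: if_splits)
  also have "\<dots> \<le> x powr (1 + \<delta>) + y powr (1 + \<delta>)"
    by (auto simp: m_def max_def)
  finally show ?thesis .
qed

text \<open>\<open>four_point\<close> is the form in which Hoelder continuity of the derivative is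
  used: a second difference of \<open>f\<close> is linear in the difference of the two increments,
  up to a term that is linear in the initial distance \<open>a - b\<close>. Linearity in this
  distance is what lets a contraction argument work.\<close>

locale bounded_hoelder = bounded_lipschitz f F
  for f :: "real^'m \<Rightarrow> real^'n^'m" and F +
  fixes \<delta> L :: real
  assumes \<delta>: "0 < \<delta>" and L: "0 \<le> L"
    and four_point: "norm (f a' - f b' - (f a - f b)) \<le>
      F * norm ((a' - b') - (a - b)) + L * norm (a - b) * (norm (a' - a) powr \<delta> + norm (b' - b) powr \<delta>)"
begin

abbreviation "r \<equiv> 1 + \<delta>"

text \<open>The tree argument for the difference of remainders. At a bisection the first term of
  \<open>four_point\<close> reproduces this difference over the left half, which the Gronwall factor
  absorbs; every other term carries the factor \<open>\<zeta>\<close>, a bound for the distance of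
  the paths on \<open>[0, b]\<close>. The products |dY|^\<delta> |dX| are split into powers
  \<open>1 + \<delta>\<close>, so dyadic sums of exponent \<open>r\<close> of both solutions
  appear.\<close>

lemma rem_diff_le_levels:
  fixes X :: "real \<Rightarrow> real^'n" and Y Y' :: "real \<Rightarrow> real^'m"
  assumes X: "dyadic_var T 2 \<gamma> C X" and "\<gamma> > 0" "0 \<le> s" "0 < h" "s + h \<le> b" "b \<le> T"
    and \<zeta>: "\<And>t. 0 \<le> t \<Longrightarrow> t \<le> b \<Longrightarrow> norm (Y t - Y' t) \<le> \<zeta>"
  shows "norm (rem f X Y s h - rem f X Y' s h) \<le> exp (F * sqrt C * T powr \<gamma> / (1 - 2 powr - \<gamma>)) *
    (lev (\<lambda>s h. norm (rem f X Y s h - rem f X Y' s h)) N s h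
      + \<zeta> * (F\<^sup>2 * (\<Sum>k<N. lev (dpow 2 X) (Suc k) s h) + L * ((\<Sum>k<N. lev (dpow r Y) (Suc k) s h) +
        (\<Sum>k<N. lev (dpow r Y') (Suc k) s h) + 2 * (\<Sum>k<N. lev (dpow r X) (Suc k) s h))))"
proof -
  let ?S = "\<lambda>s h. rem f X Y s h - rem f X Y' s h" and ?b = "\<lambda>h. F * sqrt C * h powr \<gamma>"
  let ?a = "\<lambda>s h. \<zeta> * (F\<^sup>2 * lev (dpow 2 X) 1 s h + L * (lev (dpow r Y) 1 s h + lev (dpow r Y') 1 s h + 2 * lev (dpow r X) 1 s h))"
  have T: "T > 0" using assms by auto
  have C: "C \<ge> 0" using dyadic_var_nonneg[OF X T] .
  have \<zeta>0: "\<zeta> \<ge> 0" using order_trans[OF norm_ge_zero \<zeta>[of 0]] assms by auto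
  have step: "norm (?S s' h') \<le> (1 + ?b (h'/2)) * (norm (?S s' (h'/2)) + norm (?S (s' + h'/2) (h'/2))) + ?a s' h'"
    if "s \<le> s'" "s' + h' \<le> s + h" "0 < h'" for s' h'
  proof -
    define u v where "u = s' + h'/2" and "v = s' + h'"
    define x y where "x = norm (X u - X s')" and "y = norm (X v - X u)"
    define z z' where "z = norm (Y u - Y s')" and "z' = norm (Y' u - Y' s')"
    have nn: "0 \<le> x" "0 \<le> y" "0 \<le> z" "0 \<le> z'" by (auto simp: x_def y_def z_def z'_def)
    have y: "y \<le> sqrt C * (h'/2) powr \<gamma>"
      using dyadic_var_hoelder[OF X, of u "h'/2"] that assms by (simp add: y_def u_def v_def add_ac)
    have \<zeta>s: "norm (Y s' - Y' s') \<le> \<zeta>" by (rule \<zeta>) (use that assms in auto)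
    define D where "D = norm ((Y u - Y' u) - (Y s' - Y' s'))"
    have D: "D \<le> F * \<zeta> * x + norm (?S s' (h'/2))"
    proof -
      \<comment> \<open>The difference of the increments is the difference of the remainders plus a
        first-order term, and the latter is already proportional to \<open>\<zeta>\<close>.\<close>
      have "(Y u - Y' u) - (Y s' - Y' s') = ?S s' (h'/2) + (f (Y s') - f (Y' s')) *v (X u - X s')"
        by (simp add: rem_def u_def matrix_vector_mult_diff_rdistrib)
      then have "D \<le> norm (?S s' (h'/2)) + norm ((f (Y s') - f (Y' s')) *v (X u - X s'))"
        unfolding D_def by (metis norm_triangle_ineq)
      also have "norm ((f (Y s') - f (Y' s')) *v (X u - X s')) \<le> norm (f (Y s') - f (Y' s')) * x"
        unfolding x_def by (rule norm_matrix_vector_mult_le)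
      also have "\<dots> \<le> F * \<zeta> * x"
        using lipschitz[of "Y s'" "Y' s'"] mult_left_mono[OF \<zeta>s F_nonneg] nn by (intro mult_right_mono) auto
      finally show ?thesis by simp
    qed
    define W where "W = (f (Y u) - f (Y' u) - (f (Y s') - f (Y' s'))) *v (X v - X u)"
    have "norm W \<le> norm (f (Y u) - f (Y' u) - (f (Y s') - f (Y' s'))) * y"
      unfolding W_def y_def by (rule norm_matrix_vector_mult_le)
    also have "\<dots> \<le> (F * D + L * norm (Y s' - Y' s') * (z powr \<delta> + z' powr \<delta>)) * y"
      using four_point[of "Y u" "Y' u" "Y s'" "Y' s'"] nn unfolding D_def z_def z'_def by (intro mult_right_mono)
    also have "\<dots> \<le> (F * (F * \<zeta> * x + norm (?S s' (h'/2))) + L * \<zeta> * (z powr \<delta> + z' powr \<delta>)) * y"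
      using F_nonneg L nn D \<zeta>s by (intro mult_right_mono add_mono mult_left_mono) auto
    also have "\<dots> = (\<zeta> * F\<^sup>2) * (x * y) + (F * y) * norm (?S s' (h'/2)) + L * \<zeta> * (z powr \<delta> * y + z' powr \<delta> * y)"
      by (simp add: algebra_simps power2_eq_square)
    also have "\<dots> \<le> (\<zeta> * F\<^sup>2) * (x\<^sup>2 + y\<^sup>2) + ?b (h'/2) * norm (?S s' (h'/2)) +
        L * \<zeta> * ((z powr r + y powr r) + (z' powr r + y powr r))"
    proof (intro add_mono mult_left_mono mult_right_mono powr_mult_le_add nn \<delta>)
      show "x * y \<le> x\<^sup>2 + y\<^sup>2"
        by (rule mult_le_sum_squares) (rule nn)+
      show "F * y \<le> F * sqrt C * (h'/2) powr \<gamma>"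
        using mult_left_mono[OF y F_nonneg] by (simp add: mult.assoc)
    qed (use \<zeta>0 L in auto)
    also have "\<dots> = ?b (h'/2) * norm (?S s' (h'/2)) + \<zeta> * (F\<^sup>2 * (x\<^sup>2 + y\<^sup>2) + L * (z powr r + z' powr r + 2 * y powr r))"
      by (simp add: algebra_simps)
    also have "\<dots> \<le> ?b (h'/2) * norm (?S s' (h'/2)) + ?a s' h'"
      using \<zeta>0 L nn by (intro add_left_mono mult_left_mono add_mono)
        (auto simp: dpow_2 x_def y_def u_def v_def z_def z'_def dpow_def add_ac)
    finally have *: "norm W \<le> ?b (h'/2) * norm (?S s' (h'/2)) + ?a s' h'" .
    have "?S s' h' = ?S s' (h'/2) + ?S u (h'/2) + W"
      unfolding rem_midpoint[of f X Y s' h'] rem_midpoint[of f X Y' s' h']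
      by (simp add: u_def v_def W_def algebra_simps matrix_vector_mult_diff_rdistrib)
    then have "norm (?S s' h') \<le> norm (?S s' (h'/2)) + norm (?S u (h'/2)) + norm W"
      by (simp add: norm_triangle_mono)
    moreover have "0 \<le> ?b (h'/2) * norm (?S u (h'/2))"
      using F_nonneg C by simp
    ultimately show ?thesis using * unfolding u_def by (simp add: distrib_left distrib_right)
  qed
  have a0: "?a s h \<ge> 0" for s h
    using \<zeta>0 L by (intro mult_nonneg_nonneg add_nonneg_nonneg lev_nonneg) auto
  have nn: "0 \<le> lev (\<lambda>s h. norm (?S s h)) N s h + (\<Sum>k<N. lev ?a k s h)"
    using a0 by (intro add_nonneg_nonneg lev_nonneg sum_nonneg) auto
  have "norm (?S s h) \<le> (\<Prod>i<N. 1 + ?b (h/2^Suc i)) *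
      (lev (\<lambda>s h. norm (?S s h)) N s h + (\<Sum>k<N. lev ?a k s h))"
  proof (rule tree_bound[OF _ step])
    show "0 \<le> ?a s h" for s h by (rule a0)
    show "0 \<le> ?b h" for h using F_nonneg C by simp
  qed (use assms in auto)
  also have "\<dots> \<le> exp (F * sqrt C * T powr \<gamma> / (1 - 2 powr - \<gamma>)) *
      (lev (\<lambda>s h. norm (?S s h)) N s h + (\<Sum>k<N. lev ?a k s h))"
  proof (rule mult_right_mono[OF _ nn])
    have "(\<Prod>i<N. 1 + ?b (h/2^Suc i)) \<le> exp (F * sqrt C * h powr \<gamma> / (1 - 2 powr - \<gamma>))"
      using prod_le_exp_geom[of "F * sqrt C" \<gamma> h N] F_nonneg C assms by simp
    also have "\<dots> \<le> exp (F * sqrt C * T powr \<gamma> / (1 - 2 powr - \<gamma>))"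
      using assms F_nonneg C
      by (auto intro!: divide_right_mono mult_left_mono powr_mono2 simp: powr_less_one less_imp_le)
    finally show "(\<Prod>i<N. 1 + ?b (h/2^Suc i)) \<le> exp (F * sqrt C * T powr \<gamma> / (1 - 2 powr - \<gamma>))" .
  qed
  also have "(\<Sum>k<N. lev ?a k s h) = \<zeta> * (F\<^sup>2 * (\<Sum>k<N. lev (dpow 2 X) (Suc k) s h) + L * ((\<Sum>k<N. lev (dpow r Y) (Suc k) s h) +
        (\<Sum>k<N. lev (dpow r Y') (Suc k) s h) + 2 * (\<Sum>k<N. lev (dpow r X) (Suc k) s h)))"
    unfolding lev_cmult lev_add lev_lev by (simp add: sum.distrib del: lev.simps flip: sum_distrib_left)
  finally show ?thesis .
qed

text \<open>An increment of \<open>Y - Y'\<close> over a length h is at most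
  \<open>\<zeta> * B h\<close> with \<open>B h\<close> tending to 0, where \<open>\<zeta>\<close>
  bounds the distance on the interval considered. Marching in steps with \<open>B h < 1/2\<close>
  forces the distance to vanish on one step after another.\<close>

lemma solution_unique:
  fixes X :: "real \<Rightarrow> real^'n" and Y Y' :: "real \<Rightarrow> real^'m"
  assumes "0 < T" "0 < \<gamma>" and X: "dyadic_var T 2 \<gamma> C X" "dyadic_var T r \<gamma> C1 X"
    and Y: "dyadic_var T r \<gamma> C2 Y" "continuous_on {0..T} Y" "sewn T (rem f X Y)"
    and Y': "dyadic_var T r \<gamma> C3 Y'" "continuous_on {0..T} Y'" "sewn T (rem f X Y')"
    and "Y 0 = Y' 0" "t \<in> {0..T}"
  shows "Y t = Y' t"
proof -
  let ?S = "\<lambda>s h. rem f X Y s h - rem f X Y' s h"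
  define P where "P = exp (F * sqrt C * T powr \<gamma> / (1 - 2 powr - \<gamma>))"
  define B where "B h = P * (F\<^sup>2 * (C * h powr (2 * \<gamma>)) + L * (C2 * h powr (r * \<gamma>) + C3 * h powr (r * \<gamma>) + 2 * (C1 * h powr (r * \<gamma>))))
      + F * (sqrt C * h powr \<gamma>)" for h
  have incr: "norm ((Y (s + h) - Y' (s + h)) - (Y s - Y' s)) \<le> \<zeta> * B h"
    if "0 \<le> s" "0 < h" "s + h \<le> b" "b \<le> T" "h < T"
      "\<And>t. 0 \<le> t \<Longrightarrow> t \<le> b \<Longrightarrow> norm (Y t - Y' t) \<le> \<zeta>" for s h b \<zeta>
  proof -
    have sT: "s + h \<le> T" using that by auto
    have \<zeta>0: "\<zeta> \<ge> 0" using order_trans[OF norm_ge_zero that(6)[of 0]] that by auto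
    define Q where "Q = \<zeta> * (F\<^sup>2 * (C * h powr (2 * \<gamma>)) + L * (C2 * h powr (r * \<gamma>) + C3 * h powr (r * \<gamma>) + 2 * (C1 * h powr (r * \<gamma>))))"
    have "norm (?S s h) \<le> P * (lev (\<lambda>s h. norm (?S s h)) N s h + Q)" for N
    proof -
      have "norm (?S s h) \<le> P * (lev (\<lambda>s h. norm (?S s h)) N s h
        + \<zeta> * (F\<^sup>2 * (\<Sum>k<N. lev (dpow 2 X) (Suc k) s h) + L * ((\<Sum>k<N. lev (dpow r Y) (Suc k) s h) +
        (\<Sum>k<N. lev (dpow r Y') (Suc k) s h) + 2 * (\<Sum>k<N. lev (dpow r X) (Suc k) s h))))"
        unfolding P_def by (rule rem_diff_le_levels[OF X(1) assms(2) that(1-4,6)])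
      also have "\<dots> \<le> P * (lev (\<lambda>s h. norm (?S s h)) N s h + Q)"
        unfolding Q_def
        by (intro mult_left_mono add_mono dyadic_var_sum_Suc[OF X(1) that(1,2) sT] dyadic_var_sum_Suc[OF X(2) that(1,2) sT]
             dyadic_var_sum_Suc[OF Y(1) that(1,2) sT] dyadic_var_sum_Suc[OF Y'(1) that(1,2) sT] \<zeta>0 L order_refl)
             (auto simp: P_def)
      finally show ?thesis .
    qed
    moreover have "(\<lambda>N. P * (lev (\<lambda>s h. norm (?S s h)) N s h + Q)) \<longlonglongrightarrow> P * (0 + Q)"
    proof (intro tendsto_intros)
      have "(\<lambda>N. lev (\<lambda>s h. norm (rem f X Y s h)) N s h + lev (\<lambda>s h. norm (rem f X Y' s h)) N s h) \<longlonglongrightarrow> 0 + 0"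
        using Y(3) Y'(3) that sT unfolding sewn_def by (intro tendsto_add) auto
      then show "(\<lambda>N. lev (\<lambda>s h. norm (?S s h)) N s h) \<longlonglongrightarrow> 0"
        unfolding add_0
        by (rule tendsto_sandwich[OF always_eventually always_eventually tendsto_const, rotated 2])
           (auto simp: lev_add[symmetric] intro!: lev_nonneg lev_mono[OF that(2)] norm_triangle_ineq4)
    qed
    ultimately have S: "norm (?S s h) \<le> P * Q"
      by (intro LIMSEQ_le_const) auto
    have "(Y (s + h) - Y' (s + h)) - (Y s - Y' s) = ?S s h + (f (Y s) - f (Y' s)) *v (X (s + h) - X s)"
      by (simp add: rem_def matrix_vector_mult_diff_rdistrib)
    then have "norm ((Y (s + h) - Y' (s + h)) - (Y s - Y' s)) \<le> norm (?S s h) + norm ((f (Y s) - f (Y' s)) *v (X (s + h) - X s))"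
      by (metis norm_triangle_ineq)
    also have "norm ((f (Y s) - f (Y' s)) *v (X (s + h) - X s)) \<le> norm (f (Y s) - f (Y' s)) * norm (X (s + h) - X s)"
      by (rule norm_matrix_vector_mult_le)
    also have "\<dots> \<le> (F * \<zeta>) * (sqrt C * h powr \<gamma>)"
    proof (intro mult_mono dyadic_var_hoelder[OF X(1)])
      show "norm (f (Y s) - f (Y' s)) \<le> F * \<zeta>"
        using lipschitz[of "Y s" "Y' s"] mult_left_mono[OF that(6)[of s] F_nonneg] that by auto
    qed (use that \<zeta>0 F_nonneg sT in auto)
    finally show ?thesis using S unfolding B_def Q_def by (simp add: algebra_simps)
  qed
  have "(B \<longlongrightarrow> P * (F\<^sup>2 * (C * 0) + L * (C2 * 0 + C3 * 0 + 2 * (C1 * 0))) + F * (sqrt C * 0)) (at_right 0)"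
  proof -
    have *: "((\<lambda>h. h powr \<beta>) \<longlongrightarrow> 0) (at_right 0)" if "\<beta> > 0" for \<beta> :: real
      using that by real_asymp
    show ?thesis unfolding B_def
      by (intro tendsto_intros * mult_pos_pos) (use assms(2) \<delta> in auto)
  qed
  then have "\<forall>\<^sub>F h in at_right 0. B h < 1/2"
    by (intro order_tendstoD(2)) auto
  then obtain d where d: "d > 0" "\<And>h. 0 < h \<Longrightarrow> h < d \<Longrightarrow> B h < 1/2"
    unfolding eventually_at_right_field by auto
  \<comment> \<open>The step length \<open>a\<close> must be below \<open>d\<close>, for the factor
    1/2, and below \<open>T\<close>, since \<open>sewn\<close> excludes the full interval.\<close>
  obtain n :: nat where n: "T / min d T < real n" using reals_Archimedean2 by blast
  have "0 < T / min d T" using assms(1) d(1) by simp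
  then have n0: "n > 0" using n by (cases n) auto
  define a where "a = T / real n"
  have a: "0 < a" "a < d" "a < T"
  proof -
    have "0 < min d T" using d(1) assms(1) by simp
    then have "T < real n * min d T" using n by (simp only: pos_divide_less_eq)
    then have "a < min d T" using n0 by (simp only: a_def pos_divide_less_eq of_nat_0_less_iff mult.commute)
    then show "0 < a" "a < d" "a < T" using n0 assms(1) by (auto simp: a_def)
  qed
  have Z: "\<forall>t\<in>{0..real k * a}. Y t = Y' t" if "k \<le> n" for k
    using that
  proof (induction k)
    case (Suc k)
    define b where "b = real (Suc k) * a"
    have "b \<le> real n * a" using Suc.prems a unfolding b_def by (intro mult_right_mono) auto
    then have bT: "b \<le> T" "0 \<le> b" using a n0 by (auto simp: b_def a_def)
    have "continuous_on {0..b} (\<lambda>t. norm (Y t - Y' t))"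
      using bT by (intro continuous_intros continuous_on_subset[OF Y(2)] continuous_on_subset[OF Y'(2)]) auto
    then obtain m where m: "m \<in> {0..b}" "\<And>t. t \<in> {0..b} \<Longrightarrow> norm (Y t - Y' t) \<le> norm (Y m - Y' m)"
      using continuous_attains_sup[of "{0..b}" "\<lambda>t. norm (Y t - Y' t)"] bT by auto
    have "Y m = Y' m"
    proof (cases "m \<le> real k * a")
      case True
      then show ?thesis using Suc m by auto
    next
      case False
      \<comment> \<open>Starting from \<open>s\<close>, where the paths agree, the distance at its
        maximum point \<open>m\<close> is at most half of itself.\<close>
      define s h where "s = real k * a" and "h = m - s"
      have h: "0 < h" "h \<le> a" "s + h = m" "0 \<le> s"
        using False m a by (auto simp: h_def s_def b_def algebra_simps)
      have "Y s = Y' s" using Suc a by (auto simp: s_def)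
      then have "norm (Y m - Y' m) \<le> norm (Y m - Y' m) * B h"
        using incr[of s h b "norm (Y m - Y' m)"] h m bT a by auto
      also have "\<dots> \<le> norm (Y m - Y' m) * (1/2)"
        using d(2)[of h] h a by (intro mult_left_mono) auto
      finally show ?thesis by simp
    qed
    then show ?case using m(2) unfolding b_def by fastforce
  qed (use assms in auto)
  show ?thesis using Z[of n] assms(12) n0 by (simp add: a_def)
qed

end

subsection \<open>Functions with bounded derivatives\<close>

lemma Deriv_has_derivative:
  assumes "f differentiable (at x)"
  shows "(f has_derivative blinfun_apply (Deriv f x)) (at x within S)"
proof -
  have d: "(f has_derivative frechet_derivative f (at x)) (at x)"
    using assms frechet_derivative_works by blast
  then have "blinfun_apply (Deriv f x) = frechet_derivative f (at x)"
    unfolding Deriv_def by (intro bounded_linear_Blinfun_apply has_derivative_bounded_linear)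
  then show ?thesis using d has_derivative_at_withinI by metis
qed

lemma Lipschitz_of_Deriv_bound:
  assumes "\<And>x. f differentiable (at x)" "\<And>x. norm (Deriv f x) \<le> B"
  shows "norm (f x - f y) \<le> B * norm (x - y)"
  using differentiable_bound[of UNIV f "\<lambda>x. blinfun_apply (Deriv f x)" B x y]
    Deriv_has_derivative[OF assms(1)] assms(2) by (simp add: norm_blinfun.rep_eq)

lemma Cb1_bounds:
  assumes "Cb1 f"
  shows "norm (f x) \<le> C1_norm f" "norm (Deriv f x) \<le> C1_norm f" "norm (f x - f y) \<le> C1_norm f * norm (x - y)"
proof -
  have "bdd_above (range (\<lambda>x. norm (f x)))" "bdd_above (range (\<lambda>x. norm (Deriv f x)))"
    using assms unfolding Cb1_def bounded_iff bdd_above_def by auto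
  then have *: "norm (f x) \<le> (SUP x. norm (f x))" "norm (Deriv f x) \<le> (SUP x. norm (Deriv f x))" for x
    by (auto intro: cSUP_upper)
  have 0: "0 \<le> (SUP x. norm (f x))" "0 \<le> (SUP x. norm (Deriv f x))"
    using order_trans[OF norm_ge_zero *(1)] order_trans[OF norm_ge_zero *(2)] by auto
  show "norm (f x) \<le> C1_norm f" and b: "norm (Deriv f x) \<le> C1_norm f" for x
    using *[of x] 0 unfolding C1_norm_def by auto
  show "norm (f x - f y) \<le> C1_norm f * norm (x - y)"
    by (rule Lipschitz_of_Deriv_bound[OF _ b]) (use assms in \<open>simp add: Cb1_def\<close>)
qed

lemma Cb1_bounded_lipschitz: "Cb1 f \<Longrightarrow> bounded_lipschitz f (C1_norm f)"
  by unfold_locales (rule Cb1_bounds; assumption)+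

lemma Cb2_imp_Cb1_Hoelder: "Cb2 f \<Longrightarrow> Cb1_Hoelder 1 f"
  unfolding Cb2_def Cb1_Hoelder_def using Cb1_bounds(3)[of "Deriv f"] by auto

text \<open>Both pairs are joined by segments and \<open>G\<close> compares \<open>f\<close> along
  them, so the second difference is \<open>G 1 - G 0\<close>. The mean value inequality needs only a
  bound for the derivative \<open>V\<close>, and the difference between corresponding points of the
  segments is a convex combination of \<open>a' - a\<close> and \<open>b' - b\<close>.\<close>

lemma four_point_Hoelder:
  assumes f: "\<And>x. f differentiable (at x)" and B: "\<And>x. norm (Deriv f x) \<le> B"
    and L: "\<And>x y. norm (Deriv f x - Deriv f y) \<le> L * norm (x - y) powr \<delta>" "0 \<le> L" and \<delta>: "0 < \<delta>"
  shows "norm (f a' - f b' - (f a - f b)) \<le>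
    B * norm ((a' - b') - (a - b)) + L * norm (a - b) * (norm (a' - a) powr \<delta> + norm (b' - b) powr \<delta>)"
proof -
  define p p' where "p \<theta> = b + \<theta> *\<^sub>R (a - b)" and "p' \<theta> = b' + \<theta> *\<^sub>R (a' - b')" for \<theta> :: real
  define G where "G \<theta> = f (p' \<theta>) - f (p \<theta>)" for \<theta>
  define V where "V \<theta> = Deriv f (p' \<theta>) (a' - b') - Deriv f (p \<theta>) (a - b)" for \<theta>
  define K where "K = B * norm ((a' - b') - (a - b)) + L * norm (a - b) * (norm (a' - a) powr \<delta> + norm (b' - b) powr \<delta>)"
  have dp: "(p has_derivative (\<lambda>h. h *\<^sub>R (a - b))) (at \<theta> within S)"
    "(p' has_derivative (\<lambda>h. h *\<^sub>R (a' - b'))) (at \<theta> within S)" for \<theta> S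
    unfolding p_def[abs_def] p'_def[abs_def] by (auto intro!: derivative_eq_intros)
  have dG: "(G has_derivative (\<lambda>h. h *\<^sub>R V \<theta>)) (at \<theta> within S)" for \<theta> S
  proof -
    have "((\<lambda>\<theta>. f (p' \<theta>) - f (p \<theta>)) has_derivative
       (\<lambda>h. blinfun_apply (Deriv f (p' \<theta>)) (h *\<^sub>R (a' - b')) - blinfun_apply (Deriv f (p \<theta>)) (h *\<^sub>R (a - b)))) (at \<theta> within S)"
      by (intro has_derivative_diff has_derivative_compose[OF dp(1) Deriv_has_derivative[OF f]]
         has_derivative_compose[OF dp(2) Deriv_has_derivative[OF f]])
    then show ?thesis unfolding G_def[abs_def] V_def
      by (simp only: blinfun.scaleR_right scaleR_diff_right[symmetric])
  qed
  have V: "norm (V \<theta>) \<le> K" if "\<theta> \<in> {0..1}" for \<theta>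
  proof -
    \<comment> \<open>The split puts the Hoelder difference of the derivatives against
      \<open>a - b\<close> and the bounded derivative against the difference of the
      increments.\<close>
    have "V \<theta> = Deriv f (p' \<theta>) ((a' - b') - (a - b)) + (Deriv f (p' \<theta>) - Deriv f (p \<theta>)) (a - b)"
      by (simp add: V_def blinfun.diff_right blinfun.diff_left)
    then have "norm (V \<theta>) \<le> norm (Deriv f (p' \<theta>)) * norm ((a' - b') - (a - b)) + norm (Deriv f (p' \<theta>) - Deriv f (p \<theta>)) * norm (a - b)"
      by (simp add: norm_triangle_mono norm_blinfun)
    also have "\<dots> \<le> B * norm ((a' - b') - (a - b)) + (L * (norm (a' - a) powr \<delta> + norm (b' - b) powr \<delta>)) * norm (a - b)"
    proof (intro add_mono mult_right_mono B)
      have "p' \<theta> - p \<theta> = (1 - \<theta>) *\<^sub>R (b' - b) + \<theta> *\<^sub>R (a' - a)"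
        by (simp add: p_def p'_def algebra_simps)
      then have "norm (p' \<theta> - p \<theta>) \<le> (1 - \<theta>) * norm (b' - b) + \<theta> * norm (a' - a)"
        using that norm_triangle_ineq[of "(1 - \<theta>) *\<^sub>R (b' - b)" "\<theta> *\<^sub>R (a' - a)"] by simp
      also have "\<dots> \<le> max (norm (a' - a)) (norm (b' - b))"
        using that by (intro convex_bound_le) auto
      finally have "norm (p' \<theta> - p \<theta>) powr \<delta> \<le> max (norm (a' - a)) (norm (b' - b)) powr \<delta>"
        using \<delta> by (intro powr_mono2) auto
      also have "\<dots> \<le> norm (a' - a) powr \<delta> + norm (b' - b) powr \<delta>"
        by (simp add: max_def)
      finally show "norm (Deriv f (p' \<theta>) - Deriv f (p \<theta>)) \<le> L * (norm (a' - a) powr \<delta> + norm (b' - b) powr \<delta>)"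
        by (intro order_trans[OF L(1)] mult_left_mono L(2))
    qed auto
    finally show ?thesis by (simp add: K_def mult_ac)
  qed
  have "norm (G 1 - G 0) \<le> K * norm (1 - 0 :: real)"
  proof (rule differentiable_bound[of "{0..1}" G "\<lambda>\<theta> h. h *\<^sub>R V \<theta>" K 1 0])
    show "onorm (\<lambda>h. h *\<^sub>R V \<theta>) \<le> K" if "\<theta> \<in> {0..1}" for \<theta>
      using order_trans[OF norm_ge_zero V[OF that]] V[OF that]
      by (intro onorm_bound) (auto simp: mult.commute[of K] intro!: mult_left_mono)
  qed (use dG in auto)
  then show ?thesis by (simp add: G_def p_def p'_def K_def algebra_simps)
qed

lemma Cb1_Hoelder_bounded_hoelder:
  assumes "Cb1_Hoelder \<delta> f" "0 < \<delta>"
  obtains L where "bounded_hoelder f (C1_norm f) \<delta> L"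
proof -
  have c: "Cb1 f" using assms by (simp add: Cb1_Hoelder_def)
  obtain L where L: "\<And>x y. norm (Deriv f x - Deriv f y) \<le> L * norm (x - y) powr \<delta>"
    using assms unfolding Cb1_Hoelder_def by blast
  \<comment> \<open>The sign of the Hoelder constant is not part of
    \<open>Cb1_Hoelder\<close>.\<close>
  have L': "norm (Deriv f x - Deriv f y) \<le> max 0 L * norm (x - y) powr \<delta>" for x y
    by (rule order_trans[OF L mult_right_mono]) auto
  interpret bounded_lipschitz f "C1_norm f" by (rule Cb1_bounded_lipschitz[OF c])
  have "bounded_hoelder f (C1_norm f) \<delta> (max 0 L)"
    by unfold_locales (use assms four_point_Hoelder[OF _ Cb1_bounds(2)[OF c] L'] c in \<open>auto simp: Cb1_def\<close>)
  then show thesis by (rule that)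
qed

subsection \<open>Approximation by smooth drivers\<close>

context bounded_lipschitz
begin

lemma driven_ode_solution:
  fixes g :: "real \<Rightarrow> real^'n"
  assumes T: "0 < T" and g: "continuous_on {0..T} g"
  obtains Y where "continuous_on {0..T} Y" "\<And>t. t \<in> {0..T} \<Longrightarrow> Y t = y + integral {0..t} (\<lambda>s. f (Y s) *v g s)"
proof -
  obtain G where G: "\<And>s. s \<in> {0..T} \<Longrightarrow> norm (g s) \<le> G" "0 \<le> G"
  proof -
    have "bounded (g ` {0..T})"
      by (intro compact_imp_bounded compact_continuous_image g) simp
    then obtain G where "\<And>s. s \<in> {0..T} \<Longrightarrow> norm (g s) \<le> G" unfolding bounded_iff by blast
    then show thesis using T by (intro that[of G]) (auto intro: order_trans[OF norm_ge_zero, of "g 0"])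
  qed
  \<comment> \<open>The weight \<open>exp (- \<mu> t)\<close> makes the Picard map a contraction on all of \<open>[0, T]\<close> at once.\<close>
  define \<mu> where "\<mu> = 2 * F * G + 1"
  have \<mu>: "\<mu> > 0" using F_nonneg G(2) by (simp add: \<mu>_def add_nonneg_pos)
  have cf: "continuous_on S f" for S
  proof (rule lipschitz_on_continuous_on)
    show "F-lipschitz_on S f"
      using lipschitz F_nonneg by (auto simp: lipschitz_on_def dist_norm)
  qed
  \<comment> \<open>Bounded continuous functions live on the whole line, so times are clamped to
    \<open>[0, T]\<close>.\<close>
  define cl where "cl t = max 0 (min T t)" for t :: real
  have cl: "cl t \<in> {0..T}" "t \<in> {0..T} \<Longrightarrow> cl t = t" for t
    using T by (auto simp: cl_def)
  \<comment> \<open>The unknown \<open>u\<close> is the path multiplied by the decaying weight; the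
    factor in front of \<open>u\<close> recovers the path.\<close>
  define H where "H u s = f (exp (\<mu> * s) *\<^sub>R apply_bcontfun u s) *v g s" for u :: "real \<Rightarrow>\<^sub>C (real^'m)" and s
  have H: "continuous_on {0..T} (H u)" for u
    unfolding H_def
    by (intro bounded_bilinear.continuous_on[OF bounded_bilinear_matrix_vector_mult] g
         continuous_on_compose2[OF cf[of UNIV]] continuous_intros) auto
  then have Hi: "H u integrable_on {0..t}" if "t \<in> {0..T}" for u t
    using that by (intro integrable_continuous_real continuous_on_subset[OF H]) auto
  define \<Phi> where "\<Phi> u t = exp (- \<mu> * cl t) *\<^sub>R (y + integral {0..cl t} (H u))" for u t
  have "\<Phi> u \<in> bcontfun" for u
  proof -
    have c: "continuous_on {0..T} (\<lambda>t. exp (- \<mu> * t) *\<^sub>R (y + integral {0..t} (H u)))"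
      by (intro continuous_intros indefinite_integral_continuous_1 integrable_continuous_real H)
    have "continuous_on UNIV (\<lambda>t. exp (- \<mu> * cl t) *\<^sub>R (y + integral {0..cl t} (H u)))"
      by (rule continuous_on_compose2[OF c]) (use cl in \<open>auto simp: cl_def[abs_def] intro!: continuous_intros\<close>)
    moreover have "bounded ((\<lambda>t. exp (- \<mu> * t) *\<^sub>R (y + integral {0..t} (H u))) ` {0..T})"
      by (intro compact_imp_bounded compact_continuous_image c) simp
    then have "bounded (range (\<Phi> u))"
      by (rule bounded_subset) (use cl in \<open>auto simp: \<Phi>_def\<close>)
    ultimately show ?thesis by (simp add: bcontfun_def \<Phi>_def[abs_def])
  qed
  then have \<Phi>: "apply_bcontfun (Bcontfun (\<Phi> u)) = \<Phi> u" for u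
    by (simp add: Bcontfun_inverse)
  have "dist (Bcontfun (\<Phi> u)) (Bcontfun (\<Phi> v)) \<le> 1/2 * dist u v" for u v
  proof (rule dist_bound)
    fix t
    define c D where "c = cl t" and "D = dist u v"
    have c: "c \<in> {0..T}" using cl by (simp add: c_def)
    have ie: "((\<lambda>s. F * G * D * exp (\<mu> * s)) has_integral F * G * D * (exp (\<mu> * c) / \<mu>) - F * G * D * (exp (\<mu> * 0) / \<mu>)) {0..c}"
      using c \<mu> by (intro fundamental_theorem_of_calculus)
        (auto intro!: derivative_eq_intros simp: has_real_derivative_iff_has_vector_derivative[symmetric])
    have "norm (integral {0..c} (\<lambda>s. H u s - H v s)) \<le> integral {0..c} (\<lambda>s. F * G * D * exp (\<mu> * s))"
    proof (rule integral_norm_bound_integral)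
      show "(\<lambda>s. H u s - H v s) integrable_on {0..c}" by (intro integrable_diff Hi c)
      show "(\<lambda>s. F * G * D * exp (\<mu> * s)) integrable_on {0..c}" using ie by blast
      fix s assume s: "s \<in> {0..c}"
      let ?u = "exp (\<mu> * s) *\<^sub>R apply_bcontfun u s" and ?v = "exp (\<mu> * s) *\<^sub>R apply_bcontfun v s"
      have "norm (H u s - H v s) = norm ((f ?u - f ?v) *v g s)"
        by (simp add: H_def matrix_vector_mult_diff_rdistrib)
      also have "\<dots> \<le> norm (f ?u - f ?v) * norm (g s)"
        by (rule norm_matrix_vector_mult_le)
      also have "\<dots> \<le> (F * (exp (\<mu> * s) * D)) * G"
      proof (intro mult_mono G)
        have "norm (?u - ?v) = exp (\<mu> * s) * dist (apply_bcontfun u s) (apply_bcontfun v s)"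
          by (simp add: dist_norm scaleR_diff_right[symmetric])
        also have "\<dots> \<le> exp (\<mu> * s) * D"
          unfolding D_def by (intro mult_left_mono dist_bounded) auto
        finally show "norm (f ?u - f ?v) \<le> F * (exp (\<mu> * s) * D)"
          by (intro order_trans[OF lipschitz] mult_left_mono F_nonneg)
      qed (use c s F_nonneg in \<open>auto simp: D_def\<close>)
      finally show "norm (H u s - H v s) \<le> F * G * D * exp (\<mu> * s)" by (simp add: mult_ac)
    qed
    also have "\<dots> = F * G * D / \<mu> * (exp (\<mu> * c) - 1)"
      unfolding integral_unique[OF ie] by (simp add: right_diff_distrib)
    also have "\<dots> \<le> F * G * D / \<mu> * exp (\<mu> * c)"
      using F_nonneg G \<mu> by (intro mult_left_mono) (auto simp: D_def)
    \<comment> \<open>Integrating the weight gains 1/\<open>\<mu>\<close>, and \<open>\<mu>\<close>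
      exceeds \<open>2 * F * G\<close>; this gives the contraction factor 1/2.\<close>
    also have "\<dots> \<le> 1/2 * D * exp (\<mu> * c)"
    proof (intro mult_right_mono)
      have "F * G \<le> 1/2 * \<mu>" by (simp add: \<mu>_def)
      then have "F * G * D \<le> 1/2 * \<mu> * D" by (intro mult_right_mono) (auto simp: D_def)
      then show "F * G * D / \<mu> \<le> 1/2 * D" using \<mu> by (simp add: field_simps)
    qed auto
    finally have *: "norm (integral {0..c} (\<lambda>s. H u s - H v s)) \<le> 1/2 * D * exp (\<mu> * c)" .
    have "\<Phi> u t - \<Phi> v t = exp (- \<mu> * c) *\<^sub>R integral {0..c} (\<lambda>s. H u s - H v s)"
      unfolding \<Phi>_def c_def[symmetric] integral_diff[OF Hi[OF c] Hi[OF c]] by (simp add: algebra_simps)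
    then have "dist (\<Phi> u t) (\<Phi> v t) = exp (- \<mu> * c) * norm (integral {0..c} (\<lambda>s. H u s - H v s))"
      by (simp add: dist_norm)
    also have "\<dots> \<le> exp (- \<mu> * c) * (1/2 * D * exp (\<mu> * c))"
      by (intro mult_left_mono *) auto
    also have "\<dots> = 1/2 * D" by (simp add: exp_minus field_simps)
    finally show "dist (apply_bcontfun (Bcontfun (\<Phi> u)) t) (apply_bcontfun (Bcontfun (\<Phi> v)) t) \<le> 1/2 * dist u v"
      unfolding \<Phi> D_def .
  qed
  then obtain u where u: "Bcontfun (\<Phi> u) = u"
    using banach_fix_type[of "1/2" "\<lambda>u. Bcontfun (\<Phi> u)"] by auto
  define Y where "Y t = exp (\<mu> * t) *\<^sub>R apply_bcontfun u t" for t
  have Yt: "Y t = y + integral {0..t} (\<lambda>s. f (Y s) *v g s)" if "t \<in> {0..T}" for t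
  proof -
    have "apply_bcontfun u t = \<Phi> u t" using \<Phi>[of u] u by metis
    then have "Y t = exp (\<mu> * t) *\<^sub>R (exp (- \<mu> * t) *\<^sub>R (y + integral {0..t} (H u)))"
      unfolding Y_def \<Phi>_def cl(2)[OF that] by simp
    also have "\<dots> = y + integral {0..t} (H u)"
      by (simp add: exp_minus)
    finally show ?thesis by (simp add: H_def[abs_def] Y_def)
  qed
  have "continuous_on {0..T} Y"
    unfolding Y_def by (intro continuous_intros) auto
  then show thesis using Yt by (rule that)
qed

end

section \<open>Mollified drivers and their dyadic sums\<close>

lemma dyadic_point:
  fixes s h :: real
  assumes "0 \<le> h" "j < (2::nat)^k"
  shows "s \<le> s + real j * (h/2^k)" "s + real j * (h/2^k) + h/2^k \<le> s + h"
proof -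
  have "real (Suc j) \<le> 2^k"
    using assms(2) by (metis Suc_leI of_nat_le_iff of_nat_numeral of_nat_power)
  then have "real (Suc j) * (h/2^k) \<le> 2^k * (h/2^k)"
    using assms(1) by (intro mult_right_mono) auto
  then show "s + real j * (h/2^k) + h/2^k \<le> s + h" by (simp add: add_divide_distrib distrib_right add_ac)
qed (use assms in auto)

lemma continuous_on_dpow:
  assumes "continuous_on {0..T} X" "0 < r" "0 \<le> h" "\<And>x. x \<in> S \<Longrightarrow> 0 \<le> \<phi> x \<and> \<phi> x + h \<le> T" "continuous_on S \<phi>"
  shows "continuous_on S (\<lambda>x. dpow r X (\<phi> x) h)"
  unfolding dpow_def using assms
  by (intro continuous_on_powr' continuous_intros continuous_on_compose2[OF assms(1)]) force+

lemma continuous_on_lev_dpow: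
  assumes "continuous_on {0..T} X" "0 < r" "0 \<le> h" "\<And>x. x \<in> S \<Longrightarrow> 0 \<le> \<phi> x \<and> \<phi> x + h \<le> T" "continuous_on S \<phi>"
  shows "continuous_on S (\<lambda>x. lev (dpow r X) k (\<phi> x) h)"
  unfolding lev_eq_sum
proof (intro continuous_on_sum continuous_on_dpow[OF assms(1,2)])
  fix j x assume "j \<in> {..<(2::nat)^k}" "x \<in> S"
  then show "0 \<le> \<phi> x + real j * (h/2^k) \<and> \<phi> x + real j * (h/2^k) + h/2^k \<le> T"
    using dyadic_point[OF assms(3), of j k "\<phi> x"] assms(4)[of x] by fastforce
qed (use assms in \<open>auto intro!: continuous_intros\<close>)

lemma continuous_on_lev:
  fixes g :: "real \<Rightarrow> real \<Rightarrow> 'a::real_normed_vector"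
  assumes g: "\<And>h. 0 \<le> h \<Longrightarrow> h \<le> T \<Longrightarrow> continuous_on {0..T - h} (\<lambda>s. g s h)" and h: "0 \<le> h" "h \<le> T"
  shows "continuous_on {0..T - h} (\<lambda>s. lev g k s h)"
  using h
proof (induction k arbitrary: h)
  case 0
  then show ?case using g by simp
next
  case (Suc k)
  have c: "continuous_on {0..T - h/2} (\<lambda>s. lev g k s (h/2))" by (rule Suc.IH) (use Suc.prems in auto)
  show ?case
    unfolding lev.simps
  proof (intro continuous_on_add)
    show "continuous_on {0..T - h} (\<lambda>s. lev g k s (h/2))"
      by (rule continuous_on_subset[OF c]) (use Suc.prems in auto)
    show "continuous_on {0..T - h} (\<lambda>s. lev g k (s + h/2) (h/2))"
      by (rule continuous_on_compose2[OF c]) (use Suc.prems in \<open>auto intro!: continuous_intros\<close>)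
  qed
qed

text \<open>Cauchy-Schwarz, obtained by integrating \<open>(norm (v u) - I/e)^2 \<ge> 0\<close> with
  I/e the mean of the norm.\<close>

lemma norm_integral_square_le:
  fixes v :: "real \<Rightarrow> 'a::euclidean_space"
  assumes "0 < e" "continuous_on {0..e} v"
  shows "(norm (integral {0..e} v))\<^sup>2 \<le> e * integral {0..e} (\<lambda>u. (norm (v u))\<^sup>2)"
proof -
  define I where "I = integral {0..e} (\<lambda>u. norm (v u))"
  have i: "(\<lambda>u. norm (v u)) integrable_on {0..e}" "(\<lambda>u. (norm (v u))\<^sup>2) integrable_on {0..e}" "v integrable_on {0..e}"
    using assms by (auto intro!: integrable_continuous_real continuous_intros)
  have "norm (integral {0..e} v) \<le> I"
    unfolding I_def by (rule integral_norm_bound_integral[OF i(3,1)]) simp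
  then have "(norm (integral {0..e} v))\<^sup>2 \<le> I\<^sup>2" by (simp add: power_mono)
  also have "I\<^sup>2 = e * (2 * (I/e) * I - (I/e)\<^sup>2 * e)"
    using assms(1) by (simp add: power2_eq_square field_simps)
  also have "2 * (I/e) * I - (I/e)\<^sup>2 * e = integral {0..e} (\<lambda>u. 2 * (I/e) * norm (v u) - (I/e)\<^sup>2)"
    using assms(1) i by (subst integral_diff) (auto simp: I_def intro!: integrable_on_mult_right)
  also have "\<dots> \<le> integral {0..e} (\<lambda>u. (norm (v u))\<^sup>2)"
  proof (rule integral_le[OF _ i(2)])
    show "(\<lambda>u. 2 * (I/e) * norm (v u) - (I/e)\<^sup>2) integrable_on {0..e}"
      by (intro integrable_diff integrable_on_mult_right i) auto
    show "2 * (I/e) * norm (v u) - (I/e)\<^sup>2 \<le> (norm (v u))\<^sup>2" for u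
      using sum_squares_bound[of "I/e" "norm (v u)"] by linarith
  qed
  finally show ?thesis using assms(1) by simp
qed

text \<open>The argument is contracted by \<open>1 - e/T\<close> so that the averaging window stays inside \<open>[0, T]\<close>.\<close>

definition mollify :: "real \<Rightarrow> real \<Rightarrow> (real \<Rightarrow> 'a::euclidean_space) \<Rightarrow> real \<Rightarrow> 'a" where
  "mollify T e X s = (1/e) *\<^sub>R integral {(1 - e/T) * s..(1 - e/T) * s + e} X"

context
  fixes T e :: real and X :: "real \<Rightarrow> 'a::euclidean_space"
  assumes T: "0 < T" and e: "0 < e" "e \<le> T/2" and X: "continuous_on {0..T} X"
begin

lemma mollify_arg:
  assumes "0 \<le> s" "s \<le> T" "0 \<le> u" "u \<le> e"
  shows "0 \<le> (1 - e/T) * s" "(1 - e/T) * s + u \<le> T" "\<bar>(1 - e/T) * s + u - s\<bar> \<le> e"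
proof -
  have 1: "e/T \<le> 1" "0 \<le> e/T" using T e by (simp_all add: field_simps)
  show "0 \<le> (1 - e/T) * s" using 1 assms by (intro mult_nonneg_nonneg) auto
  have "(1 - e/T) * s \<le> (1 - e/T) * T" using assms 1 by (intro mult_left_mono) auto
  also have "\<dots> = T - e" using T by (simp add: field_simps)
  finally show "(1 - e/T) * s + u \<le> T" using assms by simp
  have "e/T * s \<le> e/T * T" by (rule mult_left_mono[OF assms(2) 1(2)])
  also have "\<dots> = e" using T by simp
  finally have "e/T * s \<le> e" .
  moreover have "0 \<le> e/T * s" by (rule mult_nonneg_nonneg[OF 1(2) assms(1)])
  moreover have "(1 - e/T) * s + u - s = u - e/T * s" by (simp add: left_diff_distrib)
  ultimately show "\<bar>(1 - e/T) * s + u - s\<bar> \<le> e" using assms by linarith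
qed

lemma continuous_on_mollify_arg:
  assumes "0 \<le> s" "s \<le> T"
  shows "continuous_on {0..e} (\<lambda>u. X ((1 - e/T) * s + u))"
  by (rule continuous_on_compose2[OF X]) (use mollify_arg[OF assms] in \<open>force intro!: continuous_intros\<close>)+

lemma mollify_eq: "mollify T e X s = (1/e) *\<^sub>R integral {0..e} (\<lambda>u. X ((1 - e/T) * s + u))"
  using integral_shift_real_ivl[of "(1 - e/T) * s" "(1 - e/T) * s" "(1 - e/T) * s + e" X]
  by (simp add: mollify_def add.commute)

text \<open>An increment of the average is the average of increments over the contracted length, and
  squaring is convex.\<close>

lemma dpow_mollify_le:
  assumes "0 \<le> s" "0 \<le> h" "s + h \<le> T"
  shows "dpow 2 (mollify T e X) s h \<le> (1/e) * integral {0..e} (\<lambda>u. dpow 2 X ((1 - e/T) * s + u) ((1 - e/T) * h))"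
proof -
  have c: "continuous_on {0..e} (\<lambda>u. X ((1 - e/T) * (s + h) + u))" "continuous_on {0..e} (\<lambda>u. X ((1 - e/T) * s + u))"
    using assms by (intro continuous_on_mollify_arg; simp)+
  then have "mollify T e X (s + h) - mollify T e X s =
      (1/e) *\<^sub>R integral {0..e} (\<lambda>u. X ((1 - e/T) * (s + h) + u) - X ((1 - e/T) * s + u))"
    unfolding mollify_eq by (subst integral_diff) (auto intro: integrable_continuous_real simp: scaleR_diff_right)
  then have "dpow 2 (mollify T e X) s h = (1/e)\<^sup>2 * (norm (integral {0..e} (\<lambda>u. X ((1 - e/T) * (s + h) + u) - X ((1 - e/T) * s + u))))\<^sup>2"
    by (simp add: dpow_2 power_divide)
  also have "\<dots> \<le> (1/e)\<^sup>2 * (e * integral {0..e} (\<lambda>u. (norm (X ((1 - e/T) * (s + h) + u) - X ((1 - e/T) * s + u)))\<^sup>2))"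
    by (intro mult_left_mono norm_integral_square_le e continuous_intros c) auto
  also have "\<dots> = (1/e) * integral {0..e} (\<lambda>u. (norm (X ((1 - e/T) * (s + h) + u) - X ((1 - e/T) * s + u)))\<^sup>2)"
    using e by (simp add: power2_eq_square)
  also have "(\<lambda>u. (norm (X ((1 - e/T) * (s + h) + u) - X ((1 - e/T) * s + u)))\<^sup>2) = (\<lambda>u. dpow 2 X ((1 - e/T) * s + u) ((1 - e/T) * h))"
    by (simp add: dpow_2 distrib_left add_ac)
  finally show ?thesis .
qed

text \<open>The bound \<open>B\<close> is uniform in the position of the interval, so it survives
  averaging over positions. The sum over the levels in \<open>K\<close> is taken before averaging;
  hence \<open>X\<close> and its mollification share the same constant, and tails of levels can be
  treated as well as initial segments.\<close>

lemma lev_dpow_mollify_le: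
  assumes "0 \<le> s" "0 \<le> h" "s + h \<le> T" "finite K"
    and B: "\<And>s'. 0 \<le> s' \<Longrightarrow> s' + (1 - e/T) * h \<le> T \<Longrightarrow> (\<Sum>k\<in>K. lev (dpow 2 X) k s' ((1 - e/T) * h)) \<le> B"
  shows "(\<Sum>k\<in>K. lev (dpow 2 (mollify T e X)) k s h) \<le> B"
proof -
  define l where "l = 1 - e/T"
  have l: "0 \<le> l" using e T by (simp add: l_def field_simps)
  have arg: "0 \<le> l * s + u \<and> l * s + u + l * h \<le> T" if "u \<in> {0..e}" for u
    using mollify_arg(2)[of "s + h" u] mollify_arg(1)[of s u] assms(1-3) that l unfolding l_def[symmetric] distrib_left by simp
  have cont: "continuous_on {0..e} (\<lambda>u. lev (dpow 2 X) k (l * s + u) (l * h))" for k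
    by (rule continuous_on_lev_dpow[OF X]) (use arg l assms in \<open>auto intro!: continuous_intros\<close>)
  have "lev (dpow 2 (mollify T e X)) k s h \<le> (1/e) * integral {0..e} (\<lambda>u. lev (dpow 2 X) k (l * s + u) (l * h))" for k
  proof -
    have pow2k: "0 < (2::real)^k" by simp
    have pt: "0 \<le> s + real j * (h/2^k)" "s + real j * (h/2^k) + h/2^k \<le> T" "s + real j * (h/2^k) \<le> T" if "j < 2^k" for j
      using dyadic_point[OF assms(2) that, of s] assms(1-3) divide_nonneg_nonneg[OF assms(2) less_imp_le[OF pow2k]] by linarith+
    have "lev (dpow 2 (mollify T e X)) k s h \<le>
        (\<Sum>j<2^k. (1/e) * integral {0..e} (\<lambda>u. dpow 2 X (l * (s + real j * (h/2^k)) + u) (l * (h/2^k))))"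
      unfolding lev_eq_sum l_def using pt assms by (intro sum_mono dpow_mollify_le) auto
    also have "\<dots> = (1/e) * integral {0..e} (\<lambda>u. \<Sum>j<2^k. dpow 2 X (l * (s + real j * (h/2^k)) + u) (l * (h/2^k)))"
    proof (subst integral_sum)
      show "(\<lambda>u. dpow 2 X (l * (s + real j * (h/2^k)) + u) (l * (h/2^k))) integrable_on {0..e}" if "j \<in> {..<2^k}" for j
      proof (intro integrable_continuous_real continuous_on_dpow[OF X])
        fix u assume u: "u \<in> {0..e}"
        show "0 \<le> l * (s + real j * (h/2^k)) + u \<and> l * (s + real j * (h/2^k)) + u + l * (h/2^k) \<le> T"
          using mollify_arg(2)[of "s + real j * (h/2^k) + h/2^k" u] mollify_arg(1)[of "s + real j * (h/2^k)" u] pt[of j] that u assms(2)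
          unfolding l_def[symmetric] by (simp add: distrib_left)
      qed (use l assms in \<open>auto intro!: continuous_intros\<close>)
    qed (auto simp: sum_distrib_left)
    also have "(\<lambda>u. \<Sum>j<2^k. dpow 2 X (l * (s + real j * (h/2^k)) + u) (l * (h/2^k))) = (\<lambda>u. lev (dpow 2 X) k (l * s + u) (l * h))"
      unfolding lev_eq_sum by (simp add: algebra_simps)
    finally show ?thesis .
  qed
  then have "(\<Sum>k\<in>K. lev (dpow 2 (mollify T e X)) k s h) \<le> (\<Sum>k\<in>K. (1/e) * integral {0..e} (\<lambda>u. lev (dpow 2 X) k (l * s + u) (l * h)))"
    by (rule sum_mono)
  also have "\<dots> = (1/e) * integral {0..e} (\<lambda>u. \<Sum>k\<in>K. lev (dpow 2 X) k (l * s + u) (l * h))"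
    using assms(4) cont by (subst integral_sum) (auto simp: sum_distrib_left intro: integrable_continuous_real)
  also have "\<dots> \<le> (1/e) * integral {0..e} (\<lambda>u. B)"
  proof (intro mult_left_mono integral_le)
    show "(\<lambda>u. \<Sum>k\<in>K. lev (dpow 2 X) k (l * s + u) (l * h)) integrable_on {0..e}"
      by (intro integrable_continuous_real continuous_on_sum cont)
    show "(\<Sum>k\<in>K. lev (dpow 2 X) k (l * s + u) (l * h)) \<le> B" if "u \<in> {0..e}" for u
      unfolding l_def by (rule B) (use arg[OF that] in \<open>auto simp: l_def\<close>)
  qed (use e in auto)
  also have "\<dots> = B" using e by simp
  finally show ?thesis .
qed

text \<open>The continuous density found here turns the equation driven by the mollified path into
  an ordinary differential equation.\<close>

lemma mollify_has_integral:
  assumes "0 \<le> s" "s \<le> t" "t \<le> T"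
  shows "((\<lambda>u. ((1 - e/T)/e) *\<^sub>R (X ((1 - e/T) * u + e) - X ((1 - e/T) * u))) has_integral (mollify T e X t - mollify T e X s)) {s..t}"
proof (rule fundamental_theorem_of_calculus[OF assms(2)])
  fix x assume x: "x \<in> {s..t}"
  define \<Phi> where "\<Phi> t = integral {0..t} X" for t
  define l where "l = 1 - e/T"
  have d\<Phi>: "(\<Phi> has_vector_derivative X u) (at u within {0..T})" if "u \<in> {0..T}" for u
    unfolding \<Phi>_def[abs_def] by (rule integral_has_vector_derivative[OF X that])
  have arg: "0 \<le> l * u" "l * u + e \<le> T" "l * u \<le> T" "0 \<le> l * u + e" if "u \<in> {s..t}" for u
    using mollify_arg[of u 0] mollify_arg[of u e] that assms e unfolding l_def by auto
  have m: "mollify T e X u = (1/e) *\<^sub>R (\<Phi> (l * u + e) - \<Phi> (l * u))" if "u \<in> {s..t}" for u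
  proof -
    have "\<Phi> (l * u) + integral {l * u..l * u + e} X = \<Phi> (l * u + e)"
      unfolding \<Phi>_def using arg[OF that] e
      by (intro Henstock_Kurzweil_Integration.integral_combine integrable_continuous_real continuous_on_subset[OF X]) auto
    then show ?thesis unfolding mollify_def l_def[symmetric] by (metis add_diff_cancel_left')
  qed
  have comp: "((\<lambda>u. \<Phi> (l * u + c)) has_vector_derivative l *\<^sub>R X (l * x + c)) (at x within {s..t})" if "c \<in> {0, e}" for c
  proof -
    have "((\<lambda>u. l * u + c) has_vector_derivative l) (at x within {s..t})"
      by (auto intro!: derivative_eq_intros simp: has_real_derivative_iff_has_vector_derivative[symmetric])
    moreover have "(\<Phi> has_vector_derivative X (l * x + c)) (at (l * x + c) within (\<lambda>u. l * u + c) ` {s..t})"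
      by (rule has_vector_derivative_within_subset[OF d\<Phi>]) (use that arg x in auto)
    ultimately show ?thesis
      using vector_diff_chain_within[of "\<lambda>u. l * u + c" l x "{s..t}" \<Phi> "X (l * x + c)"] by (simp add: o_def)
  qed
  have "((\<lambda>u. (1/e) *\<^sub>R (\<Phi> (l * u + e) - \<Phi> (l * u))) has_vector_derivative (1/e) *\<^sub>R (l *\<^sub>R X (l * x + e) - l *\<^sub>R X (l * x))) (at x within {s..t})"
    using comp[of e] comp[of 0]
    by (intro bounded_linear.has_vector_derivative[OF bounded_linear_scaleR_right] has_vector_derivative_diff) auto
  then have "(mollify T e X has_vector_derivative (1/e) *\<^sub>R (l *\<^sub>R X (l * x + e) - l *\<^sub>R X (l * x))) (at x within {s..t})"
    by (rule has_vector_derivative_transform[OF x m, rotated])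
  then show "(mollify T e X has_vector_derivative ((1 - e/T)/e) *\<^sub>R (X ((1 - e/T) * x + e) - X ((1 - e/T) * x))) (at x within {s..t})"
    by (simp add: l_def scaleR_diff_right)
qed

end

lemma mollify_tendsto:
  fixes X :: "real \<Rightarrow> 'a::euclidean_space"
  assumes T: "0 < T" and X: "continuous_on {0..T} X" and s: "s \<in> {0..T}"
    and e: "\<And>n. 0 < e n" "\<And>n. e n \<le> T/2" "e \<longlonglongrightarrow> 0"
  shows "(\<lambda>n. mollify T (e n) X s) \<longlonglongrightarrow> X s"
proof (rule LIMSEQ_I)
  fix d :: real assume d: "d > 0"
  obtain r where r: "r > 0" "\<And>u. u \<in> {0..T} \<Longrightarrow> \<bar>u - s\<bar> < r \<Longrightarrow> norm (X u - X s) < d/2"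
    using X s d unfolding continuous_on_iff dist_norm by (metis half_gt_zero real_norm_def)
  obtain N where N: "\<And>n. n \<ge> N \<Longrightarrow> e n < r"
    using order_tendstoD(2)[OF e(3) r(1)] unfolding eventually_sequentially by blast
  have "norm (mollify T (e n) X s - X s) < d" if n: "n \<ge> N" for n
  proof -
    let ?v = "\<lambda>u. X ((1 - e n/T) * s + u)"
    have c: "continuous_on {0..e n} ?v" by (rule continuous_on_mollify_arg[OF T e(1,2) X]) (use s in auto)
    have "mollify T (e n) X s - X s = (1/e n) *\<^sub>R integral {0..e n} (\<lambda>u. ?v u - X s)"
      unfolding mollify_eq[OF T e(1,2) X] using e(1)[of n] c
      by (subst integral_diff) (auto intro: integrable_continuous_real simp: scaleR_diff_right)
    also have "norm \<dots> \<le> (1/e n) * integral {0..e n} (\<lambda>u. d/2)"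
    proof -
      have "norm (integral {0..e n} (\<lambda>u. ?v u - X s)) \<le> integral {0..e n} (\<lambda>u. d/2)"
      proof (rule integral_norm_bound_integral)
        show "norm (?v u - X s) \<le> d/2" if "u \<in> {0..e n}" for u
        proof (rule less_imp_le[OF r(2)])
          show "(1 - e n/T) * s + u \<in> {0..T}" "\<bar>(1 - e n/T) * s + u - s\<bar> < r"
            using mollify_arg[OF T e(1)[of n] e(2)[of n] X, of s u] s that N[OF n] by auto
        qed
      qed (auto intro!: integrable_continuous_real continuous_intros c)
      then show ?thesis using e(1)[of n] by (simp add: pos_divide_le_eq mult.commute)
    qed
    also have "\<dots> = d/2" using e(1)[of n] by simp
    also have "\<dots> < d" using d by simp
    finally show ?thesis .
  qed
  then show "\<exists>N. \<forall>n\<ge>N. norm (mollify T (e n) X s - X s) < d" by blast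
qed

text \<open>The bound is uniform over lengths in \<open>[h/2, h]\<close> because the increments of \<open>mollify T e X\<close> are averages
  of increments of \<open>X\<close> over the shorter length \<open>(1 - e/T) * h\<close>.\<close>

definition dyadic_dominated :: "real \<Rightarrow> (real \<Rightarrow> 'a::real_normed_vector) \<Rightarrow> bool" where
  "dyadic_dominated T X \<longleftrightarrow> (\<forall>h. 0 < h \<and> h \<le> T \<longrightarrow> (\<exists>c. summable c \<and> (\<forall>k::nat. 0 \<le> c k) \<and>
     (\<forall>h' s k. h/2 \<le> h' \<and> h' \<le> h \<and> 0 \<le> s \<and> s + h' \<le> T \<longrightarrow> lev (dpow 2 X) k s h' \<le> c k)))"

section \<open>A priori bounds and existence by compactness\<close>

lemma has_integral_norm_le:
  fixes f :: "real \<Rightarrow> 'a::real_normed_vector"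
  assumes "(f has_integral i) {a..b}" "a \<le> b" "0 \<le> B" "\<And>u. u \<in> {a..b} \<Longrightarrow> norm (f u) \<le> B"
  shows "norm i \<le> B * (b - a)"
  using has_integral_bound_real[of B "{}" f i a b] assms by simp

context bounded_lipschitz
begin

definition "gronwall T \<gamma> C = exp (F * sqrt C * T powr \<gamma> / (1 - 2 powr - \<gamma>))"

lemma gronwall_nonneg [simp]: "0 \<le> gronwall T \<gamma> C"
  by (simp add: gronwall_def)

text \<open>\<open>rem_le_levels\<close> is applied on each subinterval of level \<open>N\<close>
  with depth \<open>N'\<close>, and the results are summed. As \<open>N'\<close> grows the deepest
  remainders vanish, and only levels of \<open>X\<close> beyond \<open>N\<close> are left: a tail of
  a convergent series controls the remainders of level \<open>N\<close>.\<close>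

lemma lev_rem_le:
  fixes X :: "real \<Rightarrow> real^'n" and Y :: "real \<Rightarrow> real^'m"
  assumes X: "dyadic_var T 2 \<gamma> C X" and "\<gamma> > 0" "0 \<le> s" "0 < h" "s + h \<le> T"
    and lim: "(\<lambda>k. lev (\<lambda>s h. norm (rem f X Y s h)) k s h) \<longlonglongrightarrow> 0"
    and B: "\<And>N'. (\<Sum>k<N'. lev (dpow 2 X) (Suc k + N) s h) \<le> B"
  shows "lev (\<lambda>s h. norm (rem f X Y s h)) N s h \<le> gronwall T \<gamma> C * (F\<^sup>2 * B)"
proof -
  let ?R = "\<lambda>s h. norm (rem f X Y s h)"
  have "lev ?R N s h \<le> gronwall T \<gamma> C * (lev ?R (N' + N) s h + F\<^sup>2 * B)" for N'
  proof -
    have "lev ?R N s h \<le> lev (\<lambda>s h. gronwall T \<gamma> C * (lev ?R N' s h + F\<^sup>2 * (\<Sum>k<N'. lev (dpow 2 X) (Suc k) s h))) N s h"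
      unfolding gronwall_def by (rule lev_mono[OF \<open>0 < h\<close>], rule rem_le_levels[OF X]) (use assms in auto)
    also have "\<dots> = gronwall T \<gamma> C * (lev ?R (N' + N) s h + F\<^sup>2 * (\<Sum>k<N'. lev (dpow 2 X) (Suc k + N) s h))"
      unfolding lev_cmult lev_add lev_sum lev_lev ..
    also have "\<dots> \<le> gronwall T \<gamma> C * (lev ?R (N' + N) s h + F\<^sup>2 * B)"
      using B by (intro mult_left_mono add_left_mono) auto
    finally show ?thesis .
  qed
  moreover have "(\<lambda>N'. gronwall T \<gamma> C * (lev ?R (N' + N) s h + F\<^sup>2 * B)) \<longlonglongrightarrow> gronwall T \<gamma> C * (0 + F\<^sup>2 * B)"
    by (intro tendsto_intros LIMSEQ_ignore_initial_segment lim)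
  ultimately show ?thesis by (intro LIMSEQ_le_const[of _ "gronwall T \<gamma> C * (F\<^sup>2 * B)"]) auto
qed

lemma rem_le:
  fixes X :: "real \<Rightarrow> real^'n" and Y :: "real \<Rightarrow> real^'m"
  assumes X: "dyadic_var T 2 \<gamma> C X" and "\<gamma> > 0" "0 \<le> s" "0 < h" "s + h \<le> T"
    and lim: "(\<lambda>k. lev (\<lambda>s h. norm (rem f X Y s h)) k s h) \<longlonglongrightarrow> 0"
  shows "norm (rem f X Y s h) \<le> gronwall T \<gamma> C * (F\<^sup>2 * (C * h powr (2 * \<gamma>)))"
  using lev_rem_le[OF assms, of 0 "C * h powr (2 * \<gamma>)"] dyadic_var_sum_Suc[OF X] assms by simp

lemma incr_le_rem: "norm (Y (s + h) - Y s) \<le> F * norm (X (s + h) - X s) + norm (rem f X Y s h)"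
proof -
  have "Y (s + h) - Y s = f (Y s) *v (X (s + h) - X s) + rem f X Y s h" by (simp add: rem_def)
  then have "norm (Y (s + h) - Y s) \<le> norm (f (Y s) *v (X (s + h) - X s)) + norm (rem f X Y s h)"
    by (metis norm_triangle_ineq)
  also have "norm (f (Y s) *v (X (s + h) - X s)) \<le> norm (f (Y s)) * norm (X (s + h) - X s)"
    by (rule norm_matrix_vector_mult_le)
  also have "\<dots> \<le> F * norm (X (s + h) - X s)"
    by (intro mult_right_mono bound) auto
  finally show ?thesis by simp
qed

text \<open>Equicontinuity with a constant that sees the driver only through \<open>C\<close>, hence
  uniform over the mollified drivers. One factor \<open>h powr \<gamma>\<close> of the remainder is
  given away to \<open>T powr \<gamma>\<close>.\<close>

lemma incr_le:
  fixes X :: "real \<Rightarrow> real^'n" and Y :: "real \<Rightarrow> real^'m"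
  assumes X: "dyadic_var T 2 \<gamma> C X" and "\<gamma> > 0" "0 \<le> s" "0 < h" "s + h \<le> T"
    and lim: "(\<lambda>k. lev (\<lambda>s h. norm (rem f X Y s h)) k s h) \<longlonglongrightarrow> 0"
  shows "norm (Y (s + h) - Y s) \<le> (F * sqrt C + gronwall T \<gamma> C * F\<^sup>2 * C * T powr \<gamma>) * h powr \<gamma>"
proof -
  have C: "C \<ge> 0" using dyadic_var_nonneg[OF X] assms by auto
  have "norm (rem f X Y s h) \<le> gronwall T \<gamma> C * F\<^sup>2 * C * (h powr \<gamma> * h powr \<gamma>)"
    using rem_le[OF assms] by (simp add: powr_add[symmetric] mult_ac)
  also have "\<dots> \<le> gronwall T \<gamma> C * F\<^sup>2 * C * (T powr \<gamma> * h powr \<gamma>)"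
    using C assms by (intro mult_left_mono mult_right_mono powr_mono2) auto
  moreover have "F * norm (X (s + h) - X s) \<le> F * (sqrt C * h powr \<gamma>)"
    by (intro mult_left_mono dyadic_var_hoelder[OF X] assms F_nonneg)
  ultimately show ?thesis
    using incr_le_rem[of Y s h X] by (simp add: algebra_simps)
qed

lemma continuous_on_f: "continuous_on S f"
proof (rule lipschitz_on_continuous_on)
  show "F-lipschitz_on S f"
    using lipschitz F_nonneg by (auto simp: lipschitz_on_def dist_norm)
qed

text \<open>For a driver with continuous density the remainder is quadratic in the length, so the
  \<open>2^k\<close> remainders of level \<open>k\<close> add up to order \<open>(1/2)^k\<close>.
  The constant depends on the density; only the limit 0 is used afterwards.\<close>

lemma driven_ode_sewn:
  assumes T: "0 < T" and g: "continuous_on {0..T} g" and Y: "continuous_on {0..T} Y"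
    and eq: "\<And>t. t \<in> {0..T} \<Longrightarrow> Y t = y + integral {0..t} (\<lambda>s. f (Y s) *v g s)"
    and M: "\<And>s t. 0 \<le> s \<Longrightarrow> s \<le> t \<Longrightarrow> t \<le> T \<Longrightarrow> (g has_integral (M t - M s)) {s..t}"
    and s: "0 \<le> s" "0 < h" "s + h \<le> T"
  shows "(\<lambda>k. lev (\<lambda>s h. norm (rem f M Y s h)) k s h) \<longlonglongrightarrow> 0"
proof -
  have "bounded (g ` {0..T})"
    by (intro compact_imp_bounded compact_continuous_image g) simp
  then obtain G where G: "\<And>s. s \<in> {0..T} \<Longrightarrow> norm (g s) \<le> G" unfolding bounded_iff by blast
  have G0: "G \<ge> 0" using T by (auto intro: order_trans[OF norm_ge_zero G[of 0]])
  have cont: "continuous_on {0..T} (\<lambda>s. f (Y s) *v g s)"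
    by (intro bounded_bilinear.continuous_on[OF bounded_bilinear_matrix_vector_mult] g
         continuous_on_compose2[OF continuous_on_f[of UNIV] Y]) auto
  have int: "((\<lambda>u. f (Y u) *v g u) has_integral (Y t - Y s)) {s..t}" if "0 \<le> s" "s \<le> t" "t \<le> T" for s t
  proof -
    have "integral {0..s} (\<lambda>s. f (Y s) *v g s) + integral {s..t} (\<lambda>s. f (Y s) *v g s) = integral {0..t} (\<lambda>s. f (Y s) *v g s)"
      by (rule Henstock_Kurzweil_Integration.integral_combine)
        (use that in \<open>auto intro!: integrable_continuous_real continuous_on_subset[OF cont]\<close>)
    then have "Y t - Y s = integral {s..t} (\<lambda>u. f (Y u) *v g u)"
      using eq[of t] eq[of s] that by (simp add: algebra_simps)
    moreover have "(\<lambda>u. f (Y u) *v g u) integrable_on {s..t}"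
      using that by (intro integrable_continuous_real continuous_on_subset[OF cont]) auto
    ultimately show ?thesis by (simp add: has_integral_integral)
  qed
  have Ylip: "norm (Y t - Y s) \<le> F * G * (t - s)" if "0 \<le> s" "s \<le> t" "t \<le> T" for s t
  proof (rule has_integral_norm_le[OF int[OF that]])
    show "0 \<le> F * G" using F_nonneg G0 by simp
    show "norm (f (Y u) *v g u) \<le> F * G" if "u \<in> {s..t}" for u
      using norm_matrix_vector_mult_le[of "f (Y u)" "g u"] mult_mono[OF bound[of "Y u"] G[of u] F_nonneg norm_ge_zero] that \<open>0 \<le> s\<close> \<open>t \<le> T\<close>
      by auto
  qed (use that in auto)
  define K where "K = F * (F * G) * G"
  have R: "norm (rem f M Y s h) \<le> K * h\<^sup>2" if "0 \<le> s" "0 < h" "s + h \<le> T" for s h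
  proof -
    have "((\<lambda>u. f (Y u) *v g u - f (Y s) *v g u) has_integral (rem f M Y s h)) {s..s+h}"
      unfolding rem_def using that
      by (intro has_integral_diff int has_integral_linear[OF M, of s "s + h" "(*v) (f (Y s))", unfolded o_def]) auto
    then have "norm (rem f M Y s h) \<le> K * h * (s + h - s)"
    proof (rule has_integral_norm_le)
      show "norm (f (Y u) *v g u - f (Y s) *v g u) \<le> K * h" if u: "u \<in> {s..s+h}" for u
    proof -
      have "norm (f (Y u) *v g u - f (Y s) *v g u) \<le> norm (f (Y u) - f (Y s)) * norm (g u)"
        unfolding matrix_vector_mult_diff_rdistrib[symmetric] by (rule norm_matrix_vector_mult_le)
      also have "\<dots> \<le> (F * (F * G * h)) * G"
      proof (intro mult_mono G order_trans[OF lipschitz] mult_left_mono F_nonneg)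
        show "norm (Y u - Y s) \<le> F * G * h"
          using Ylip[of s u] u that \<open>0 \<le> s\<close> mult_left_mono[of "u - s" h "F * G"] F_nonneg G0 \<open>s + h \<le> T\<close> by auto
      qed (use u that G0 F_nonneg \<open>0 \<le> s\<close> \<open>s + h \<le> T\<close> \<open>0 < h\<close> in auto)
      finally show ?thesis by (simp add: K_def mult_ac)
    qed
    qed (use F_nonneg G0 that in \<open>auto simp: K_def\<close>)
    then show ?thesis using that by (simp add: power2_eq_square mult_ac)
  qed
  have "lev (\<lambda>s h. norm (rem f M Y s h)) k s h \<le> K * h\<^sup>2 * (1/2)^k" for k
  proof -
    have "lev (\<lambda>s h. norm (rem f M Y s h)) k s h \<le> lev (\<lambda>s h. K * h\<^sup>2) k s h"
      by (rule lev_mono[OF s(2)]) (use s R in auto)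
    also have "\<dots> = K * h\<^sup>2 * (1/2)^k"
      unfolding lev_eq_sum by (simp add: power_divide power2_eq_square)
    finally show ?thesis .
  qed
  moreover have "(\<lambda>k. K * h\<^sup>2 * (1/2)^k) \<longlonglongrightarrow> 0"
    by (intro tendsto_mult_right_zero LIMSEQ_realpow_zero) auto
  ultimately show ?thesis
    by (rule tendsto_0_le_real[rotated]) (auto intro!: lev_nonneg)
qed

text \<open>Pointwise convergence alone would not make the limit \<open>sewn\<close>. What passes to
  the limit is the bound of the level-\<open>N\<close> remainders by a constant times
  \<open>t N\<close>; this tail comes from \<open>dyadic_dominated\<close> and is the same for all
  mollified drivers.\<close>

lemma sewn_solution_exists:
  fixes X :: "real \<Rightarrow> real^'n"
  assumes T: "0 < T" and \<gamma>: "0 < \<gamma>" and X: "continuous_on {0..T} X" "dyadic_var T 2 \<gamma> C X" "dyadic_dominated T X"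
  shows "\<exists>Y. continuous_on {0..T} Y \<and> Y 0 = y \<and> sewn T (rem f X Y)"
proof -
  \<comment> \<open>The shift by 2 keeps \<open>e n \<le> T/2\<close>; the contracted lengths
    \<open>l n * h\<close> then stay in \<open>[h/2, h]\<close>, the range covered by
    \<open>dyadic_dominated\<close>.\<close>
  define e where "e n = T / (real n + 2)" for n :: nat
  have e: "0 < e n" "e n \<le> T/2" for n using T by (auto simp: e_def field_simps)
  have e0: "e \<longlonglongrightarrow> 0" unfolding e_def[abs_def] by real_asymp
  have C: "C \<ge> 0" using dyadic_var_nonneg[OF X(2) T] .
  define M where "M n = mollify T (e n) X" for n
  define l where "l n = 1 - e n/T" for n
  have l: "1/2 \<le> l n" "l n \<le> 1" "0 < l n" for n using T e[of n] by (auto simp: l_def field_simps)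
  have lh: "h/2 \<le> l n * h" "l n * h \<le> h" "0 < l n * h" if "0 < h" for n h
    using that mult_right_mono[OF l(1), of h n] mult_right_mono[OF l(2), of h n] l(3)[of n] by auto
  define g where "g n u = (l n/e n) *\<^sub>R (X (l n * u + e n) - X (l n * u))" for n u
  have g: "continuous_on {0..T} (g n)" for n
  proof -
    have "continuous_on {0..T} (\<lambda>u. X (l n * u + c))" if c: "c \<in> {0, e n}" for c
    proof (rule continuous_on_compose2[OF X(1)])
      have "l n * u + c \<in> {0..T}" if "u \<in> {0..T}" for u
        using mollify_arg(1,2)[OF T e(1)[of n] e(2)[of n] X(1), of u c] c that e(1)[of n] unfolding l_def[symmetric]
        by auto
      then show "(\<lambda>u. l n * u + c) ` {0..T} \<subseteq> {0..T}" by blast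
    qed (intro continuous_intros)
    from this[of 0] this[of "e n"] show ?thesis
      unfolding g_def by (intro continuous_intros) auto
  qed
  have "\<exists>Y. continuous_on {0..T} Y \<and> (\<forall>t\<in>{0..T}. Y t = y + integral {0..t} (\<lambda>s. f (Y s) *v g n s))" for n
    by (rule driven_ode_solution[OF T g[of n], of y]) blast
  then obtain Y where Y: "\<And>n. continuous_on {0..T} (Y n)"
      "\<And>n t. t \<in> {0..T} \<Longrightarrow> Y n t = y + integral {0..t} (\<lambda>s. f (Y n s) *v g n s)"
    by metis
  have sewn: "(\<lambda>k. lev (\<lambda>s h. norm (rem f (M n) (Y n) s h)) k s h) \<longlonglongrightarrow> 0" if "0 \<le> s" "0 < h" "s + h \<le> T" for n s h
    using T g[of n] Y(1)[of n] Y(2)[of _ n]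
  proof (rule driven_ode_sewn[OF _ _ _ _ _ that])
    show "(g n has_integral M n t - M n s) {s..t}" if "0 \<le> s" "s \<le> t" "t \<le> T" for s t
      unfolding g_def l_def M_def by (rule mollify_has_integral[OF T e(1)[of n] e(2)[of n] X(1) that])
  qed
  have M2: "(\<Sum>k\<in>K. lev (dpow 2 (M n)) k s h) \<le> B"
    if "0 \<le> s" "0 < h" "s + h \<le> T" "finite K"
      "\<And>s'. 0 \<le> s' \<Longrightarrow> s' + l n * h \<le> T \<Longrightarrow> (\<Sum>k\<in>K. lev (dpow 2 X) k s' (l n * h)) \<le> B" for n s h K B
    unfolding M_def
    by (rule lev_dpow_mollify_le[OF T e(1)[of n] e(2)[of n] X(1)]) (use that in \<open>auto simp: l_def\<close>)
  have MX: "dyadic_var T 2 \<gamma> C (M n)" for n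
    unfolding dyadic_var_def
  proof (intro allI impI, elim conjE)
    fix s h N assume sh: "0 \<le> s" "0 < h" "s + h \<le> T"
    show "(\<Sum>k<N. lev (dpow 2 (M n)) k s h) \<le> C * h powr (2 * \<gamma>)"
    proof (rule M2[OF sh])
      fix s' assume s': "0 \<le> s'" "s' + l n * h \<le> T"
      have "(\<Sum>k<N. lev (dpow 2 X) k s' (l n * h)) \<le> C * (l n * h) powr (2 * \<gamma>)"
        by (rule dyadic_var_sum[OF X(2)]) (use s' lh[OF sh(2)] in auto)
      also have "\<dots> \<le> C * h powr (2 * \<gamma>)"
        using lh[OF sh(2), of n] \<gamma> C by (intro mult_left_mono powr_mono2) auto
      finally show "(\<Sum>k<N. lev (dpow 2 X) k s' (l n * h)) \<le> C * h powr (2 * \<gamma>)" .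
    qed auto
  qed
  define K where "K = F * sqrt C + gronwall T \<gamma> C * F\<^sup>2 * C * T powr \<gamma>"
  have K: "K \<ge> 0" using F_nonneg C by (simp add: K_def)
  have hoelder: "norm (Y n t - Y n s) \<le> K * \<bar>t - s\<bar> powr \<gamma>" if "s \<in> {0..T}" "t \<in> {0..T}" for n s t
    using that
  proof (induction s t rule: linorder_wlog)
    case (le s t)
    then show ?case
      using incr_le[OF MX \<gamma> _ _ _ sewn, of s "t - s" n] unfolding K_def by (cases "s = t") auto
  next
    case (sym s t)
    then show ?case by (simp add: norm_minus_commute abs_minus_commute)
  qed
  have Y0: "Y n 0 = y" for n using Y(2)[of 0 n] T by simp
  obtain Z k where Z: "continuous_on {0..T} Z" "strict_mono (k :: nat \<Rightarrow> nat)"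
    "\<And>e. 0 < e \<Longrightarrow> \<exists>N. \<forall>n x. n \<ge> N \<and> x \<in> {0..T} \<longrightarrow> norm (Y (k n) x - Z x) < e"
  proof (rule Arzela_Ascoli[of "{0..T}" Y "norm y + K * T powr \<gamma>"])
    fix n x assume x: "x \<in> {0..T}"
    have "norm (Y n x) \<le> norm y + norm (Y n x - Y n 0)"
      using norm_triangle_sub[of "Y n x" y] Y0[of n] by simp
    also have "norm (Y n x - Y n 0) \<le> K * \<bar>x - 0\<bar> powr \<gamma>"
      by (rule hoelder) (use x T in auto)
    also have "\<dots> \<le> K * T powr \<gamma>"
      using x \<gamma> K by (intro mult_left_mono powr_mono2) auto
    finally show "norm (Y n x) \<le> norm y + K * T powr \<gamma>" by simp
  next
    fix x d :: real assume x: "x \<in> {0..T}" and d: "0 < d"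
    \<comment> \<open>Solves \<open>(K + 1) * r powr \<gamma> = d\<close>, so that
      \<open>K * r powr \<gamma> < d\<close> also when \<open>K = 0\<close>.\<close>
    define r where "r = (d / (K + 1)) powr (1/\<gamma>)"
    have r: "0 < r" "r powr \<gamma> = d / (K + 1)" using d K \<gamma> by (auto simp: r_def powr_powr)
    have "norm (Y n x - Y n u) < d" if "u \<in> {0..T}" "norm (x - u) < r" for n u
    proof -
      have "norm (Y n x - Y n u) \<le> K * \<bar>x - u\<bar> powr \<gamma>"
        by (rule hoelder) (use x that in auto)
      also have "\<dots> \<le> K * r powr \<gamma>"
        using that \<gamma> K by (intro mult_left_mono powr_mono2) auto
      also have "\<dots> < d" using K d by (simp add: r field_simps)
      finally show ?thesis .
    qed
    then show "\<exists>r>0. \<forall>n u. u \<in> {0..T} \<and> norm (x - u) < r \<longrightarrow> norm (Y n x - Y n u) < d"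
      using r(1) by blast
  qed auto
  have Zlim: "(\<lambda>n. Y (k n) t) \<longlonglongrightarrow> Z t" if "t \<in> {0..T}" for t
    using Z(3) that by (intro LIMSEQ_I) blast
  have Mlim: "(\<lambda>n. M (k n) t) \<longlonglongrightarrow> X t" if "t \<in> {0..T}" for t
    unfolding M_def
    by (rule mollify_tendsto[OF T X(1) that]) (use e LIMSEQ_subseq_LIMSEQ[OF e0 Z(2)] in \<open>auto simp: o_def\<close>)
  have flim: "(\<lambda>n. f (Y (k n) t)) \<longlonglongrightarrow> f (Z t)" if "t \<in> {0..T}" for t
    using continuous_on_tendsto_compose[OF continuous_on_f[of UNIV] Zlim[OF that]] by simp
  have Rlim: "(\<lambda>n. rem f (M (k n)) (Y (k n)) s h) \<longlonglongrightarrow> rem f X Z s h" if "0 \<le> s" "0 \<le> h" "s + h \<le> T" for s h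
    unfolding rem_def
    by (intro tendsto_diff bounded_bilinear.tendsto[OF bounded_bilinear_matrix_vector_mult] Zlim Mlim flim) (use that in auto)
  have "sewn T (rem f X Z)"
    unfolding sewn_def
  proof (intro allI impI, elim conjE)
    fix s h assume sh: "0 \<le> s" "0 < h" "s + h \<le> T"
    have "h \<le> T" using sh by simp
    then obtain c :: "nat \<Rightarrow> real" where c: "summable c" "\<And>k. 0 \<le> c k"
      "\<And>h' s k. h/2 \<le> h' \<Longrightarrow> h' \<le> h \<Longrightarrow> 0 \<le> s \<Longrightarrow> s + h' \<le> T \<Longrightarrow> lev (dpow 2 X) k s h' \<le> c k"
      using X(3) sh(2) unfolding dyadic_dominated_def by metis
    define t where "t N = (\<Sum>k. c (k + N))" for N
    have *: "lev (\<lambda>s h. norm (rem f (M n) (Y n) s h)) N s h \<le> gronwall T \<gamma> C * (F\<^sup>2 * t N)" for n N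
    proof (rule lev_rem_le[OF MX \<gamma> sh sewn[OF sh]])
      fix N'
      have "(\<Sum>k\<in>(\<lambda>k. Suc k + N) ` {..<N'}. lev (dpow 2 (M n)) k s h) \<le> (\<Sum>k\<in>(\<lambda>k. Suc k + N) ` {..<N'}. c k)"
        by (intro M2[OF sh] sum_mono c(3) lh sh) auto
      then have "(\<Sum>k<N'. lev (dpow 2 (M n)) (Suc k + N) s h) \<le> (\<Sum>k<N'. c (Suc k + N))"
        by (simp add: sum.reindex inj_on_def)
      also have "\<dots> \<le> (\<Sum>k<Suc N'. c (k + N))"
        unfolding sum.lessThan_Suc_shift using c(2) by simp
      also have "\<dots> \<le> t N"
        unfolding t_def by (intro sum_le_suminf) (use c in \<open>auto simp: summable_iff_shift\<close>)
      finally show "(\<Sum>k<N'. lev (dpow 2 (M n)) (Suc k + N) s h) \<le> t N" .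
    qed
    have "lev (\<lambda>s h. norm (rem f X Z s h)) N s h \<le> gronwall T \<gamma> C * (F\<^sup>2 * t N)" for N
    proof (rule LIMSEQ_le_const2)
      show "(\<lambda>n. lev (\<lambda>s h. norm (rem f (M (k n)) (Y (k n)) s h)) N s h) \<longlonglongrightarrow> lev (\<lambda>s h. norm (rem f X Z s h)) N s h"
        unfolding lev_eq_sum
      proof (intro tendsto_sum tendsto_norm Rlim)
        fix j assume "j \<in> {..<(2::nat)^N}"
        then show "0 \<le> s + real j * (h/2^N)" "s + real j * (h/2^N) + h/2^N \<le> T" "0 \<le> h/2^N"
          using dyadic_point[of h j N s] sh by auto
      qed
      show "\<exists>n0. \<forall>n\<ge>n0. lev (\<lambda>s h. norm (rem f (M (k n)) (Y (k n)) s h)) N s h \<le> gronwall T \<gamma> C * (F\<^sup>2 * t N)"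
        using * by blast
    qed
    moreover have "(\<lambda>N. gronwall T \<gamma> C * (F\<^sup>2 * t N)) \<longlonglongrightarrow> 0"
    proof (intro tendsto_mult_right_zero)
      show "t \<longlonglongrightarrow> 0"
        unfolding t_def[abs_def] using suminf_tail_tendsto_0[OF c(1)] suminf_minus_initial_segment[OF c(1)] by simp
    qed
    ultimately show "(\<lambda>N. lev (\<lambda>s h. norm (rem f X Z s h)) N s h) \<longlonglongrightarrow> 0"
      by (rule tendsto_0_le_real[rotated]) (auto intro!: lev_nonneg)
  qed
  moreover have "Z 0 = y"
    using Zlim[of 0] T Y0 LIMSEQ_unique[OF _ tendsto_const[of y]] by auto
  ultimately show ?thesis using Z(1) by blast
qed

end

subsection \<open>Integral bounds for continuous functions\<close>

text \<open>One factor is split off the power; the remaining exponent \<open>p - 1\<close> is not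
  positive, so that power is decreasing.\<close>

lemma powr_add_le_add_powr:
  fixes x y p :: real
  assumes "0 \<le> x" "0 \<le> y" "0 < p" "p \<le> 1"
  shows "(x + y) powr p \<le> x powr p + y powr p"
proof (cases "x = 0 \<or> y = 0")
  case False
  then have xy: "0 < x" "0 < y" using assms by auto
  have e: "z powr p = z * z powr (p - 1)" if "0 < z" for z :: real
    using powr_mult_base[of z "p - 1"] that by simp
  have "(x + y) powr p = x * (x + y) powr (p - 1) + y * (x + y) powr (p - 1)"
    using e[of "x + y"] xy by (simp add: distrib_right)
  also have "\<dots> \<le> x * x powr (p - 1) + y * y powr (p - 1)"
    using xy assms by (intro add_mono mult_left_mono powr_mono2') auto
  also have "\<dots> = x powr p + y powr p"
    using e[OF xy(1)] e[OF xy(2)] by simp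
  finally show ?thesis .
qed auto

lemma powr_convex_combination:
  fixes x y p t :: real
  assumes "0 \<le> x" "0 \<le> y" "1 \<le> p" "0 \<le> t" "t \<le> 1"
  shows "((1 - t) * x + t * y) powr p \<le> (1 - t) * x powr p + t * y powr p"
proof -
  have *: "u powr p \<le> u" if "0 \<le> u" "u \<le> 1" for u :: real
    using that assms powr_le_one_le[of u p] by (cases "u = 0") auto
  consider "x = 0" | "y = 0" | "0 < x" "0 < y" using assms by fastforce
  then show ?thesis
  proof cases
    case 1
    then show ?thesis using assms *[of t] by (auto simp: powr_mult intro!: mult_right_mono)
  next
    case 2
    then show ?thesis using assms *[of "1 - t"] by (auto simp: powr_mult intro!: mult_right_mono)
  next
    case 3
    then show ?thesis using convex_onD[OF powr_convex[OF assms(3)], of t x y] assms by simp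
  qed
qed

text \<open>The exponent \<open>max 1 p\<close> makes the bound \<open>e\<close> additive in \<open>g\<close> for every \<open>p > 0\<close>: for \<open>p \<ge> 1\<close> it bounds the norm,
  for \<open>p < 1\<close> the \<open>p\<close>-th power of the quasi-norm. The condition \<open>a < b\<close> accounts for the essential supremum
  over a null set.\<close>

definition Lpc :: "ennreal \<Rightarrow> real \<Rightarrow> real \<Rightarrow> (real \<Rightarrow> real) \<Rightarrow> real \<Rightarrow> bool" where
  "Lpc p a b g e \<longleftrightarrow> (if p = top then a < b \<longrightarrow> (\<forall>x\<in>{a..b}. g x \<le> e)
      else integral {a..b} (\<lambda>x. g x powr enn2real p) \<le> e powr max 1 (enn2real p))"

text \<open>Relates \<open>Lpc\<close> to the norm: a norm at most \<open>e\<close> corresponds to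
  the bound \<open>e powr kap p\<close>, because \<open>kap p * max 1 p = p\<close> for finite
  \<open>p\<close>.\<close>

definition kap :: "ennreal \<Rightarrow> real" where
  "kap p = (if p = top then 1 else min 1 (enn2real p))"

lemma enn2real_pos: "0 < p \<Longrightarrow> p \<noteq> top \<Longrightarrow> 0 < enn2real p" for p :: ennreal
  by (simp add: enn2real_positive_iff less_top)

lemma kap_pos: "0 < p \<Longrightarrow> 0 < kap p"
  by (auto simp: kap_def enn2real_pos)

lemma kap_le_1: "kap p \<le> 1"
  by (auto simp: kap_def)

lemma Lpc_mono:
  assumes "Lpc p a b g e" "0 < p" "0 \<le> e" "e \<le> e'"
    and "continuous_on {a..b} f" "continuous_on {a..b} g" "\<And>x. x \<in> {a..b} \<Longrightarrow> 0 \<le> f x" "\<And>x. x \<in> {a..b} \<Longrightarrow> f x \<le> g x"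
  shows "Lpc p a b f e'"
proof (cases "p = top")
  case True
  have "f x \<le> e'" if "a < b" "x \<in> {a..b}" for x
  proof -
    have "g x \<le> e" using assms(1) True that by (simp add: Lpc_def)
    then show ?thesis using assms(4) assms(8)[OF that(2)] by linarith
  qed
  then show ?thesis using True by (simp add: Lpc_def)
next
  case False
  have p: "0 < enn2real p" using enn2real_pos[OF assms(2) False] .
  have "integral {a..b} (\<lambda>x. f x powr enn2real p) \<le> integral {a..b} (\<lambda>x. g x powr enn2real p)"
  proof (rule integral_le)
    show "(\<lambda>x. f x powr enn2real p) integrable_on {a..b}"
      using p assms(5,7) by (intro integrable_continuous_real continuous_on_powr') auto
    show "(\<lambda>x. g x powr enn2real p) integrable_on {a..b}"
      using p assms(6) order_trans[OF assms(7,8)] by (intro integrable_continuous_real continuous_on_powr') auto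
  qed (use assms p in \<open>auto intro!: powr_mono2\<close>)
  also have "\<dots> \<le> e powr max 1 (enn2real p)" using assms(1) False by (simp add: Lpc_def)
  also have "\<dots> \<le> e' powr max 1 (enn2real p)" using assms by (intro powr_mono2) auto
  finally show ?thesis using False by (simp add: Lpc_def)
qed

lemma Lpc_closed:
  assumes "\<And>d. 0 < d \<Longrightarrow> Lpc p a b g (e + d)" "0 \<le> e"
  shows "Lpc p a b g e"
proof (cases "p = top")
  case True
  have "g x \<le> e" if "a < b" "x \<in> {a..b}" for x
  proof (rule field_le_epsilon)
    show "g x \<le> e + d" if "0 < d" for d using assms(1)[OF that] True \<open>a < b\<close> \<open>x \<in> {a..b}\<close> by (auto simp: Lpc_def)
  qed
  then show ?thesis using True by (simp add: Lpc_def)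
next
  case False
  have "((\<lambda>d. (e + d) powr max 1 (enn2real p)) \<longlongrightarrow> (e + 0) powr max 1 (enn2real p)) (at_right 0)"
    by (intro tendsto_powr' tendsto_intros) (use assms(2) in \<open>auto simp: eventually_at_right_less intro: eventually_mono[OF eventually_at_right_less]\<close>)
  moreover have "\<forall>\<^sub>F d in at_right 0. integral {a..b} (\<lambda>x. g x powr enn2real p) \<le> (e + d) powr max 1 (enn2real p)"
    using eventually_at_right_less[of 0] by eventually_elim (use assms(1) False in \<open>auto simp: Lpc_def\<close>)
  ultimately have "integral {a..b} (\<lambda>x. g x powr enn2real p) \<le> (e + 0) powr max 1 (enn2real p)"
    by (intro tendsto_lowerbound[where F="at_right 0"]) auto
  then show ?thesis using False by (simp add: Lpc_def)
qed

text \<open>Minkowski's inequality. For an exponent above 1 both functions are divided by their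
  bounds, and \<open>f + g\<close> is \<open>d + e\<close> times a convex combination of the
  quotients; for an exponent at most 1 the power itself is subadditive.\<close>

lemma Lpc_add_pos:
  assumes "Lpc p a b f d" "Lpc p a b g e" "0 < p" "0 < d" "0 < e"
    and f: "continuous_on {a..b} f" and g: "continuous_on {a..b} g"
    and nn: "\<And>x. x \<in> {a..b} \<Longrightarrow> 0 \<le> f x" "\<And>x. x \<in> {a..b} \<Longrightarrow> 0 \<le> g x"
  shows "Lpc p a b (\<lambda>x. f x + g x) (d + e)"
proof (cases "p = top")
  case True
  then show ?thesis using assms(1,2) by (auto simp: Lpc_def intro!: add_mono)
next
  case False
  define r where "r = enn2real p"
  have r: "0 < r" using enn2real_pos[OF assms(3) False] by (simp add: r_def)
  have i: "(\<lambda>x. f x powr r) integrable_on {a..b}" "(\<lambda>x. g x powr r) integrable_on {a..b}"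
    "(\<lambda>x. (f x + g x) powr r) integrable_on {a..b}"
    by (intro integrable_continuous_real continuous_on_powr' f g continuous_intros; use r nn in auto)+
  have le: "integral {a..b} (\<lambda>x. f x powr r) \<le> d powr max 1 r" "integral {a..b} (\<lambda>x. g x powr r) \<le> e powr max 1 r"
    using assms(1,2) False by (auto simp: Lpc_def r_def)
  have "integral {a..b} (\<lambda>x. (f x + g x) powr r) \<le> (d + e) powr max 1 r"
  proof (cases "r \<le> 1")
    case True
    have "integral {a..b} (\<lambda>x. (f x + g x) powr r) \<le> integral {a..b} (\<lambda>x. f x powr r + g x powr r)"
      by (rule integral_le[OF i(3) integrable_add[OF i(1,2)]]) (use nn r True in \<open>auto intro!: powr_add_le_add_powr\<close>)
    also have "\<dots> \<le> d powr max 1 r + e powr max 1 r"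
      using le i by (simp add: integral_add)
    finally show ?thesis using True assms(4,5) by (simp add: max_absorb1)
  next
    case r1: False
    define t where "t = e / (d + e)"
    have t: "0 \<le> t" "t \<le> 1" "1 - t = d / (d + e)" using assms(4,5) by (auto simp: t_def field_simps)
    have "integral {a..b} (\<lambda>x. (f x + g x) powr r) \<le>
        integral {a..b} (\<lambda>x. (d + e) powr r * ((1 - t) / d powr r * f x powr r + t / e powr r * g x powr r))"
    proof (rule integral_le[OF i(3)])
      show "(\<lambda>x. (d + e) powr r * ((1 - t) / d powr r * f x powr r + t / e powr r * g x powr r)) integrable_on {a..b}"
        by (intro integrable_on_mult_right integrable_add i)
      fix x assume x: "x \<in> {a..b}"
      have "f x + g x = (d + e) * ((1 - t) * (f x / d) + t * (g x / e))"
      proof -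
        have "(1 - t) * (f x / d) = f x / (d + e)" "t * (g x / e) = g x / (d + e)"
          using assms(4,5) unfolding t(3) by (simp_all add: t_def)
        then show ?thesis using assms(4,5) by (simp add: distrib_left)
      qed
      then have "(f x + g x) powr r = (d + e) powr r * ((1 - t) * (f x / d) + t * (g x / e)) powr r"
        using assms(4,5) nn x t by (simp add: powr_mult)
      also have "\<dots> \<le> (d + e) powr r * ((1 - t) * (f x / d) powr r + t * (g x / e) powr r)"
        using nn x assms(4,5) r1 t by (intro mult_left_mono powr_convex_combination) auto
      also have "\<dots> = (d + e) powr r * ((1 - t) / d powr r * f x powr r + t / e powr r * g x powr r)"
        using nn x assms(4,5) by (simp add: powr_divide)
      finally show "(f x + g x) powr r \<le> (d + e) powr r * ((1 - t) / d powr r * f x powr r + t / e powr r * g x powr r)" .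
    qed
    also have "\<dots> = (d + e) powr r * ((1 - t) / d powr r * integral {a..b} (\<lambda>x. f x powr r) + t / e powr r * integral {a..b} (\<lambda>x. g x powr r))"
      by (simp only: integral_mult_right
          integral_add[OF integrable_on_mult_right[OF i(1)] integrable_on_mult_right[OF i(2)]])
    also have "\<dots> \<le> (d + e) powr r * ((1 - t) / d powr r * d powr r + t / e powr r * e powr r)"
      using le r1 t(1,2) by (intro mult_left_mono add_mono) (auto simp: max_absorb2)
    also have "\<dots> = (d + e) powr r" using assms(4,5) by simp
    finally show ?thesis using r1 by (simp add: max_absorb2)
  qed
  then show ?thesis using False by (simp add: Lpc_def r_def)
qed

text \<open>The normalisation in \<open>Lpc_add_pos\<close> divides by the bounds; vanishing bounds
  are reached by enlarging them a little and letting the enlargement tend to 0.\<close>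

lemma Lpc_add:
  assumes "Lpc p a b f d" "Lpc p a b g e" "0 < p" "0 \<le> d" "0 \<le> e"
    and f: "continuous_on {a..b} f" and g: "continuous_on {a..b} g"
    and nn: "\<And>x. x \<in> {a..b} \<Longrightarrow> 0 \<le> f x" "\<And>x. x \<in> {a..b} \<Longrightarrow> 0 \<le> g x"
  shows "Lpc p a b (\<lambda>x. f x + g x) (d + e)"
proof (rule Lpc_closed)
  fix c :: real assume c: "0 < c"
  have "Lpc p a b (\<lambda>x. f x + g x) ((d + c/2) + (e + c/2))"
    by (rule Lpc_add_pos[OF Lpc_mono[OF assms(1)] Lpc_mono[OF assms(2)]]) (use assms c in auto)
  then show "Lpc p a b (\<lambda>x. f x + g x) (d + e + c)" by (simp add: algebra_simps)
qed (use assms in auto)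

lemma Lpc_zero: "0 < p \<Longrightarrow> 0 \<le> e \<Longrightarrow> Lpc p a b (\<lambda>x. 0) e"
  by (auto simp: Lpc_def enn2real_pos)

lemma Lpc_sum:
  assumes "finite I" "0 < p" "\<And>i. i \<in> I \<Longrightarrow> Lpc p a b (f i) (e i)" "\<And>i. i \<in> I \<Longrightarrow> 0 \<le> e i"
    "\<And>i. i \<in> I \<Longrightarrow> continuous_on {a..b} (f i)" "\<And>i x. i \<in> I \<Longrightarrow> x \<in> {a..b} \<Longrightarrow> 0 \<le> f i x"
  shows "Lpc p a b (\<lambda>x. \<Sum>i\<in>I. f i x) (\<Sum>i\<in>I. e i)"
  using assms
proof (induction I rule: finite_induct)
  case (insert i I)
  have "Lpc p a b (\<lambda>x. f i x + (\<Sum>i\<in>I. f i x)) (e i + (\<Sum>i\<in>I. e i))"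
    by (rule Lpc_add) (use insert in \<open>auto intro!: sum_nonneg continuous_on_sum insert.IH\<close>)
  then show ?case using insert by simp
qed (auto intro: Lpc_zero)

lemma Lpc_shift:
  assumes "Lpc p a b g e" "0 < p" "continuous_on {a..b} g" "\<And>x. x \<in> {a..b} \<Longrightarrow> 0 \<le> g x" "a \<le> a' + c" "b' + c \<le> b"
  shows "Lpc p a' b' (\<lambda>x. g (x + c)) e"
proof (cases "p = top")
  case True
  then show ?thesis using assms unfolding Lpc_def by auto
next
  case False
  have r: "0 < enn2real p" using enn2real_pos[OF assms(2) False] .
  have c: "continuous_on {a..b} (\<lambda>x. g x powr enn2real p)"
    by (intro continuous_on_powr' assms) (use assms r in auto)
  have "integral {a'..b'} (\<lambda>x. g (x + c) powr enn2real p) = integral {a' + c..b' + c} (\<lambda>x. g x powr enn2real p)"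
    using integral_shift_real_ivl[of "a' + c" c "b' + c" "\<lambda>x. g x powr enn2real p"] by simp
  also have "\<dots> \<le> integral {a..b} (\<lambda>x. g x powr enn2real p)"
    by (rule integral_subset_le) (use assms c in \<open>auto intro!: integrable_continuous_real continuous_on_subset[OF c]\<close>)
  also have "\<dots> \<le> e powr max 1 (enn2real p)" using assms(1) False by (simp add: Lpc_def)
  finally show ?thesis using False by (simp add: Lpc_def)
qed

lemma Lpc_cmult:
  assumes "Lpc p a b g e" "0 < p" "0 \<le> c" "0 \<le> e" "\<And>x. x \<in> {a..b} \<Longrightarrow> 0 \<le> g x"
  shows "Lpc p a b (\<lambda>x. c * g x) (c powr kap p * e)"
proof (cases "p = top")
  case True
  then show ?thesis using assms unfolding Lpc_def kap_def by (auto simp: powr_one_gt_zero_iff intro!: mult_left_mono)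
next
  case False
  have r: "0 < enn2real p" using enn2real_pos[OF assms(2) False] .
  have km: "kap p * max 1 (enn2real p) = enn2real p" using False by (simp add: kap_def min_def max_def)
  have "integral {a..b} (\<lambda>x. (c * g x) powr enn2real p) = integral {a..b} (\<lambda>x. c powr enn2real p * g x powr enn2real p)"
    using assms by (intro integral_cong) (auto simp: powr_mult)
  also have "\<dots> = c powr enn2real p * integral {a..b} (\<lambda>x. g x powr enn2real p)" by simp
  also have "\<dots> \<le> c powr enn2real p * e powr max 1 (enn2real p)"
    using assms(1) False by (intro mult_left_mono) (auto simp: Lpc_def)
  also have "\<dots> = (c powr kap p * e) powr max 1 (enn2real p)"
    using assms km by (simp add: powr_mult powr_powr)
  finally show ?thesis using False by (simp add: Lpc_def)
qed

lemma Lpc_const: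
  assumes "0 < p" "0 \<le> t" "a \<le> b" "b - a \<le> T"
  shows "Lpc p a b (\<lambda>x. t) ((1 + T) * t powr kap p)"
proof (cases "p = top")
  case True
  have "t \<le> (1 + T) * t" using assms by (simp add: mult_le_cancel_right1)
  then show ?thesis using assms True unfolding Lpc_def kap_def by simp
next
  case False
  have r: "0 < enn2real p" using enn2real_pos[OF assms(1) False] .
  have km: "kap p * max 1 (enn2real p) = enn2real p" using False by (simp add: kap_def min_def max_def)
  have "integral {a..b} (\<lambda>x. t powr enn2real p) = (b - a) * t powr enn2real p"
    using assms by simp
  also have "\<dots> \<le> (1 + T) powr max 1 (enn2real p) * t powr enn2real p"
  proof (rule mult_right_mono)
    \<comment> \<open>The base \<open>1 + T\<close> is at least 1, so raising it to
      \<open>max 1 p\<close> keeps it above the length.\<close>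
    have "b - a \<le> (1 + T) powr 1" using assms by simp
    also have "\<dots> \<le> (1 + T) powr max 1 (enn2real p)" using assms by (intro powr_mono) auto
    finally show "b - a \<le> (1 + T) powr max 1 (enn2real p)" .
  qed simp
  also have "\<dots> = ((1 + T) * t powr kap p) powr max 1 (enn2real p)"
    using assms km by (simp add: powr_mult powr_powr)
  finally show ?thesis using False by (simp add: Lpc_def)
qed

text \<open>The set of violations inside the open interval is open, so it is empty or not
  negligible; passing to the closure settles the endpoints.\<close>

lemma continuous_AE_le_imp_le:
  fixes g :: "real \<Rightarrow> real"
  assumes g: "continuous_on {a..b} g" and "a < b" and ae: "AE x in lebesgue_on {a..b}. g x \<le> c" and x: "x \<in> {a..b}"
  shows "g x \<le> c"
proof (rule ccontr)
  assume "\<not> g x \<le> c"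
  then have "g x \<in> {c<..}" by auto
  moreover have "closure {a<..<b} = {a..b}" using \<open>a < b\<close> by simp
  ultimately have "\<exists>y\<in>{a<..<b}. g y > c"
  proof -
    have "g ` closure {a<..<b} \<subseteq> {..c}" if "\<forall>y\<in>{a<..<b}. g y \<le> c"
      by (rule image_closure_subset) (use that g \<open>a < b\<close> in auto)
    then show ?thesis using \<open>closure _ = _\<close> x \<open>\<not> g x \<le> c\<close> by (force simp: not_less)
  qed
  then obtain y where y: "y \<in> {a<..<b}" "g y > c" by blast
  define S where "S = {a<..<b} \<inter> g -` {c<..}"
  have "open S" unfolding S_def
    by (rule continuous_open_preimage) (auto intro: continuous_on_subset[OF g])
  have "negligible S"
  proof -
    have "AE x in lebesgue. x \<in> {a..b} \<longrightarrow> g x \<le> c"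
      using ae by (subst (asm) AE_restrict_space_iff) auto
    then obtain N where N: "N \<in> null_sets lebesgue" "{x \<in> space lebesgue. \<not> (x \<in> {a..b} \<longrightarrow> g x \<le> c)} \<subseteq> N"
      unfolding eventually_ae_filter by blast
    have "S \<subseteq> N" using N(2) by (auto simp: S_def)
    then show ?thesis using N(1) negligible_iff_null_sets negligible_subset by blast
  qed
  then show False using open_not_negligible[OF \<open>open S\<close>] \<open>negligible S\<close> y unfolding S_def by blast
qed

lemma nn_integral_lebesgue_on_Icc:
  fixes g :: "real \<Rightarrow> real"
  assumes "continuous_on {a..b} g" "\<And>x. x \<in> {a..b} \<Longrightarrow> 0 \<le> g x"
  shows "(\<integral>\<^sup>+x. ennreal (g x) \<partial>lebesgue_on {a..b}) = ennreal (integral {a..b} g)"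
proof -
  have "(\<integral>\<^sup>+x. ennreal (g x) \<partial>lebesgue_on {a..b}) = (\<integral>\<^sup>+x. ennreal (g x) * indicator {a..b} x \<partial>lebesgue)"
    by (subst nn_integral_restrict_space) auto
  also have "\<dots> = (\<integral>\<^sup>+x. ennreal (g x) * indicator {a..b} x \<partial>lborel)"
    by (simp add: nn_integral_completion)
  also have "\<dots> = ennreal (integral {a..b} g)"
    using assms by (intro nn_integral_has_integral_lebesgue' integrable_integral integrable_continuous_real) auto
  finally show ?thesis .
qed

lemma enn_powr_le_iff:
  assumes "0 < r" "0 \<le> c"
  shows "enn_powr x (1/r) \<le> ennreal c \<longleftrightarrow> x \<le> ennreal (c powr r)"
proof (cases x)
  case (real z)
  have "z powr (1/r) \<le> c \<longleftrightarrow> z \<le> c powr r"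
  proof
    assume "z powr (1/r) \<le> c"
    then have "(z powr (1/r)) powr r \<le> c powr r" using assms by (intro powr_mono2) auto
    then show "z \<le> c powr r" using assms real by (simp add: powr_powr)
  next
    assume "z \<le> c powr r"
    then have "z powr (1/r) \<le> (c powr r) powr (1/r)" using assms real by (intro powr_mono2) auto
    then show "z powr (1/r) \<le> c" using assms by (simp add: powr_powr)
  qed
  then show ?thesis using real assms by (simp add: enn_powr_def)
qed (simp add: enn_powr_def top_unique)

lemma measurable_norm_lebesgue_on:
  "continuous_on {a..b::real} f \<Longrightarrow> (\<lambda>x. ennreal (norm (f x))) \<in> borel_measurable (lebesgue_on {a..b})"
  by (intro measurable_compose[OF continuous_imp_measurable_on_sets_lebesgue measurable_ennreal] continuous_intros) auto

text \<open>The bridge from extended-valued norms to real integrals: afterwards L^p estimates are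
  made with \<open>Lpc\<close>. For \<open>p = top\<close> and a degenerate interval both sides
  hold, the essential supremum being taken over a null set.\<close>

lemma Lp_norm_le_iff:
  fixes f :: "real \<Rightarrow> 'a::real_normed_vector"
  assumes p: "0 < p" and f: "continuous_on {a..b} f" and e: "0 \<le> e"
  shows "Lp_norm p (lebesgue_on {a..b}) f \<le> ennreal e \<longleftrightarrow> Lpc p a b (\<lambda>x. norm (f x)) (e powr kap p)"
proof (cases "p = top")
  case True
  have m: "(\<lambda>x. ennreal (norm (f x))) \<in> borel_measurable (lebesgue_on {a..b})"
    by (rule measurable_norm_lebesgue_on[OF f])
  show ?thesis
  proof (cases "a < b")
    case ab: True
    have "esssup (lebesgue_on {a..b}) (\<lambda>x. ennreal (norm (f x))) \<le> ennreal e \<longleftrightarrow> (\<forall>x\<in>{a..b}. norm (f x) \<le> e)"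
    proof
      assume *: "esssup (lebesgue_on {a..b}) (\<lambda>x. ennreal (norm (f x))) \<le> ennreal e"
      have "AE x in lebesgue_on {a..b}. ennreal (norm (f x)) \<le> esssup (lebesgue_on {a..b}) (\<lambda>x. ennreal (norm (f x)))"
        by (rule esssup_AE)
      then have "AE x in lebesgue_on {a..b}. norm (f x) \<le> e"
        by eventually_elim (use * e in \<open>auto dest: order_trans\<close>)
      then show "\<forall>x\<in>{a..b}. norm (f x) \<le> e"
        using continuous_AE_le_imp_le[OF continuous_on_norm[OF f] ab] by blast
    next
      assume "\<forall>x\<in>{a..b}. norm (f x) \<le> e"
      then show "esssup (lebesgue_on {a..b}) (\<lambda>x. ennreal (norm (f x))) \<le> ennreal e"
        using e by (intro esssup_I[OF m] AE_I2) auto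
    qed
    then show ?thesis using True ab e by (simp add: Lp_norm_def Lpc_def kap_def)
  next
    case False
    then have "emeasure lebesgue {a..b} = 0" by (simp add: emeasure_lborel_Icc_eq)
    then have "AE x in lebesgue_on {a..b}. ennreal (norm (f x)) \<le> ennreal e"
      by (intro AE_I[of _ _ "{a..b}"]) (auto simp: emeasure_restrict_space)
    then have "esssup (lebesgue_on {a..b}) (\<lambda>x. ennreal (norm (f x))) \<le> ennreal e"
      by (rule esssup_I[OF m])
    then show ?thesis using True False by (simp add: Lp_norm_def Lpc_def)
  qed
next
  case False
  have r: "0 < enn2real p" using enn2real_pos[OF p False] .
  have km: "kap p * max 1 (enn2real p) = enn2real p" using False by (simp add: kap_def min_def max_def)
  have "(\<integral>\<^sup>+x. ennreal (norm (f x) powr enn2real p) \<partial>lebesgue_on {a..b}) = ennreal (integral {a..b} (\<lambda>x. norm (f x) powr enn2real p))"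
    using r f by (intro nn_integral_lebesgue_on_Icc continuous_on_powr' continuous_intros) auto
  then have "Lp_norm p (lebesgue_on {a..b}) f \<le> ennreal e \<longleftrightarrow> integral {a..b} (\<lambda>x. norm (f x) powr enn2real p) \<le> e powr enn2real p"
    using False enn_powr_le_iff[OF r e] by (simp add: Lp_norm_def)
  then show ?thesis using False km e by (simp add: Lpc_def powr_powr)
qed

subsection \<open>Integral moduli of continuity of Besov paths\<close>

locale besov_path =
  fixes T \<alpha> :: real and p q :: ennreal and X :: "real \<Rightarrow> 'a::euclidean_space"
  assumes T: "0 < T" and \<alpha>: "1/2 \<le> \<alpha>" "\<alpha> < 1" and p: "ennreal (1/\<alpha>) < p" and q: "0 < q"
    and X: "X \<in> besov_space T \<alpha> p q" and cont: "continuous_on {0..T} X"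
begin

definition w :: "real \<Rightarrow> real" where "w \<eta> = enn2real (modulus2 T p (incr X) \<eta>)"

definition "K = enn2real (besov_seminorm T \<alpha> p q X)"

lemma besov_seminorm_eq: "besov_seminorm T \<alpha> p q X = ennreal K"
  using X unfolding K_def besov_space_def by simp

lemma p_pos: "0 < p" "1 < p"
proof -
  have "(1::ennreal) < ennreal (1/\<alpha>)"
    using \<alpha> by (simp add: ennreal_1[symmetric] ennreal_less_iff del: ennreal_1)
  then show "1 < p" using p by (rule less_trans)
  then show "0 < p" using less_trans zero_less_one by blast
qed

lemma p_real: "p \<noteq> top \<Longrightarrow> 1/\<alpha> < enn2real p"
  using p \<alpha> by (cases p) (auto simp: ennreal_less_iff)

lemma p_real_1: "p \<noteq> top \<Longrightarrow> 1 < enn2real p"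
  using p_pos(2) by (cases p) (auto simp: ennreal_1[symmetric] ennreal_less_iff simp del: ennreal_1)

lemma inv_p: "0 \<le> 1 / enn2real p" "1 / enn2real p < \<alpha>"
proof -
  show "1 / enn2real p < \<alpha>"
  proof (cases "p = top")
    case False
    then show ?thesis using p_real p_real_1 \<alpha> by (simp add: field_simps)
  qed (use \<alpha> in auto)
qed simp

lemma kap_p [simp]: "kap p = 1"
  using p_real_1 by (auto simp: kap_def)

lemma Lp_incr_le_iff:
  assumes "0 \<le> h" "h \<le> T" "0 \<le> e"
  shows "Lp_norm p (lebesgue_on {0..T - h}) (\<lambda>s. incr X s (s + h)) \<le> ennreal e \<longleftrightarrow>
    Lpc p 0 (T - h) (\<lambda>s. norm (X (s + h) - X s)) e"
proof -
  have "continuous_on {0..T - h} (\<lambda>s. incr X s (s + h))"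
    unfolding incr_def using assms
    by (intro continuous_intros continuous_on_compose2[OF cont] continuous_on_subset[OF cont]) auto
  then show ?thesis using Lp_norm_le_iff[OF p_pos(1) _ assms(3), of 0 "T - h"] assms(3) by (simp add: incr_def)
qed

lemma continuous_on_norm_incr:
  assumes "0 \<le> h" "h \<le> T"
  shows "continuous_on {0..T - h} (\<lambda>s. norm (X (s + h) - X s))"
  using assms by (intro continuous_intros continuous_on_compose2[OF cont] continuous_on_subset[OF cont]) auto

lemma modulus2_finite: "\<eta> \<le> T \<Longrightarrow> modulus2 T p (incr X) \<eta> < top"
proof -
  assume \<eta>: "\<eta> \<le> T"
  have "bounded (X ` {0..T})"
    by (intro compact_imp_bounded compact_continuous_image cont) simp
  then obtain B where B: "\<And>x. x \<in> {0..T} \<Longrightarrow> norm (X x) \<le> B" unfolding bounded_iff by blast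
  have B0: "0 \<le> B" using order_trans[OF norm_ge_zero B[of 0]] T by simp
  have "modulus2 T p (incr X) \<eta> \<le> ennreal ((1 + T) * (2 * B))"
    unfolding modulus2_def
  proof (rule SUP_least)
    fix h assume h: "h \<in> {0..\<eta>}"
    have "Lpc p 0 (T - h) (\<lambda>s. norm (X (s + h) - X s)) ((1 + T) * (2 * B))"
    proof (rule Lpc_mono[OF _ p_pos(1)])
      show "Lpc p 0 (T - h) (\<lambda>s. 2 * B) ((1 + T) * (2 * B))"
        using Lpc_const[OF p_pos(1), of "2 * B" 0 "T - h" T] h \<eta> B0 by simp
      show "norm (X (s + h) - X s) \<le> 2 * B" if "s \<in> {0..T - h}" for s
        using norm_triangle_ineq4[of "X (s + h)" "X s"] B[of s] B[of "s + h"] that h by auto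
    qed (use h \<eta> T B0 in \<open>auto intro!: continuous_on_norm_incr\<close>)
    then show "Lp_norm p (lebesgue_on {0..T - h}) (\<lambda>s. incr X s (s + h)) \<le> ennreal ((1 + T) * (2 * B))"
      by (subst Lp_incr_le_iff) (use h \<eta> T B0 in auto)
  qed
  then show ?thesis using ennreal_less_top le_less_trans by blast
qed

lemma modulus2_eq: "\<eta> \<le> T \<Longrightarrow> modulus2 T p (incr X) \<eta> = ennreal (w \<eta>)"
  unfolding w_def using modulus2_finite by simp

lemma w_nonneg [simp]: "0 \<le> w \<eta>"
  by (simp add: w_def)

lemma w_Lpc:
  assumes "0 \<le> h" "h \<le> \<eta>" "\<eta> \<le> T"
  shows "Lpc p 0 (T - h) (\<lambda>s. norm (X (s + h) - X s)) (w \<eta>)"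
proof -
  have "Lp_norm p (lebesgue_on {0..T - h}) (\<lambda>s. incr X s (s + h)) \<le> modulus2 T p (incr X) \<eta>"
    unfolding modulus2_def using assms by (intro SUP_upper) auto
  then show ?thesis unfolding modulus2_eq[OF assms(3)]
    by (subst (asm) Lp_incr_le_iff) (use assms in auto)
qed

lemma w_leI:
  assumes "\<eta> \<le> T" "0 \<le> e" "\<And>h. 0 \<le> h \<Longrightarrow> h \<le> \<eta> \<Longrightarrow> Lpc p 0 (T - h) (\<lambda>s. norm (X (s + h) - X s)) e"
  shows "w \<eta> \<le> e"
proof -
  have "modulus2 T p (incr X) \<eta> \<le> ennreal e"
    unfolding modulus2_def
  proof (rule SUP_least)
    fix h assume h: "h \<in> {0..\<eta>}"
    then show "Lp_norm p (lebesgue_on {0..T - h}) (\<lambda>s. incr X s (s + h)) \<le> ennreal e"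
      using assms by (subst Lp_incr_le_iff) auto
  qed
  then show ?thesis unfolding modulus2_eq[OF assms(1)] using assms(2) by simp
qed

lemma w_mono: "\<eta> \<le> \<eta>' \<Longrightarrow> \<eta>' \<le> T \<Longrightarrow> w \<eta> \<le> w \<eta>'"
  by (rule w_leI) (auto intro: w_Lpc)

text \<open>Splitting an increment into two of half the length. Comparability of the modulus at
  neighbouring dyadic scales is what permits the discretisation of the Besov seminorm.\<close>

lemma w_half: 
  assumes "0 \<le> \<eta>" "\<eta> \<le> T"
  shows "w \<eta> \<le> 2 * w (\<eta>/2)"
proof (rule w_leI)
  fix h assume h: "0 \<le> h" "h \<le> \<eta>"
  have 1: "Lpc p 0 (T - h/2) (\<lambda>s. norm (X (s + h/2) - X s)) (w (\<eta>/2))"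
    by (rule w_Lpc) (use h assms in auto)
  have c: "continuous_on {0..T - h/2} (\<lambda>s. norm (X (s + h/2) - X s))"
    by (rule continuous_on_norm_incr) (use h assms in auto)
  have 2: "Lpc p 0 (T - h) (\<lambda>s. norm (X (s + h/2 + h/2) - X (s + h/2))) (w (\<eta>/2))"
    by (rule Lpc_shift[OF 1 p_pos(1) c]) (use h in auto)
  have 3: "Lpc p 0 (T - h) (\<lambda>s. norm (X (s + 0 + h/2) - X (s + 0))) (w (\<eta>/2))"
    by (rule Lpc_shift[OF 1 p_pos(1) c]) (use h in auto)
  have cc: "continuous_on {0..T - h} (\<lambda>s. norm (X (s + a + h/2) - X (s + a)))" if "a \<in> {0, h/2}" for a
    by (rule continuous_on_compose2[OF c]) (use that h in \<open>auto intro!: continuous_intros\<close>)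
  have 4: "Lpc p 0 (T - h) (\<lambda>s. norm (X (s + 0 + h/2) - X (s + 0)) + norm (X (s + h/2 + h/2) - X (s + h/2))) (w (\<eta>/2) + w (\<eta>/2))"
    by (rule Lpc_add[OF 3 2 p_pos(1)]) (use cc[of 0] cc[of "h/2"] in auto)
  show "Lpc p 0 (T - h) (\<lambda>s. norm (X (s + h) - X s)) (2 * w (\<eta>/2))"
  proof (rule Lpc_mono[OF 4 p_pos(1)])
    show "norm (X (s + h) - X s) \<le> norm (X (s + 0 + h/2) - X (s + 0)) + norm (X (s + h/2 + h/2) - X (s + h/2))" for s
      using norm_triangle_ineq[of "X (s + h/2) - X s" "X (s + h) - X (s + h/2)"] by (simp add: add_ac)
    show "continuous_on {0..T - h} (\<lambda>s. norm (X (s + 0 + h/2) - X (s + 0)) + norm (X (s + h/2 + h/2) - X (s + h/2)))"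
      by (rule continuous_on_add[OF cc cc]) auto
  qed (use h assms in \<open>auto intro!: continuous_on_norm_incr\<close>)
qed (use assms in auto)

definition "\<beta> n = w (T/2^n) / (T/2^n) powr \<alpha>"

lemma \<beta>_nonneg [simp]: "0 \<le> \<beta> n"
  by (simp add: \<beta>_def)

lemma w_dyadic: "w (T/2^n) = (T/2^n) powr \<alpha> * \<beta> n"
  using T by (simp add: \<beta>_def)

lemma \<beta>_le_top:
  assumes "q = top"
  shows "\<beta> n \<le> K"
proof -
  have t: "T/2^n \<in> {0<..T}" using T by (auto simp: field_simps)
  have "ennreal (\<beta> n) = modulus2 T p (incr X) (T/2^n) / ennreal ((T/2^n) powr \<alpha>)"
    using t T by (simp add: modulus2_eq \<beta>_def divide_ennreal)
  also have "\<dots> \<le> (SUP \<tau>\<in>{0<..T}. modulus2 T p (incr X) \<tau> / ennreal (\<tau> powr \<alpha>))"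
    by (rule SUP_upper[OF t])
  also have "\<dots> = ennreal K"
    using besov_seminorm_eq assms by (simp add: besov_seminorm_def besov2_def)
  finally show ?thesis by (simp add: K_def)
qed

text \<open>On \<open>(T/2^(n+1), T/2^n]\<close> monotonicity and \<open>w_half\<close> bound the
  integrand below by \<open>(\<beta> n / 2) powr q\<close> over \<open>T/2^n\<close>, and the
  interval has half the length \<open>T/2^n\<close>. The two losses make the factor
  \<open>2 powr (q + 1)\<close>.\<close>

lemma sum_\<beta>_powr_q:
  assumes "q \<noteq> top"
  shows "(\<Sum>n<N. \<beta> n powr enn2real q) \<le> 2 powr (enn2real q + 1) * K powr enn2real q"
proof -
  define r where "r = enn2real q"
  have r: "0 < r" using enn2real_pos[OF q assms] by (simp add: r_def)
  define g where "g \<tau> = enn_powr (modulus2 T p (incr X) \<tau> / ennreal (\<tau> powr \<alpha>)) r / ennreal \<tau>" for \<tau>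
  have "enn_powr (\<integral>\<^sup>+\<tau>\<in>{0<..T}. g \<tau> \<partial>lborel) (1/r) \<le> ennreal K"
    using besov_seminorm_eq assms by (simp add: besov_seminorm_def besov2_def g_def r_def)
  then have int: "(\<integral>\<^sup>+\<tau>\<in>{0<..T}. g \<tau> \<partial>lborel) \<le> ennreal (K powr r)"
    using enn_powr_le_iff[OF r] by (simp add: K_def)
  define \<eta> where "\<eta> n = T/2^n" for n :: nat
  have \<eta>: "0 < \<eta> n" "\<eta> n \<le> T" "\<eta> (Suc n) = \<eta> n/2" for n
    using T by (auto simp: \<eta>_def field_simps)
  define v where "v n = (\<beta> n / 2) powr r / \<eta> n" for n
  have v0: "0 \<le> v n" for n using \<eta>(1)[of n] by (simp add: v_def)
  have \<eta>4: "\<eta> (Suc n) \<le> \<eta> n" for n using \<eta>(1,3)[of n] by simp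
  have gv: "ennreal (v n) \<le> g \<tau>" if "\<eta> (Suc n) < \<tau>" "\<tau> \<le> \<eta> n" for n \<tau>
  proof -
    have \<tau>: "0 < \<tau>" "\<tau> \<le> T" using that \<eta>[of n] \<eta>[of "Suc n"] by auto
    have "\<beta> n / 2 \<le> w \<tau> / \<tau> powr \<alpha>"
    proof -
      have "w (\<eta> n) \<le> 2 * w (\<eta> n / 2)" by (rule w_half) (use \<eta>[of n] in auto)
      also have "\<dots> \<le> 2 * w \<tau>" using that \<tau> \<eta>(3)[of n] by (auto intro!: w_mono)
      finally have "w (\<eta> n) / 2 \<le> w \<tau>" by simp
      then have "(w (\<eta> n) / 2) / \<eta> n powr \<alpha> \<le> w \<tau> / \<tau> powr \<alpha>"
        using that \<tau> \<alpha> by (intro frac_le powr_mono2) auto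
      then show ?thesis by (simp add: \<beta>_def \<eta>_def)
    qed
    then have "(\<beta> n / 2) powr r \<le> (w \<tau> / \<tau> powr \<alpha>) powr r"
      using r by (intro powr_mono2) auto
    then have "v n \<le> (w \<tau> / \<tau> powr \<alpha>) powr r / \<tau>"
      unfolding v_def using that \<tau> by (intro frac_le) auto
    moreover have "g \<tau> = ennreal ((w \<tau> / \<tau> powr \<alpha>) powr r / \<tau>)"
      using \<tau> by (simp add: g_def modulus2_eq divide_ennreal enn_powr_def)
    ultimately show ?thesis using \<tau> by (simp add: ennreal_leI)
  qed
  have disj: "m = n" if "\<eta> (Suc m) < \<tau>" "\<tau> \<le> \<eta> m" "\<eta> (Suc n) < \<tau>" "\<tau> \<le> \<eta> n" for m n \<tau>
  proof -
    have "\<eta> b \<le> \<eta> (Suc a)" if "a < b" for a b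
      unfolding \<eta>_def using T that by (intro divide_left_mono power_increasing) auto
    then show ?thesis using that by (metis linorder_neqE_nat not_less order_trans)
  qed
  have "(\<Sum>n<N. v n * (\<eta> n / 2)) = (\<Sum>n<N. v n * (\<eta> n - \<eta> (Suc n)))"
    by (simp add: \<eta>(3))
  then have "ennreal (\<Sum>n<N. v n * (\<eta> n / 2)) = ennreal (\<Sum>n<N. v n * (\<eta> n - \<eta> (Suc n)))"
    by (rule arg_cong)
  also have "\<dots> = (\<Sum>n<N. ennreal (v n * (\<eta> n - \<eta> (Suc n))))"
    using v0 \<eta>4 by (intro sum_ennreal[symmetric] mult_nonneg_nonneg) auto
  also have "\<dots> = (\<Sum>n<N. ennreal (v n) * emeasure lborel {\<eta> (Suc n)<..\<eta> n})"
    using v0 \<eta>4 by (intro sum.cong refl) (simp add: ennreal_mult emeasure_lborel_Ioc)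
  also have "\<dots> = (\<integral>\<^sup>+\<tau>. (\<Sum>n<N. ennreal (v n) * indicator {\<eta> (Suc n)<..\<eta> n} \<tau>) \<partial>lborel)"
    by (subst nn_integral_sum) (auto simp: nn_integral_cmult_indicator)
  also have "\<dots> \<le> (\<integral>\<^sup>+\<tau>\<in>{0<..T}. g \<tau> \<partial>lborel)"
  proof (rule nn_integral_mono)
    fix \<tau> :: real
    show "(\<Sum>n<N. ennreal (v n) * indicator {\<eta> (Suc n)<..\<eta> n} \<tau>) \<le> g \<tau> * indicator {0<..T} \<tau>"
    proof (cases "\<exists>m<N. \<tau> \<in> {\<eta> (Suc m)<..\<eta> m}")
      case True
      then obtain m where m: "m < N" "\<eta> (Suc m) < \<tau>" "\<tau> \<le> \<eta> m" by auto
      have "(\<Sum>n<N. ennreal (v n) * indicator {\<eta> (Suc n)<..\<eta> n} \<tau>) = (\<Sum>n<N. if n = m then ennreal (v n) else 0)"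
        using disj m by (intro sum.cong) (auto simp: indicator_def)
      also have "\<dots> = ennreal (v m)" using m(1) by simp
      also have "\<dots> \<le> g \<tau> * indicator {0<..T} \<tau>"
        using gv[OF m(2,3)] m \<eta>[of m] \<eta>[of "Suc m"] by (simp add: indicator_def)
      finally show ?thesis .
    next
      case False
      then have "(\<Sum>n<N. ennreal (v n) * indicator {\<eta> (Suc n)<..\<eta> n} \<tau>) = 0"
        by (auto simp: indicator_def)
      then show ?thesis by simp
    qed
  qed
  also note int
  finally have "(\<Sum>n<N. v n * (\<eta> n / 2)) \<le> K powr r" by simp
  also have "(\<Sum>n<N. v n * (\<eta> n / 2)) = (\<Sum>n<N. \<beta> n powr r) / 2 powr (r + 1)"
    unfolding sum_divide_distrib
  proof (intro sum.cong refl)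
    fix n
    have "v n * (\<eta> n / 2) = (\<beta> n / 2) powr r / 2" using \<eta>(1)[of n] by (simp add: v_def)
    then show "v n * (\<eta> n / 2) = \<beta> n powr r / 2 powr (r + 1)"
      by (simp add: powr_divide powr_add)
  qed
  finally show ?thesis by (simp add: r_def field_simps)
qed

text \<open>\<open>B\<close> dominates the \<open>l\<^sup>q\<close> norm of the normalised moduli \<open>\<beta> n\<close> at the dyadic scales \<open>T/2^n\<close>.\<close>

definition "B = (if q = top then K else 2 powr ((enn2real q + 1) / enn2real q) * K)"

lemma K_nonneg [simp]: "0 \<le> K" by (simp add: K_def)

lemma B_top: "q = top \<Longrightarrow> B = K"
  unfolding B_def by (rule if_P)

lemma B_not_top: "q \<noteq> top \<Longrightarrow> B = 2 powr ((enn2real q + 1) / enn2real q) * K"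
  unfolding B_def by (rule if_not_P)

lemma B_nonneg [simp]: "0 \<le> B"
proof (cases "q = top")
  case True
  show ?thesis unfolding B_top[OF True] by simp
next
  case False
  show ?thesis unfolding B_not_top[OF False] by (intro mult_nonneg_nonneg) simp_all
qed

lemma B_powr_q: 
  assumes "q \<noteq> top"
  shows "B powr enn2real q = 2 powr (enn2real q + 1) * K powr enn2real q"
  using enn2real_pos[OF q assms] unfolding B_not_top[OF assms] by (simp add: powr_mult powr_powr)

lemma \<beta>_le: "\<beta> n \<le> B"
proof (cases "q = top")
  case True
  show ?thesis unfolding B_top[OF True] by (rule \<beta>_le_top[OF True])
next
  case False
  have r: "0 < enn2real q" using enn2real_pos[OF q False] .
  have "\<beta> n powr enn2real q \<le> (\<Sum>n<Suc n. \<beta> n powr enn2real q)"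
    by (rule member_le_sum) auto
  also have "\<dots> \<le> B powr enn2real q"
    using sum_\<beta>_powr_q[OF False] B_powr_q[OF False] by metis
  finally show ?thesis using r powr_less_mono2[OF r B_nonneg, of "\<beta> n"] by (meson not_less)
qed

text \<open>The inclusion of l^q in l^r with the same constant: the surplus power of each term is
  bounded through \<open>B\<close>.\<close>

lemma sum_\<beta>_powr:
  assumes "q \<le> ennreal r" "finite S"
  shows "(\<Sum>n\<in>S. \<beta> n powr r) \<le> B powr r"
proof -
  have qt: "q \<noteq> top" using assms by (auto simp: top_unique)
  define s where "s = enn2real q"
  have s: "0 < s" using enn2real_pos[OF q qt] by (simp add: s_def)
  have "s \<le> r" using assms qt s by (cases q) (auto simp: s_def ennreal_le_iff2)
  have e: "\<beta> n powr r \<le> B powr (r - s) * \<beta> n powr s" for n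
  proof -
    have "\<beta> n powr r = \<beta> n powr (r - s) * \<beta> n powr s" by (simp add: powr_add[symmetric])
    also have "\<dots> \<le> B powr (r - s) * \<beta> n powr s"
      using \<open>s \<le> r\<close> \<beta>_le by (intro mult_right_mono powr_mono2) auto
    finally show ?thesis .
  qed
  obtain N where N: "S \<subseteq> {..<N}" using \<open>finite S\<close> finite_nat_iff_bounded by blast
  have "(\<Sum>n\<in>S. \<beta> n powr r) \<le> (\<Sum>n<N. \<beta> n powr r)" by (rule sum_mono2) (use N in auto)
  also have "\<dots> \<le> B powr (r - s) * (\<Sum>n<N. \<beta> n powr s)"
    unfolding sum_distrib_left by (intro sum_mono e)
  also have "\<dots> \<le> B powr (r - s) * B powr s"
    using sum_\<beta>_powr_q[OF qt, of N] B_powr_q[OF qt] by (intro mult_left_mono) (auto simp: s_def)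
  also have "\<dots> = B powr r" by (simp add: powr_add[symmetric])
  finally show ?thesis .
qed

lemma dyadic_scale:
  assumes "0 < h" "h \<le> T"
  obtains m :: nat where "T/2^Suc m < h" "h \<le> T/2^m"
proof -
  obtain k :: nat where k: "T/h < 2^k" using real_arch_pow[of 2 "T/h"] by auto
  define m where "m = (LEAST k. T/2^Suc k < h)"
  have "T/2^k < h" using k assms by (simp add: field_simps)
  then have ex: "T/2^Suc k < h" using T by (simp add: field_simps)
  have 1: "T/2^Suc m < h" unfolding m_def by (rule LeastI[of _ k]) (rule ex)
  have 2: "h \<le> T/2^m"
  proof (cases m)
    case (Suc m')
    then have "\<not> T/2^Suc m' < h" using not_less_Least[of m' "\<lambda>k. T/2^Suc k < h"] by (simp add: m_def)
    then show ?thesis using Suc by simp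
  qed (use assms in simp)
  show thesis using 1 2 by (rule that)
qed

text \<open>The scale index \<open>m\<close> fixes \<open>h\<close> up to a factor 2, which costs
  \<open>2 powr \<alpha>\<close>.\<close>

lemma w_le_\<beta>:
  assumes "T/2^Suc m < h" "h \<le> T/2^m"
  shows "w (h/2^n) \<le> 2 powr \<alpha> * (h/2^n) powr \<alpha> * \<beta> (m + n)"
proof -
  have h: "0 < h" using assms(1) T by (meson divide_pos_pos less_trans zero_less_numeral zero_less_power)
  have "h/2^n \<le> T/2^(m + n)" using assms(2) by (simp add: power_add field_simps)
  then have "w (h/2^n) \<le> w (T/2^(m + n))"
    by (rule w_mono) (use T in \<open>simp add: field_simps\<close>)
  also have "\<dots> = (T/2^(m + n)) powr \<alpha> * \<beta> (m + n)" by (rule w_dyadic)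
  also have "\<dots> \<le> (2 * (h/2^n)) powr \<alpha> * \<beta> (m + n)"
    using assms(1) T h \<alpha> by (intro mult_right_mono powr_mono2) (auto simp: power_add field_simps)
  also have "(2 * (h/2^n)) powr \<alpha> = 2 powr \<alpha> * (h/2^n) powr \<alpha>"
    by (rule powr_mult)
  finally show ?thesis .
qed

end

subsection \<open>Sampling increments of Besov paths\<close>

text \<open>Covers both orders of the exponents: Hoelder's inequality with its power of the
  cardinality if \<open>r \<le> p\<close>, and the inclusion of l^p in l^r with constant 1
  otherwise.\<close>

lemma sum_powr_le_power_mean:
  fixes y :: "'i \<Rightarrow> real"
  assumes "finite I" "\<And>i. i \<in> I \<Longrightarrow> 0 \<le> y i" "0 < r" "0 < p"
  shows "(\<Sum>i\<in>I. y i powr r) \<le> real (card I) powr max 0 (1 - r/p) * (\<Sum>i\<in>I. y i powr p) powr (r/p)"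
proof -
  define S where "S = (\<Sum>i\<in>I. y i powr p)"
  have S0: "0 \<le> S" unfolding S_def by (intro sum_nonneg) auto
  have mem: "y i powr p \<le> S" if "i \<in> I" for i
    unfolding S_def using assms(1) that by (intro member_le_sum) auto
  show ?thesis
  proof (cases "S = 0")
    case True
    then have "y i powr p = 0" if "i \<in> I" for i using mem[OF that] by (simp add: antisym)
    then have "y i = 0" if "i \<in> I" for i using that by simp
    then show ?thesis by (simp add: sum_nonneg)
  next
    case False
    then have S: "0 < S" using S0 by simp
    then have n: "0 < real (card I)" using assms(1) by (auto simp: S_def card_gt_0_iff)
    show ?thesis
    proof (cases "r \<le> p")
      case True
      \<comment> \<open>The mean of the p-th powers. Young's inequality with weights r/p and 1 - r/p
        is sharp at \<open>y i powr p = m\<close>, so summation gives the optimal constant.\<close>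
      define m where "m = S / card I"
      have m: "0 < m" using S n by (simp add: m_def)
      have "y i powr r \<le> m powr (r/p - 1) * (r/p * y i powr p + (1 - r/p) * m)" if "i \<in> I" for i
      proof (cases "y i = 0")
        case True
        then show ?thesis using m assms \<open>r \<le> p\<close> by (auto intro!: mult_nonneg_nonneg)
      next
        case False
        then have yi: "0 < y i" using assms(2)[OF that] by simp
        have "(y i powr p) powr (r/p) * m powr (1 - r/p) \<le> r/p * y i powr p + (1 - r/p) * m"
          using yi m assms True by (intro Youngs_inequality_0) auto
        then have "m powr (r/p - 1) * (y i powr r * m powr (1 - r/p)) \<le> m powr (r/p - 1) * (r/p * y i powr p + (1 - r/p) * m)"
          using assms yi by (intro mult_left_mono) (auto simp: powr_powr)
        moreover have "m powr (r/p - 1) * m powr (1 - r/p) = 1"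
          using m by (simp add: powr_add[symmetric])
        moreover have "m powr (r/p - 1) * (y i powr r * m powr (1 - r/p)) = y i powr r * (m powr (r/p - 1) * m powr (1 - r/p))"
          by (simp only: mult_ac)
        ultimately show ?thesis by simp
      qed
      then have "(\<Sum>i\<in>I. y i powr r) \<le> (\<Sum>i\<in>I. m powr (r/p - 1) * (r/p * y i powr p + (1 - r/p) * m))"
        by (rule sum_mono)
      also have "\<dots> = m powr (r/p - 1) * (r/p * S + (1 - r/p) * (card I * m))"
        by (simp add: sum_distrib_left[symmetric] sum_divide_distrib[symmetric] sum.distrib S_def)
      also have "card I * m = S" using n by (simp add: m_def)
      also have "m powr (r/p - 1) * (r/p * S + (1 - r/p) * S) = m powr (r/p - 1) * S"
        by (simp add: algebra_simps)
      also have "\<dots> = real (card I) powr (1 - r/p) * S powr (r/p)"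
      proof -
        have "m powr (r/p - 1) * S = (S * S powr (r/p - 1)) * (1 / real (card I) powr (r/p - 1))"
          by (simp add: m_def powr_divide)
        also have "S * S powr (r/p - 1) = S powr (r/p)" using S by (simp add: powr_mult_base)
        also have "1 / real (card I) powr (r/p - 1) = real (card I) powr (1 - r/p)"
          using powr_minus_divide[of "real (card I)" "r/p - 1"] by simp
        finally show ?thesis by (simp only: mult.commute)
      qed
      also have "1 - r/p = max 0 (1 - r/p)" using True assms by simp
      finally show ?thesis by (simp add: S_def)
    next
      case False
      have "y i powr r \<le> y i powr p * S powr (r/p - 1)" if "i \<in> I" for i
      proof -
        have "y i powr r = y i powr p * (y i powr p) powr (r/p - 1)"
          using assms by (cases "y i = 0") (auto simp: powr_powr powr_add[symmetric] algebra_simps)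
        also have "\<dots> \<le> y i powr p * S powr (r/p - 1)"
          using mem[OF that] False assms by (intro mult_left_mono powr_mono2) (auto simp: field_simps)
        finally show ?thesis .
      qed
      then have "(\<Sum>i\<in>I. y i powr r) \<le> (\<Sum>i\<in>I. y i powr p * S powr (r/p - 1))" by (rule sum_mono)
      also have "\<dots> = S * S powr (r/p - 1)" by (simp add: S_def sum_distrib_right)
      also have "\<dots> = S powr (r/p)" using S by (simp add: powr_mult_base)
      finally show ?thesis using False assms n by (simp add: S_def max_def)
    qed
  qed
qed

text \<open>Jensen's inequality, from the tangent line of \<open>x powr p\<close> at the mean
  \<open>m\<close> of the norm.\<close>

lemma norm_integral_le_powr:
  fixes v :: "real \<Rightarrow> 'a::euclidean_space"
  assumes "0 < l" "continuous_on {a..a+l} v" "1 \<le> p"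
  shows "norm (integral {a..a+l} v) \<le> l * (integral {a..a+l} (\<lambda>u. norm (v u) powr p) / l) powr (1/p)"
proof -
  define m where "m = integral {a..a+l} (\<lambda>u. norm (v u)) / l"
  define J where "J = integral {a..a+l} (\<lambda>u. norm (v u) powr p)"
  have i: "(\<lambda>u. norm (v u)) integrable_on {a..a+l}" "(\<lambda>u. norm (v u) powr p) integrable_on {a..a+l}" "v integrable_on {a..a+l}"
    using assms by (auto intro!: integrable_continuous_real continuous_intros continuous_on_powr')
  have m0: "0 \<le> m" using assms by (auto simp: m_def intro!: divide_nonneg_pos integral_nonneg i)
  have J0: "0 \<le> J" by (auto simp: J_def intro!: integral_nonneg i)
  have "norm (integral {a..a+l} v) \<le> l * m"
    using integral_norm_bound_integral[OF i(3,1)] assms by (simp add: m_def)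
  also have "m \<le> (J / l) powr (1/p)"
  proof (cases "m = 0")
    case False
    then have m: "0 < m" using m0 by simp
    have "p * m powr (p - 1) * x - (p - 1) * m powr p \<le> x powr p" if "0 \<le> x" for x
    proof (cases "x = 0")
      case False
      then have "(x powr p) powr (1/p) * (m powr p) powr (1 - 1/p) \<le> 1/p * x powr p + (1 - 1/p) * m powr p"
        using assms m that by (intro Youngs_inequality_0) auto
      then have "x * m powr (p - 1) \<le> 1/p * x powr p + (1 - 1/p) * m powr p"
        using assms that m by (simp add: powr_powr right_diff_distrib)
      then have "p * (x * m powr (p - 1)) \<le> p * (1/p * x powr p + (1 - 1/p) * m powr p)"
        using assms by (intro mult_left_mono) auto
      also have "\<dots> = x powr p + (p - 1) * m powr p" using assms by (simp add: field_simps)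
      finally show ?thesis by (simp add: mult_ac)
    qed (use assms in simp)
    then have "integral {a..a+l} (\<lambda>u. p * m powr (p - 1) * norm (v u) - (p - 1) * m powr p) \<le> J"
      unfolding J_def by (intro integral_le i integrable_diff integrable_on_mult_right) auto
    also have "integral {a..a+l} (\<lambda>u. p * m powr (p - 1) * norm (v u) - (p - 1) * m powr p) = p * m powr (p - 1) * (l * m) - l * ((p - 1) * m powr p)"
      using i assms by (subst integral_diff) (auto simp: m_def intro!: integrable_on_mult_right)
    also have "\<dots> = l * (p * (m * m powr (p - 1)) - (p - 1) * m powr p)" by (simp add: algebra_simps)
    also have "m * m powr (p - 1) = m powr p" using m by (simp add: powr_mult_base)
    also have "l * (p * m powr p - (p - 1) * m powr p) = l * m powr p" by (simp add: algebra_simps)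
    finally have "m powr p \<le> J / l" using assms by (simp add: field_simps)
    then have "(m powr p) powr (1/p) \<le> (J / l) powr (1/p)" using assms by (intro powr_mono2) auto
    then show ?thesis using assms m by (simp add: powr_powr)
  qed simp
  finally show ?thesis using assms by (simp add: J_def mult_left_mono)
qed

text \<open>Consecutive tiles are separated by gaps of length \<open>l\<close>; the integrals over
  the gaps are nonnegative and are filled in.\<close>

lemma sum_integral_tiles_le:
  fixes g :: "real \<Rightarrow> real"
  assumes "0 \<le> l" "l \<le> \<eta>" and g: "continuous_on {s..s + real (Suc n) * \<eta> - l} g"
    "\<And>x. x \<in> {s..s + real (Suc n) * \<eta> - l} \<Longrightarrow> 0 \<le> g x"
  shows "(\<Sum>j<Suc n. integral {s + real j * \<eta>..s + real j * \<eta> + \<eta> - l} g) \<le> integral {s..s + real (Suc n) * \<eta> - l} g"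
  using g
proof (induction n)
  case (Suc n)
  define b c where "b = s + real (Suc n) * \<eta>" and "c = s + real (Suc (Suc n)) * \<eta> - l"
  have bc: "s \<le> b - l" "b - l \<le> b" "b \<le> c" "c = b + \<eta> - l"
  proof -
    have "0 \<le> real n * \<eta>" using assms(1,2) by (intro mult_nonneg_nonneg) auto
    moreover have "b = s + real n * \<eta> + \<eta>" "c = b + \<eta> - l"
      by (simp_all add: b_def c_def distrib_right)
    ultimately show "s \<le> b - l" "b - l \<le> b" "b \<le> c" "c = b + \<eta> - l"
      using assms(1,2) by linarith+
  qed
  have sub: "g integrable_on {x..y}" if "s \<le> x" "y \<le> c" for x y
    using that Suc.prems(1) unfolding c_def by (intro integrable_continuous_real) (auto elim: continuous_on_subset)
  have "(\<Sum>j<Suc (Suc n). integral {s + real j * \<eta>..s + real j * \<eta> + \<eta> - l} g) \<le> integral {s..b - l} g + integral {b..c} g"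
    unfolding sum.lessThan_Suc[of _ "Suc n"]
  proof (rule add_mono)
    show "(\<Sum>j<Suc n. integral {s + real j * \<eta>..s + real j * \<eta> + \<eta> - l} g) \<le> integral {s..b - l} g"
      unfolding b_def using bc
      by (intro Suc.IH continuous_on_subset[OF Suc.prems(1)] Suc.prems(2)) (auto simp: b_def c_def)
  qed (simp add: bc(4) b_def)
  also have "\<dots> \<le> integral {s..b - l} g + (integral {b - l..b} g + integral {b..c} g)"
    using bc by (intro add_left_mono) (auto simp: c_def intro!: integral_nonneg sub Suc.prems(2))
  also have "integral {b - l..b} g + integral {b..c} g = integral {b - l..c} g"
    by (rule Henstock_Kurzweil_Integration.integral_combine) (use bc in \<open>auto intro!: sub\<close>)
  also have "integral {s..b - l} g + integral {b - l..c} g = integral {s..c} g"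
    by (rule Henstock_Kurzweil_Integration.integral_combine) (use bc in \<open>auto intro!: sub\<close>)
  finally show ?case by (simp add: c_def)
qed simp

text \<open>Each term is at most the whole weighted sum, so \<open>x i\<close> is at most
  \<open>2 powr - ((i + 1) * \<epsilon>)\<close> times its r-th root, and the geometric series gives
  1/(2^\<epsilon> - 1). The argument is the same for \<open>r\<close> below and above 1.\<close>

lemma sum_le_weighted_powr:
  fixes x :: "nat \<Rightarrow> real"
  assumes "0 < \<epsilon>" "0 < r" "\<And>i. 0 \<le> x i"
  shows "(\<Sum>i<M. x i) powr r \<le> (1 / (2 powr \<epsilon> - 1)) powr r * (\<Sum>i<M. 2 powr (real (Suc i) * \<epsilon> * r) * x i powr r)"
proof -
  define S where "S = (\<Sum>i<M. 2 powr (real (Suc i) * \<epsilon> * r) * x i powr r)"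
  define t where "t = 2 powr - \<epsilon>"
  have t: "0 < t" "t < 1" using assms(1) by (auto simp: t_def powr_less_one)
  have S: "0 \<le> S" unfolding S_def by (intro sum_nonneg) auto
  have "x i \<le> t * t ^ i * S powr (1/r)" if "i < M" for i
  proof -
    have "2 powr (real (Suc i) * \<epsilon> * r) * x i powr r \<le> S"
      unfolding S_def using that by (intro member_le_sum[of i "{..<M}" "\<lambda>i. 2 powr (real (Suc i) * \<epsilon> * r) * x i powr r"]) auto
    then have "(2 powr (real (Suc i) * \<epsilon>) * x i) powr r \<le> S"
      using assms(3)[of i] by (simp add: powr_mult powr_powr)
    then have "((2 powr (real (Suc i) * \<epsilon>) * x i) powr r) powr (1/r) \<le> S powr (1/r)"
      using assms by (intro powr_mono2) auto
    then have "2 powr (real (Suc i) * \<epsilon>) * x i \<le> S powr (1/r)"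
      using assms by (simp add: powr_powr)
    moreover have "t * t ^ i = inverse (2 powr (real (Suc i) * \<epsilon>))"
    proof -
      have "t * t ^ i = t powr real (Suc i)" using t powr_realpow[of t "Suc i"] by simp
      then show ?thesis by (simp add: t_def powr_powr powr_minus[symmetric] mult_ac)
    qed
    moreover have "x i = inverse (2 powr (real (Suc i) * \<epsilon>)) * (2 powr (real (Suc i) * \<epsilon>) * x i)"
      by simp
    ultimately show ?thesis by (metis inverse_nonnegative_iff_nonnegative mult_left_mono powr_ge_zero)
  qed
  then have "(\<Sum>i<M. x i) \<le> (\<Sum>i<M. t * t ^ i * S powr (1/r))" by (intro sum_mono) auto
  also have "\<dots> = t * ((1 - t^M) / (1 - t)) * S powr (1/r)"
    using t by (simp add: sum_distrib_right[symmetric] sum_distrib_left[symmetric] sum_gp_strict)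
  also have "\<dots> \<le> t * (1 / (1 - t)) * S powr (1/r)"
    using t by (intro mult_right_mono mult_left_mono divide_right_mono) auto
  also have "t * (1 / (1 - t)) = 1 / (2 powr \<epsilon> - 1)"
    using t by (simp add: t_def powr_minus field_simps)
  finally have "(\<Sum>i<M. x i) powr r \<le> (1 / (2 powr \<epsilon> - 1) * S powr (1/r)) powr r"
    using assms by (intro powr_mono2) (auto intro: sum_nonneg)
  also have "\<dots> = (1 / (2 powr \<epsilon> - 1)) powr r * S"
    using assms S unfolding powr_mult by (simp add: powr_powr)
  finally show ?thesis by (simp add: S_def)
qed

text \<open>The increment over \<open>[a, a + \<eta>]\<close> is replaced by the difference of the
  averages over a last and a first window of length \<open>\<eta>/2^M\<close>. For
  \<open>M = 0\<close> the windows coincide and the difference vanishes. Halving a window to length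
  \<open>l\<close> changes its average by half the mean of \<open>X (u + l) - X u\<close> over a
  stretch of length \<open>l\<close>, which Jensen's inequality bounds by the integral over all
  admissible u. Integrals of increments, unlike increments at points, can be summed over a
  grid.\<close>

lemma average_incr_le:
  fixes X :: "real \<Rightarrow> 'a::euclidean_space"
  assumes "continuous_on {a..a+\<eta>} X" "0 < \<eta>" "1 \<le> p"
  shows "norm ((2^M/\<eta>) *\<^sub>R integral {a+\<eta>-\<eta>/2^M..a+\<eta>} X - (2^M/\<eta>) *\<^sub>R integral {a..a+\<eta>/2^M} X)
    \<le> (\<Sum>i<M. (integral {a..a+\<eta>-\<eta>/2^Suc i} (\<lambda>u. norm (X (u + \<eta>/2^Suc i) - X u) powr p) / (\<eta>/2^Suc i)) powr (1/p))"
proof (induction M)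
  case (Suc M)
  define l where "l = \<eta>/2^Suc M"
  have l: "0 < l" "\<eta>/2^M = 2 * l" "2^M/\<eta> = 1/(2*l)" "2^Suc M/\<eta> = 1/l" "2 * l \<le> \<eta>"
    using assms(2) by (auto simp: l_def field_simps)
  define D where "D u = X (u + l) - X u" for u
  have cX: "X integrable_on {x..y}" if "a \<le> x" "y \<le> a + \<eta>" for x y
    using that assms by (intro integrable_continuous_real) (auto elim: continuous_on_subset)
  have cD: "continuous_on {a..a+\<eta>-l} D"
    unfolding D_def using l
    by (intro continuous_intros continuous_on_compose2[OF assms(1)] continuous_on_subset[OF assms(1)]) auto
  define J where "J = integral {a..a+\<eta>-l} (\<lambda>u. norm (D u) powr p)"
  define V where "V x = integral {x..x+l} D" for x
  have V: "norm ((1/(2*l)) *\<^sub>R V x) \<le> 1/2 * (J / l) powr (1/p)" if x: "a \<le> x" "x + l \<le> a + \<eta> - l" for x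
  proof -
    have cp: "continuous_on {a..a+\<eta>-l} (\<lambda>u. norm (D u) powr p)"
      using assms by (intro continuous_on_powr' continuous_intros cD) auto
    have "norm (V x) \<le> l * (integral {x..x+l} (\<lambda>u. norm (D u) powr p) / l) powr (1/p)"
      unfolding V_def using x by (intro norm_integral_le_powr l assms continuous_on_subset[OF cD]) auto
    also have "\<dots> \<le> l * (J / l) powr (1/p)"
    proof (intro mult_left_mono powr_mono2 divide_right_mono)
      show "integral {x..x+l} (\<lambda>u. norm (D u) powr p) \<le> J"
        unfolding J_def using x
        by (intro integral_subset_le integrable_continuous_real cp continuous_on_subset[OF cp]) auto
      show "0 \<le> integral {x..x+l} (\<lambda>u. norm (D u) powr p) / l"
        using l x by (intro divide_nonneg_pos integral_nonneg integrable_continuous_real continuous_on_subset[OF cp]) auto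
    qed (use l assms in auto)
    finally show ?thesis using l by (simp add: field_simps)
  qed
  have Veq: "V x = integral {x+l..x+2*l} X - integral {x..x+l} X" if x: "a \<le> x" "x + 2 * l \<le> a + \<eta>" for x
  proof -
    have "integral {x..x+l} (\<lambda>u. X (u + l)) = integral {x+l..x+2*l} X"
      using integral_shift_real_ivl[of "x + l" l "x + 2*l" X] by (simp add: add.commute)
    moreover have "(\<lambda>u. X (u + l)) integrable_on {x..x+l}"
      using x l by (intro integrable_continuous_real continuous_on_compose2[OF assms(1)]) (auto intro!: continuous_intros)
    ultimately show ?thesis
      unfolding V_def D_def using x l by (subst integral_diff) (auto intro!: cX)
  qed
  have comb: "integral {x..x+l} X + integral {x+l..x+2*l} X = integral {x..x+2*l} X" if "a \<le> x" "x + 2*l \<le> a + \<eta>" for x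
    by (rule Henstock_Kurzweil_Integration.integral_combine) (use that l in \<open>auto intro!: cX\<close>)
  define b where "b = a + \<eta> - 2 * l"
  have b: "a \<le> b" "b + 2 * l = a + \<eta>" "b + l = a + \<eta> - l" using l by (auto simp: b_def)
  have half: "(1/(2*l)) *\<^sub>R (u + v) + (1/(2*l)) *\<^sub>R (v - u) = (1/l) *\<^sub>R v" for u v :: 'a
  proof -
    have "(u + v) + (v - u) = 2 *\<^sub>R v" by (simp add: scaleR_2)
    then have "(1/(2*l)) *\<^sub>R (u + v) + (1/(2*l)) *\<^sub>R (v - u) = (1/(2*l)) *\<^sub>R (2 *\<^sub>R v)"
      by (simp only: scaleR_add_right[symmetric])
    then show ?thesis by simp
  qed
  have bI: "integral {b+l..b+2*l} X = integral {a+\<eta>-l..a+\<eta>} X" "integral {b..b+2*l} X = integral {a+\<eta>-2*l..a+\<eta>} X"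
    by (simp_all only: b(2,3) b_def[symmetric])
  have bV: "V b = integral {b+l..b+2*l} X - integral {b..b+l} X" "integral {b..b+l} X + integral {b+l..b+2*l} X = integral {b..b+2*l} X"
    by (rule Veq comb; simp only: b order_refl)+
  have R: "(1/l) *\<^sub>R integral {a+\<eta>-l..a+\<eta>} X = (1/(2*l)) *\<^sub>R integral {a+\<eta>-2*l..a+\<eta>} X + (1/(2*l)) *\<^sub>R V b"
    using half[of "integral {b..b+l} X" "integral {b+l..b+2*l} X"] unfolding bV(2) unfolding bV(1)[symmetric] unfolding bI by (rule sym)
  have L: "(1/l) *\<^sub>R integral {a..a+l} X = (1/(2*l)) *\<^sub>R integral {a..a+2*l} X - (1/(2*l)) *\<^sub>R V a"
  proof -
    have "V a = - (integral {a..a+l} X - integral {a+l..a+2*l} X)" "integral {a..a+2*l} X = integral {a+l..a+2*l} X + integral {a..a+l} X"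
      using Veq[of a] comb[of a] l by (simp_all add: add.commute)
    then show ?thesis using half[of "integral {a+l..a+2*l} X" "integral {a..a+l} X"] by (simp only: scaleR_minus_right minus_minus diff_minus_eq_add)
  qed
  have "norm ((1/l) *\<^sub>R integral {a+\<eta>-l..a+\<eta>} X - (1/l) *\<^sub>R integral {a..a+l} X)
     = norm (((1/(2*l)) *\<^sub>R integral {a+\<eta>-2*l..a+\<eta>} X - (1/(2*l)) *\<^sub>R integral {a..a+2*l} X) + ((1/(2*l)) *\<^sub>R V b + (1/(2*l)) *\<^sub>R V a))"
    unfolding R L by (simp add: algebra_simps)
  also have "\<dots> \<le> norm ((1/(2*l)) *\<^sub>R integral {a+\<eta>-2*l..a+\<eta>} X - (1/(2*l)) *\<^sub>R integral {a..a+2*l} X)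
      + (norm ((1/(2*l)) *\<^sub>R V b) + norm ((1/(2*l)) *\<^sub>R V a))"
    by (intro norm_triangle_mono order_refl norm_triangle_ineq)
  also have "\<dots> \<le> (\<Sum>i<M. (integral {a..a+\<eta>-\<eta>/2^Suc i} (\<lambda>u. norm (X (u + \<eta>/2^Suc i) - X u) powr p) / (\<eta>/2^Suc i)) powr (1/p))
      + (1/2 * (J / l) powr (1/p) + 1/2 * (J / l) powr (1/p))"
    using Suc.IH unfolding l(2,3) by (intro add_mono V) (use b l in auto)
  also have "\<dots> = (\<Sum>i<Suc M. (integral {a..a+\<eta>-\<eta>/2^Suc i} (\<lambda>u. norm (X (u + \<eta>/2^Suc i) - X u) powr p) / (\<eta>/2^Suc i)) powr (1/p))"
    by (simp add: J_def l_def D_def)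
  finally show ?case unfolding l(4) l_def[symmetric] .
qed simp

lemma average_tendsto:
  fixes X :: "real \<Rightarrow> 'a::euclidean_space"
  assumes X: "continuous_on {a..b} X" and c: "c \<in> {a..b}"
    and uv: "\<And>n. a \<le> u n" "\<And>n. u n < v n" "\<And>n. v n \<le> b" "u \<longlonglongrightarrow> c" "v \<longlonglongrightarrow> c"
  shows "(\<lambda>n::nat. (1/(v n - u n)) *\<^sub>R integral {u n..v n} X) \<longlonglongrightarrow> X c"
proof (rule LIMSEQ_I)
  fix d :: real assume d: "d > 0"
  obtain r where r: "r > 0" "\<And>x. x \<in> {a..b} \<Longrightarrow> \<bar>x - c\<bar> < r \<Longrightarrow> norm (X x - X c) < d/2"
    using X c d unfolding continuous_on_iff dist_norm by (metis half_gt_zero real_norm_def)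
  have "\<forall>\<^sub>F n in sequentially. c - r < u n" "\<forall>\<^sub>F n in sequentially. v n < c + r"
    using uv(4,5) r(1) by (auto intro!: order_tendstoD)
  then have "\<forall>\<^sub>F n in sequentially. norm ((1/(v n - u n)) *\<^sub>R integral {u n..v n} X - X c) < d"
  proof eventually_elim
    case (elim n)
    let ?l = "v n - u n"
    have l: "0 < ?l" using uv(2)[of n] by simp
    have i: "X integrable_on {u n..v n}"
      using uv(1,3)[of n] by (intro integrable_continuous_real continuous_on_subset[OF X]) auto
    have "(1/?l) *\<^sub>R integral {u n..v n} X - X c = (1/?l) *\<^sub>R integral {u n..v n} (\<lambda>x. X x - X c)"
      using l i by (subst integral_diff) (auto simp: scaleR_diff_right)
    also have "norm \<dots> \<le> (1/?l) * (d/2 * ?l)"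
    proof -
      have "norm (integral {u n..v n} (\<lambda>x. X x - X c)) \<le> integral {u n..v n} (\<lambda>x. d/2)"
      proof (rule integral_norm_bound_integral)
        show "norm (X x - X c) \<le> d/2" if "x \<in> {u n..v n}" for x
          by (rule less_imp_le, rule r(2)) (use that elim uv(1,3)[of n] in auto)
      qed (use i in \<open>auto intro!: integrable_diff\<close>)
      then show ?thesis using l by (simp add: pos_divide_le_eq mult.commute)
    qed
    also have "\<dots> < d" using l d by simp
    finally show ?case .
  qed
  then show "\<exists>N. \<forall>n\<ge>N. norm ((1/(v n - u n)) *\<^sub>R integral {u n..v n} X - X c) < d"
    unfolding eventually_sequentially .
qed

text \<open>The first summand serves finite \<open>p\<close>, the second \<open>p = top\<close>;
  their sum avoids a case distinction.\<close>

definition "sampling_const \<epsilon> r = (1 / (2 powr \<epsilon> - 1)) powr r + 2 powr (r::real)"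

context besov_path
begin

text \<open>For \<open>p = top\<close> this is 0, since \<open>enn2real top = 0\<close> and division by 0 gives 0.\<close>

abbreviation "ip \<equiv> 1 / enn2real p"

lemma w_integral_le:
  assumes "p \<noteq> top" "0 < l" "l \<le> T"
  shows "integral {0..T - l} (\<lambda>u. norm (X (u + l) - X u) powr enn2real p) \<le> w l powr enn2real p"
  using w_Lpc[of l l] assms p_real_1[OF assms(1)] by (simp add: Lpc_def max_absorb2)

lemma w_sup_le:
  assumes "p = top" "0 \<le> l" "l < T" "u \<in> {0..T - l}"
  shows "norm (X (u + l) - X u) \<le> w l"
  using w_Lpc[of l l] assms by (simp add: Lpc_def)

text \<open>At finite \<open>p\<close> each grid increment is expanded by
  \<open>average_incr_le\<close>, with the scales weighted by means of \<open>\<epsilon>\<close>.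
  For a fixed scale the integrals over the grid cells add up to at most the p-th power of one
  modulus, wherever the grid lies; \<open>sum_powr_le_power_mean\<close> then turns p-th into r-th
  powers over \<open>2^k\<close> cells. Its cardinality factor and the normalisation by the scale
  combine to the exponent \<open>max 1 (r * ip)\<close>.\<close>

lemma lev_dpow_le_sampling:
  assumes sh: "0 \<le> s" "0 < h" "s + h \<le> T" and \<epsilon>: "0 < \<epsilon>" and r: "0 < r"
    and D: "\<And>M. (\<Sum>i<M. 2 powr (real (Suc i) * (ip + \<epsilon>) * r) * w (h/2^(k + Suc i)) powr r) \<le> D"
  shows "lev (dpow r X) k s h \<le> sampling_const \<epsilon> r * h powr - (r * ip) * 2 powr (k * max 1 (r * ip)) * D"
proof (cases "p = top")
  case True
  have "w (h/2^Suc k) powr r \<le> D"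
  proof -
    have "1 * w (h/2^Suc k) powr r \<le> 2 powr ((ip + \<epsilon>) * r) * w (h/2^Suc k) powr r"
      using \<epsilon> r inv_p(1) by (intro mult_right_mono ge_one_powr_ge_zero mult_nonneg_nonneg) auto
    also have "\<dots> \<le> D" using D[of 1] by simp
    finally show ?thesis by simp
  qed
  have "lev (dpow r X) k s h \<le> (\<Sum>j<(2::nat)^k. (2 * w (h/2^Suc k)) powr r)"
    unfolding lev_eq_sum
  proof (rule sum_mono)
    fix j assume j: "j \<in> {..<(2::nat)^k}"
    \<comment> \<open>Splitting at the midpoint keeps the length \<open>l\<close> below
      \<open>T\<close>, as the supremum bound requires; the whole interval may have length
      \<open>T\<close>.\<close>
    define x l where "x = s + real j * (h/2^k)" and "l = h/2^Suc k"
    have l: "h/2^k = 2 * l" "0 < l" using sh by (auto simp: l_def)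
    have x: "0 \<le> x" "x + 2 * l \<le> T"
      using dyadic_point[of h j k s] j sh l unfolding x_def by auto
    have "norm (X (x + l) - X x) \<le> w l" "norm (X (x + l + l) - X (x + l)) \<le> w l"
      by (rule w_sup_le[OF True]; use x l in auto)+
    then have "norm (X (x + 2 * l) - X x) \<le> 2 * w l"
      using norm_triangle_ineq[of "X (x + l) - X x" "X (x + l + l) - X (x + l)"] by (simp add: algebra_simps)
    then have "dpow r X x (2 * l) \<le> (2 * w l) powr r"
      unfolding dpow_def using r by (intro powr_mono2) auto
    then show "dpow r X (s + real j * (h/2^k)) (h/2^k) \<le> (2 * w (h/2^Suc k)) powr r"
      unfolding l(1)[symmetric] unfolding x_def l_def .
  qed
  also have "\<dots> = 2^k * (2 powr r * w (h/2^Suc k) powr r)" by (simp add: powr_mult)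
  also have "\<dots> \<le> 2^k * (sampling_const \<epsilon> r * D)"
  proof (intro mult_left_mono mult_mono)
    show "2 powr r \<le> sampling_const \<epsilon> r" unfolding sampling_const_def by simp
    then show "0 \<le> sampling_const \<epsilon> r" by (rule order_trans[rotated]) simp
  qed (use \<open>w _ powr r \<le> D\<close> in auto)
  finally show ?thesis using True sh by (simp add: powr_realpow mult_ac)
next
  case False
  define P where "P = enn2real p"
  have P: "1 < P" using p_real_1[OF False] by (simp add: P_def)
  define \<eta> where "\<eta> = h/2^k"
  have \<eta>: "0 < \<eta>" "h = 2^k * \<eta>" using sh by (auto simp: \<eta>_def)
  define l where "l i = \<eta>/2^Suc i" for i
  have l: "0 < l i" "l i \<le> \<eta>" "l i = h/2^(k + Suc i)" for i
    using \<eta>(1) one_le_power[of "2::real" "Suc i"] by (auto simp: l_def \<eta>_def power_add field_simps)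
  have \<eta>h: "\<eta> \<le> h" "h \<le> T" using sh by (auto simp: \<eta>_def field_simps)
  define a where "a j = s + real j * \<eta>" for j
  have a: "0 \<le> a j" "a j + \<eta> \<le> T" if "j < 2^k" for j
    using dyadic_point[of h j k s] that sh unfolding a_def \<eta>_def by auto
  define g where "g i u = norm (X (u + l i) - X u) powr P" for i u
  have g: "continuous_on {0..T - l i} (g i)" for i
    unfolding g_def using l[of i] \<eta>h P
    by (intro continuous_on_powr' continuous_on_norm_incr continuous_intros) auto
  have g0: "0 \<le> g i u" for i u by (simp add: g_def)
  define I where "I i j = integral {a j..a j + \<eta> - l i} (g i)" for i j
  have I0: "0 \<le> I i j" if "j < 2^k" for i j
    unfolding I_def using a[OF that]
    by (intro integral_nonneg integrable_continuous_real continuous_on_subset[OF g]) (auto simp: g0)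
  have Isum: "(\<Sum>j<(2::nat)^k. I i j) \<le> w (l i) powr P" for i
  proof -
    obtain n where n: "(2::nat)^k = Suc n" by (metis Suc_pred zero_less_numeral zero_less_power)
    have nk: "real (Suc n) = 2^k" by (metis n of_nat_numeral of_nat_power)
    have e: "s + real (Suc n) * \<eta> - l i = s + h - l i" unfolding nk \<eta>(2) ..
    have "(\<Sum>j<Suc n. I i j) \<le> integral {s..s + real (Suc n) * \<eta> - l i} (g i)"
      unfolding I_def a_def
    proof (rule sum_integral_tiles_le)
      show "continuous_on {s..s + real (Suc n) * \<eta> - l i} (g i)"
        unfolding e using sh by (auto intro: continuous_on_subset[OF g])
    qed (use l(1,2)[of i] in \<open>auto simp: g0\<close>)
    also have "\<dots> \<le> integral {0..T - l i} (g i)"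
      unfolding e using sh by (intro integral_subset_le integrable_continuous_real g continuous_on_subset[OF g]) (auto simp: g0)
    also have "\<dots> \<le> w (l i) powr P"
      unfolding g_def P_def using l[of i] \<eta>h by (intro w_integral_le False) auto
    finally show ?thesis by (simp add: n)
  qed
  \<comment> \<open>Differences of window averages; they converge to the increment by continuity of
    \<open>X\<close>, so a bound uniform in \<open>M\<close> passes to the limit.\<close>
  define A where "A M j = (1/(a j + \<eta> - (a j + \<eta> - \<eta>/2^M))) *\<^sub>R integral {a j + \<eta> - \<eta>/2^M..a j + \<eta>} X
     - (1/(a j + \<eta>/2^M - a j)) *\<^sub>R integral {a j..a j + \<eta>/2^M} X" for M j
  have e0: "(\<lambda>M. \<eta>/2^M) \<longlonglongrightarrow> 0" by real_asymp
  have Alim: "(\<lambda>M. A M j) \<longlonglongrightarrow> X (a j + \<eta>) - X (a j)" if "j < 2^k" for j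
    unfolding A_def
  proof (intro tendsto_diff average_tendsto)
    show "continuous_on {a j..a j + \<eta>} X" "continuous_on {a j..a j + \<eta>} X"
      using a[OF that] by (auto intro: continuous_on_subset[OF cont])
    show "(\<lambda>M. a j + \<eta> - \<eta>/2^M) \<longlonglongrightarrow> a j + \<eta>" "(\<lambda>M. a j + \<eta>/2^M) \<longlonglongrightarrow> a j"
      using tendsto_diff[OF tendsto_const[of "a j + \<eta>"] e0] tendsto_add[OF tendsto_const[of "a j"] e0] by auto
  qed (use \<eta> in \<open>auto simp: field_simps\<close>)
  define c where "c = (1 / (2 powr \<epsilon> - 1)) powr r"
  have c0: "0 \<le> c" by (simp add: c_def)
  define m where "m = max 0 (1 - r/P)"
  have m0: "0 \<le> m" by (simp add: m_def)
  have Aj: "norm (A M j) powr r \<le> c * (\<Sum>i<M. 2 powr (real (Suc i) * \<epsilon> * r) * ((I i j / l i) powr (1/P)) powr r)" if "j < 2^k" for M j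
  proof -
    have "norm (A M j) \<le> (\<Sum>i<M. (I i j / l i) powr (1/P))"
    proof -
      have "continuous_on {a j..a j + \<eta>} X"
        using a[OF that] by (auto intro: continuous_on_subset[OF cont])
      from average_incr_le[OF this \<eta>(1), of P M] P show ?thesis
        unfolding A_def I_def g_def l_def by simp
    qed
    then have "norm (A M j) powr r \<le> (\<Sum>i<M. (I i j / l i) powr (1/P)) powr r"
      using r by (intro powr_mono2) auto
    also have "\<dots> \<le> c * (\<Sum>i<M. 2 powr (real (Suc i) * \<epsilon> * r) * ((I i j / l i) powr (1/P)) powr r)"
      unfolding c_def by (rule sum_le_weighted_powr[OF \<epsilon> r]) simp
    finally show ?thesis .
  qed
  have xi: "(\<Sum>j<(2::nat)^k. ((I i j / l i) powr (1/P)) powr r) \<le> h powr - (r * ip) * 2 powr (k * max 1 (r * ip)) * (2 powr (real (Suc i) * ip * r) * w (l i) powr r)" for i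
  proof -
    have "(\<Sum>j<(2::nat)^k. ((I i j / l i) powr (1/P)) powr r) = (\<Sum>j<(2::nat)^k. (I i j powr (1/P)) powr r) * l i powr - (r/P)"
      unfolding sum_distrib_right
      by (intro sum.cong refl) (simp add: powr_divide powr_powr powr_minus_divide mult.commute)
    also have "\<dots> \<le> (real (card {..<(2::nat)^k}) powr m * (\<Sum>j<(2::nat)^k. (I i j powr (1/P)) powr P) powr (r/P)) * l i powr - (r/P)"
      unfolding m_def by (intro mult_right_mono sum_powr_le_power_mean r) (use P in auto)
    also have "(\<Sum>j<(2::nat)^k. (I i j powr (1/P)) powr P) = (\<Sum>j<(2::nat)^k. I i j)"
      using I0 P by (intro sum.cong refl) (simp add: powr_powr)
    also have "(real (card {..<(2::nat)^k}) powr m * (\<Sum>j<(2::nat)^k. I i j) powr (r/P)) * l i powr - (r/P)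
       \<le> ((2 powr k) powr m * (w (l i) powr P) powr (r/P)) * l i powr - (r/P)"
      using Isum[of i] I0 r P m0
      by (intro mult_right_mono mult_mono powr_mono2) (auto simp: powr_realpow intro!: sum_nonneg)
    also have "\<dots> = 2 powr (k * m) * w (l i) powr r * (h / 2 powr (k + Suc i)) powr - (r/P)"
      using P unfolding l(3) by (simp add: powr_powr powr_realpow[symmetric] powr_add)
    also have "(h / 2 powr (k + Suc i)) powr - (r/P) = h powr - (r/P) * 2 powr ((k + Suc i) * (r/P))"
      by (simp add: powr_divide powr_powr powr_minus_divide)
    also have "2 powr (k * m) * w (l i) powr r * (h powr - (r/P) * 2 powr ((k + Suc i) * (r/P)))
      = h powr - (r/P) * 2 powr (k * m + k * (r/P)) * (2 powr (real (Suc i) * (r/P)) * w (l i) powr r)"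
      unfolding of_nat_add distrib_right powr_add by (simp only: mult_ac)
    also have "k * m + k * (r/P) = k * max 1 (r/P)"
      by (simp add: m_def max_def algebra_simps)
    finally show ?thesis by (simp add: P_def mult_ac)
  qed
  have "(\<Sum>j<(2::nat)^k. norm (A M j) powr r) \<le> c * h powr - (r * ip) * 2 powr (k * max 1 (r * ip)) * D" for M
  proof -
    have "(\<Sum>j<(2::nat)^k. norm (A M j) powr r) \<le> (\<Sum>j<(2::nat)^k. c * (\<Sum>i<M. 2 powr (real (Suc i) * \<epsilon> * r) * ((I i j / l i) powr (1/P)) powr r))"
      by (intro sum_mono Aj) auto
    also have "\<dots> = c * (\<Sum>i<M. 2 powr (real (Suc i) * \<epsilon> * r) * (\<Sum>j<(2::nat)^k. ((I i j / l i) powr (1/P)) powr r))"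
      unfolding sum_distrib_left[symmetric] by (subst sum.swap) (simp add: sum_distrib_left)
    also have "\<dots> \<le> c * (\<Sum>i<M. 2 powr (real (Suc i) * \<epsilon> * r) * (h powr - (r * ip) * 2 powr (k * max 1 (r * ip)) * (2 powr (real (Suc i) * ip * r) * w (l i) powr r)))"
      by (intro mult_left_mono sum_mono xi c0) auto
    also have "\<dots> = c * (h powr - (r * ip) * 2 powr (k * max 1 (r * ip))) * (\<Sum>i<M. 2 powr (real (Suc i) * (ip + \<epsilon>) * r) * w (l i) powr r)"
      unfolding sum_distrib_left by (intro sum.cong refl) (simp add: powr_add distrib_left distrib_right)
    also have "\<dots> \<le> c * (h powr - (r * ip) * 2 powr (k * max 1 (r * ip))) * D"
      unfolding l(3) by (intro mult_left_mono D mult_nonneg_nonneg c0) auto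
    finally show ?thesis by (simp add: mult.assoc)
  qed
  moreover have "(\<lambda>M. \<Sum>j<(2::nat)^k. norm (A M j) powr r) \<longlonglongrightarrow> (\<Sum>j<(2::nat)^k. norm (X (a j + \<eta>) - X (a j)) powr r)"
    by (intro tendsto_sum tendsto_powr2 tendsto_norm Alim tendsto_const) (use r in auto)
  ultimately have "(\<Sum>j<(2::nat)^k. norm (X (a j + \<eta>) - X (a j)) powr r) \<le> c * h powr - (r * ip) * 2 powr (k * max 1 (r * ip)) * D"
    by (intro LIMSEQ_le_const2) auto
  moreover have "lev (dpow r X) k s h = (\<Sum>j<(2::nat)^k. norm (X (a j + \<eta>) - X (a j)) powr r)"
    unfolding lev_eq_sum dpow_def a_def \<eta>_def ..
  moreover have "c * h powr - (r * ip) * 2 powr (k * max 1 (r * ip)) * D \<le> sampling_const \<epsilon> r * h powr - (r * ip) * 2 powr (k * max 1 (r * ip)) * D"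
    using D[of 0] by (intro mult_right_mono) (auto simp: sampling_const_def c_def)
  ultimately show ?thesis by linarith
qed

end

text \<open>In the borderline case \<open>\<kappa> = 0\<close> there is no geometric decay, and the
  value 1 goes with the l^r bound \<open>sum_\<beta>_powr\<close> used instead.\<close>

definition "geom_const (\<kappa>::real) = (if \<kappa> = 0 then 1 else 1 / (1 - 2 powr - \<kappa>))"

lemma geom_const_nonneg: "0 \<le> \<kappa> \<Longrightarrow> 0 \<le> geom_const \<kappa>"
  by (auto simp: geom_const_def powr_less_one less_imp_le)

text \<open>In order: the sampling constant for the weight (\<alpha> - ip)/2, the cost of replacing
  a length in \<open>[h/2, h]\<close> by h, the cost of \<open>w_le_\<beta>\<close>, the geometric
  sum over the sampling scales, and the sum over the levels.\<close>

definition "dyadic_const \<alpha> ip r =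
  sampling_const ((\<alpha> - ip)/2) r * 2 powr (r * ip) * 2 powr (\<alpha> * r) *
  (geom_const ((\<alpha> - ip)/2 * r) * geom_const (\<alpha> * r - max 1 (r * ip)))" for \<alpha> ip r :: real

lemma dyadic_powr: "(h/2^k) powr x = h powr x * 2 powr - (real k * x)" for h x :: real
proof -
  have e: "(2::real)^k = 2 powr real k" by (simp add: powr_realpow)
  show ?thesis unfolding e powr_divide powr_powr powr_minus_divide by simp
qed

lemma enn2real_half: "enn2real (p/2) = enn2real p / 2" for p :: ennreal
proof (cases p)
  case (real x)
  then show ?thesis by (simp add: ennreal_numeral[symmetric] divide_ennreal del: ennreal_numeral)
qed (simp add: ennreal_top_divide)

lemma half_eq_top_iff: "p/2 = top \<longleftrightarrow> p = top" for p :: ennreal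
proof (cases p)
  case (real x)
  then show ?thesis by (simp add: ennreal_numeral[symmetric] divide_ennreal del: ennreal_numeral)
qed (simp add: ennreal_top_divide)

lemma half_pos: "0 < p \<Longrightarrow> 0 < p/2" for p :: ennreal
  by (simp add: ennreal_zero_less_divide)

context besov_path
begin

lemma weighted_sum_\<beta>_le:
  assumes r: "0 < r" and \<kappa>: "0 < \<kappa> \<or> (\<kappa> = 0 \<and> q \<le> ennreal r)"
  shows "(\<Sum>k<N. 2 powr - (real k * \<kappa>) * \<beta> (m + k) powr r) \<le> geom_const \<kappa> * B powr r"
proof (cases "\<kappa> = 0")
  case True
  have "(\<Sum>k<N. \<beta> (m + k) powr r) = (\<Sum>n\<in>(+) m ` {..<N}. \<beta> n powr r)"
    by (simp add: sum.reindex)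
  also have "\<dots> \<le> B powr r" using \<kappa> True by (intro sum_\<beta>_powr) auto
  finally show ?thesis using True by (simp add: geom_const_def)
next
  case False
  then have \<kappa>0: "0 < \<kappa>" using \<kappa> by auto
  define x where "x = 2 powr - \<kappa>"
  have x: "0 < x" "x < 1" using \<kappa>0 by (auto simp: x_def powr_less_one)
  have xk: "2 powr - (real k * \<kappa>) = x ^ k" for k
  proof -
    have "x ^ k = x powr real k" using x by (simp add: powr_realpow)
    then show ?thesis by (simp add: x_def powr_powr mult.commute)
  qed
  have "(\<Sum>k<N. 2 powr - (real k * \<kappa>) * \<beta> (m + k) powr r) \<le> (\<Sum>k<N. x ^ k * B powr r)"
    unfolding xk using x r by (intro sum_mono mult_left_mono powr_mono2 \<beta>_le) auto
  also have "\<dots> = (1 - x^N) / (1 - x) * B powr r"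
    using x by (simp add: sum_distrib_right[symmetric] sum_gp_strict)
  also have "\<dots> \<le> 1 / (1 - x) * B powr r"
    using x by (intro mult_right_mono divide_right_mono) auto
  finally show ?thesis using False by (simp add: geom_const_def x_def)
qed

text \<open>Inserting \<open>w_le_\<beta>\<close> into the sampling bound leaves at level
  \<open>k\<close> the factor \<open>2 powr - (k * \<kappa>')\<close> times a weighted sum of powers
  of \<open>\<beta>\<close> over the scales finer than that level. For \<open>\<kappa>' = 0\<close>
  there is no definite rate of decay; summability holds because the sums over levels and scales can
  be exchanged and each inner sum is at most \<open>B powr r\<close>.\<close>

lemma dyadic_bounds:
  assumes r: "0 < r" and \<kappa>: "0 < \<alpha> * r - max 1 (r * ip) \<or> (\<alpha> * r - max 1 (r * ip) = 0 \<and> q \<le> ennreal r)"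
    and h: "0 < h" "h \<le> T"
  obtains c where "\<And>k::nat. 0 \<le> c k" "summable c" "suminf c \<le> dyadic_const \<alpha> ip r * B powr r * h powr (r * (\<alpha> - ip))"
    "\<And>h' s k. h/2 \<le> h' \<Longrightarrow> h' \<le> h \<Longrightarrow> 0 \<le> s \<Longrightarrow> s + h' \<le> T \<Longrightarrow> lev (dpow r X) k s h' \<le> c k"
proof -
  \<comment> \<open>\<open>\<epsilon>\<close> is half of the available exponent: then
    \<open>ip + \<epsilon> = \<alpha> - \<epsilon>\<close>, so the weights of the sampling bound
    still leave the decay \<open>\<theta> ^ i\<close>.\<close>
  define \<epsilon> \<kappa>' \<mu> where "\<epsilon> = (\<alpha> - ip)/2" and "\<kappa>' = \<alpha> * r - max 1 (r * ip)" and "\<mu> = max 1 (r * ip)"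
  have \<epsilon>: "0 < \<epsilon>" using inv_p(2) by (simp add: \<epsilon>_def)
  have \<kappa>0: "0 \<le> \<kappa>'" using \<kappa> by (auto simp: \<kappa>'_def)
  obtain m where m: "T/2^Suc m < h" "h \<le> T/2^m" using dyadic_scale[OF h] .
  define \<theta> where "\<theta> = 2 powr - (\<epsilon> * r)"
  have \<theta>: "0 < \<theta>" "\<theta> < 1" using \<epsilon> r by (auto simp: \<theta>_def powr_less_one)
  define a where "a k i = \<theta> ^ i * \<beta> (m + Suc k + i) powr r" for k i
  have a0: "0 \<le> a k i" for k i using \<theta> by (simp add: a_def)
  have aB: "a k i \<le> B powr r * \<theta> ^ i" for k i
    unfolding a_def using \<theta> r by (subst mult.commute) (intro mult_right_mono powr_mono2 \<beta>_le, auto)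
  have sg: "summable (\<lambda>i. B powr r * \<theta> ^ i)" using \<theta> by (intro summable_mult summable_geometric) auto
  have sa: "summable (a k)" for k
    by (rule summable_comparison_test'[OF sg]) (use aB a0 in auto)
  define C where "C = sampling_const \<epsilon> r * 2 powr (r * ip) * 2 powr (\<alpha> * r)"
  have sc: "0 \<le> sampling_const \<epsilon> r" by (simp add: sampling_const_def)
  have C0: "0 \<le> C" using sc by (simp add: C_def)
  define c where "c k = C * h powr (r * (\<alpha> - ip)) * (2 powr - (real k * \<kappa>') * suminf (a k))" for k
  have c0: "0 \<le> c k" for k
    unfolding c_def using C0 sa a0 by (intro mult_nonneg_nonneg suminf_nonneg) auto
  have partial: "(\<Sum>k<N. c k) \<le> dyadic_const \<alpha> ip r * B powr r * h powr (r * (\<alpha> - ip))" for N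
  proof -
    have "(\<Sum>k<N. 2 powr - (real k * \<kappa>') * suminf (a k)) = (\<Sum>i. \<Sum>k<N. 2 powr - (real k * \<kappa>') * a k i)"
      using sa by (subst suminf_sum) (auto simp: suminf_mult intro: summable_mult)
    also have "\<dots> \<le> (\<Sum>i. geom_const \<kappa>' * B powr r * \<theta> ^ i)"
    proof (rule suminf_le)
      fix i
      have "(\<Sum>k<N. 2 powr - (real k * \<kappa>') * a k i) = \<theta> ^ i * (\<Sum>k<N. 2 powr - (real k * \<kappa>') * \<beta> ((m + Suc i) + k) powr r)"
        by (simp add: a_def sum_distrib_left mult_ac add_ac)
      also have "\<dots> \<le> \<theta> ^ i * (geom_const \<kappa>' * B powr r)"
        using \<theta> \<kappa> by (intro mult_left_mono weighted_sum_\<beta>_le r) (auto simp: \<kappa>'_def)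
      finally show "(\<Sum>k<N. 2 powr - (real k * \<kappa>') * a k i) \<le> geom_const \<kappa>' * B powr r * \<theta> ^ i"
        by (simp add: mult_ac)
    qed (use \<theta> sa in \<open>auto intro!: summable_sum summable_mult summable_geometric\<close>)
    also have "\<dots> = geom_const \<kappa>' * B powr r * (1 / (1 - \<theta>))"
      using \<theta> by (subst suminf_mult) (auto simp: suminf_geometric intro: summable_geometric)
    also have "1 / (1 - \<theta>) = geom_const (\<epsilon> * r)"
      using \<epsilon> r by (simp add: geom_const_def \<theta>_def)
    finally have "C * h powr (r * (\<alpha> - ip)) * (\<Sum>k<N. 2 powr - (real k * \<kappa>') * suminf (a k)) \<le>
       C * h powr (r * (\<alpha> - ip)) * (geom_const \<kappa>' * B powr r * geom_const (\<epsilon> * r))"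
      using C0 by (intro mult_left_mono) auto
    moreover have "(\<Sum>k<N. c k) = C * h powr (r * (\<alpha> - ip)) * (\<Sum>k<N. 2 powr - (real k * \<kappa>') * suminf (a k))"
      unfolding c_def by (rule sum_distrib_left[symmetric])
    moreover have "C * h powr (r * (\<alpha> - ip)) * (geom_const \<kappa>' * B powr r * geom_const (\<epsilon> * r)) =
        dyadic_const \<alpha> ip r * B powr r * h powr (r * (\<alpha> - ip))"
      unfolding C_def dyadic_const_def \<epsilon>_def \<kappa>'_def by (simp only: mult_ac)
    ultimately show ?thesis by (simp only:)
  qed
  have "summable c"
    by (rule bounded_imp_summable[where B="dyadic_const \<alpha> ip r * B powr r * h powr (r * (\<alpha> - ip))", OF c0])
      (metis partial lessThan_Suc_atMost)
  moreover have "suminf c \<le> dyadic_const \<alpha> ip r * B powr r * h powr (r * (\<alpha> - ip))"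
    by (rule suminf_le_const[OF \<open>summable c\<close> partial])
  moreover have "lev (dpow r X) k s h' \<le> c k" if h': "h/2 \<le> h'" "h' \<le> h" "0 \<le> s" "s + h' \<le> T" for h' s k
  proof -
    have h'0: "0 < h'" using h' h by auto
    define D where "D = 2 powr (\<alpha> * r) * h powr (\<alpha> * r) * 2 powr - (real k * \<alpha> * r) * suminf (a k)"
    have "lev (dpow r X) k s h' \<le> sampling_const \<epsilon> r * h' powr - (r * ip) * 2 powr (k * max 1 (r * ip)) * D"
    proof (rule lev_dpow_le_sampling[OF h'(3) h'0 h'(4) \<epsilon> r])
      fix M
      have "2 powr (real (Suc i) * (ip + \<epsilon>) * r) * w (h'/2^(k + Suc i)) powr r \<le> 2 powr (\<alpha> * r) * h powr (\<alpha> * r) * 2 powr - (real k * \<alpha> * r) * a k i" for i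
      proof -
        have "w (h'/2^(k + Suc i)) \<le> w (h/2^(k + Suc i))"
        proof (rule w_mono)
          show "h'/2^(k + Suc i) \<le> h/2^(k + Suc i)" using h' by (intro divide_right_mono) auto
          have "h/2^(k + Suc i) \<le> h/1" using h one_le_power[of "2::real" "k + Suc i"] by (intro divide_left_mono) auto
          then show "h/2^(k + Suc i) \<le> T" using h by simp
        qed
        also have "\<dots> \<le> 2 powr \<alpha> * (h/2^(k + Suc i)) powr \<alpha> * \<beta> (m + (k + Suc i))"
          by (rule w_le_\<beta>[OF m])
        finally have "w (h'/2^(k + Suc i)) powr r \<le> (2 powr \<alpha> * (h/2^(k + Suc i)) powr \<alpha> * \<beta> (m + (k + Suc i))) powr r"
          using r by (intro powr_mono2) auto
        also have "\<dots> = 2 powr (\<alpha> * r) * (h/2^(k + Suc i)) powr (\<alpha> * r) * \<beta> (m + (k + Suc i)) powr r"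
          by (simp only: powr_mult powr_powr)
        also have "(h/2^(k + Suc i)) powr (\<alpha> * r) = h powr (\<alpha> * r) * 2 powr - (real (k + Suc i) * (\<alpha> * r))"
          by (rule dyadic_powr)
        finally have "2 powr (real (Suc i) * (ip + \<epsilon>) * r) * w (h'/2^(k + Suc i)) powr r \<le>
           2 powr (real (Suc i) * (ip + \<epsilon>) * r) * (2 powr (\<alpha> * r) * (h powr (\<alpha> * r) * 2 powr - (real (k + Suc i) * (\<alpha> * r))) * \<beta> (m + (k + Suc i)) powr r)"
          by (intro mult_left_mono) auto
        also have "\<dots> = 2 powr (\<alpha> * r) * h powr (\<alpha> * r) * (2 powr (real (Suc i) * (ip + \<epsilon>) * r) * 2 powr - (real (k + Suc i) * (\<alpha> * r))) * \<beta> (m + (k + Suc i)) powr r"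
          by (simp only: mult_ac)
        also have "2 powr (real (Suc i) * (ip + \<epsilon>) * r) * 2 powr - (real (k + Suc i) * (\<alpha> * r)) = 2 powr - (real k * \<alpha> * r) * \<theta> ^ Suc i"
        proof -
          have "ip + \<epsilon> = \<alpha> - \<epsilon>" by (simp add: \<epsilon>_def field_simps)
          then have "real (Suc i) * (ip + \<epsilon>) * r + - (real (k + Suc i) * (\<alpha> * r)) = - (real k * \<alpha> * r) + - (\<epsilon> * r) * real (Suc i)"
            unfolding of_nat_add by (simp only:) (simp add: algebra_simps)
          moreover have "\<theta> ^ Suc i = 2 powr (- (\<epsilon> * r) * real (Suc i))"
            unfolding \<theta>_def by (subst powr_realpow[symmetric]) (auto simp: powr_powr)
          ultimately show ?thesis by (simp only: powr_add[symmetric])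
        qed
        also have "2 powr (\<alpha> * r) * h powr (\<alpha> * r) * (2 powr - (real k * \<alpha> * r) * \<theta> ^ Suc i) * \<beta> (m + (k + Suc i)) powr r
           \<le> 2 powr (\<alpha> * r) * h powr (\<alpha> * r) * (2 powr - (real k * \<alpha> * r) * \<theta> ^ i) * \<beta> (m + (k + Suc i)) powr r"
          using \<theta> by (intro mult_right_mono mult_left_mono power_decreasing) auto
        finally show ?thesis
          unfolding a_def add_Suc_right add_Suc add.assoc[symmetric] by (simp only: mult_ac)
      qed
      then have "(\<Sum>i<M. 2 powr (real (Suc i) * (ip + \<epsilon>) * r) * w (h'/2^(k + Suc i)) powr r) \<le>
          (\<Sum>i<M. 2 powr (\<alpha> * r) * h powr (\<alpha> * r) * 2 powr - (real k * \<alpha> * r) * a k i)"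
        by (rule sum_mono)
      also have "\<dots> \<le> D"
        unfolding D_def sum_distrib_left[symmetric] using a0 sa by (intro mult_left_mono sum_le_suminf) auto
      finally show "(\<Sum>i<M. 2 powr (real (Suc i) * (ip + \<epsilon>) * r) * w (h'/2^(k + Suc i)) powr r) \<le> D" .
    qed
    also have "\<dots> \<le> sampling_const \<epsilon> r * (2 powr (r * ip) * h powr - (r * ip)) * 2 powr (k * max 1 (r * ip)) * D"
    proof (intro mult_right_mono mult_left_mono sc)
      have "h' powr - (r * ip) \<le> (h/2) powr - (r * ip)"
        using h h' r inv_p(1) by (intro powr_mono2') auto
      also have "\<dots> = 2 powr (r * ip) * h powr - (r * ip)"
        unfolding powr_divide powr_minus_divide by simp
      finally show "h' powr - (r * ip) \<le> 2 powr (r * ip) * h powr - (r * ip)" .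
      show "0 \<le> D" unfolding D_def using sa a0 by (intro mult_nonneg_nonneg suminf_nonneg) auto
    qed auto
    also have "\<dots> = C * (h powr (\<alpha> * r) * h powr - (r * ip)) * ((2 powr (k * max 1 (r * ip)) * 2 powr - (real k * \<alpha> * r)) * suminf (a k))"
      unfolding D_def C_def by (simp only: mult_ac)
    also have "h powr (\<alpha> * r) * h powr - (r * ip) = h powr (r * (\<alpha> - ip))"
      unfolding powr_add[symmetric] by (simp add: algebra_simps)
    also have "2 powr (k * max 1 (r * ip)) * 2 powr - (real k * \<alpha> * r) = 2 powr - (real k * \<kappa>')"
      unfolding powr_add[symmetric] \<kappa>'_def by (simp add: algebra_simps)
    finally show ?thesis by (simp add: c_def)
  qed
  ultimately show thesis using c0 that by blast
qed

lemma dyadic_var_X: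
  assumes r: "0 < r" and \<kappa>: "0 < \<alpha> * r - max 1 (r * ip) \<or> (\<alpha> * r - max 1 (r * ip) = 0 \<and> q \<le> ennreal r)"
  shows "dyadic_var T r (\<alpha> - ip) (dyadic_const \<alpha> ip r * B powr r) X"
  unfolding dyadic_var_def
proof (intro allI impI, elim conjE)
  fix s h N assume h: "0 \<le> s" "0 < h" "s + h \<le> T"
  then have "h \<le> T" by simp
  then obtain c where c: "\<And>k::nat. 0 \<le> c k" "summable c" "suminf c \<le> dyadic_const \<alpha> ip r * B powr r * h powr (r * (\<alpha> - ip))"
    "\<And>h' s k. h/2 \<le> h' \<Longrightarrow> h' \<le> h \<Longrightarrow> 0 \<le> s \<Longrightarrow> s + h' \<le> T \<Longrightarrow> lev (dpow r X) k s h' \<le> c k"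
    using dyadic_bounds[OF r \<kappa> h(2)] by blast
  have "(\<Sum>k<N. lev (dpow r X) k s h) \<le> (\<Sum>k<N. c k)" using c(4) h by (intro sum_mono) auto
  also have "\<dots> \<le> suminf c" using c by (intro sum_le_suminf) auto
  finally show "(\<Sum>k<N. lev (dpow r X) k s h) \<le> dyadic_const \<alpha> ip r * B powr r * h powr (r * (\<alpha> - ip))"
    using c(3) by simp
qed

lemma dyadic_dominated_X:
  assumes "0 < \<alpha> * 2 - max 1 (2 * ip) \<or> (\<alpha> * 2 - max 1 (2 * ip) = 0 \<and> q \<le> ennreal 2)"
  shows "dyadic_dominated T X"
  unfolding dyadic_dominated_def
proof (intro allI impI, elim conjE)
  fix h assume h: "0 < h" "h \<le> T"
  show "\<exists>c. summable c \<and> (\<forall>k::nat. 0 \<le> c k) \<and>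
     (\<forall>h' s k. h/2 \<le> h' \<and> h' \<le> h \<and> 0 \<le> s \<and> s + h' \<le> T \<longrightarrow> lev (dpow 2 X) k s h' \<le> c k)"
    by (rule dyadic_bounds[of 2 h]) (use assms h in auto)
qed

section \<open>Level sums in L^{p/2}\<close>

definition "kp = kap (p/2)"

text \<open>The third claim says that the decay of \<open>w\<close> at least balances the
  \<open>2^k\<close> intervals of level \<open>k\<close>: either \<open>kp = 1\<close> and
  \<open>\<alpha> \<ge> 1/2\<close>, or \<open>kp = p/2\<close> and
  \<open>\<alpha> * p > 1\<close>.\<close>

lemma kp: "0 < kp" "kp \<le> 1" "1 \<le> 2 * \<alpha> * kp" "p = top \<Longrightarrow> kp = 1" 
  "p \<noteq> top \<Longrightarrow> kp * max 1 (enn2real p / 2) = enn2real p / 2"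
proof -
  show "0 < kp" unfolding kp_def by (rule kap_pos[OF half_pos[OF p_pos(1)]])
  show "kp \<le> 1" unfolding kp_def by (rule kap_le_1)
  show "1 \<le> 2 * \<alpha> * kp"
  proof (cases "p = top")
    case False
    have "1 < enn2real p * \<alpha>" using p_real[OF False] \<alpha> by (simp add: pos_divide_less_eq)
    then show ?thesis using \<alpha> False by (auto simp: kp_def kap_def half_eq_top_iff enn2real_half min_def mult_ac)
  next
    case True
    have "kp = 1" unfolding kp_def kap_def using True by (simp add: half_eq_top_iff)
    then show ?thesis using \<alpha> by simp
  qed
  show "kp = 1" if "p = top" unfolding kp_def kap_def using that by (simp add: half_eq_top_iff)
qed (auto simp: kp_def kap_def half_eq_top_iff enn2real_half min_def max_def)

lemma level_sum_le:
  assumes m: "T/2^Suc m < h" "h \<le> T/2^m"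
  shows "(\<Sum>k<N. 2^k * w (h/2^k) powr (2 * kp)) \<le>
    2 powr (2 * \<alpha> * kp) * h powr (2 * \<alpha> * kp) * (\<Sum>k<N. 2 powr - (real k * (2 * \<alpha> * kp - 1)) * \<beta> (m + k) powr (2 * kp))"
  unfolding sum_distrib_left
proof (rule sum_mono)
  fix k
  have "w (h/2^k) powr (2 * kp) \<le> (2 powr \<alpha> * (h/2^k) powr \<alpha> * \<beta> (m + k)) powr (2 * kp)"
    using kp(1) by (intro powr_mono2 w_le_\<beta>[OF m]) auto
  also have "\<dots> = 2 powr (\<alpha> * (2 * kp)) * (h/2^k) powr (\<alpha> * (2 * kp)) * \<beta> (m + k) powr (2 * kp)"
    by (simp only: powr_mult powr_powr)
  also have "(h/2^k) powr (\<alpha> * (2 * kp)) = h powr (\<alpha> * (2 * kp)) * 2 powr - (real k * (\<alpha> * (2 * kp)))"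
    by (rule dyadic_powr)
  finally have "2^k * w (h/2^k) powr (2 * kp) \<le> 2 powr (real k) * (2 powr (\<alpha> * (2 * kp)) * (h powr (\<alpha> * (2 * kp)) * 2 powr - (real k * (\<alpha> * (2 * kp)))) * \<beta> (m + k) powr (2 * kp))"
    by (simp add: powr_realpow)
  also have "\<dots> = 2 powr (\<alpha> * (2 * kp)) * h powr (\<alpha> * (2 * kp)) * ((2 powr real k * 2 powr - (real k * (\<alpha> * (2 * kp)))) * \<beta> (m + k) powr (2 * kp))"
    by (simp only: mult_ac)
  also have "2 powr real k * 2 powr - (real k * (\<alpha> * (2 * kp))) = 2 powr - (real k * (2 * \<alpha> * kp - 1))"
    unfolding powr_add[symmetric] by (simp add: algebra_simps)
  finally show "2^k * w (h/2^k) powr (2 * kp) \<le> 2 powr (2 * \<alpha> * kp) * h powr (2 * \<alpha> * kp) * (2 powr - (real k * (2 * \<alpha> * kp - 1)) * \<beta> (m + k) powr (2 * kp))"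
    by (simp add: mult_ac)
qed

lemma level_sum_bound:
  assumes "0 < h" "h \<le> T" and crit: "2 * \<alpha> * kp = 1 \<Longrightarrow> q \<le> ennreal (2 * kp)"
  shows "(\<Sum>k<N. 2^k * w (h/2^k) powr (2 * kp)) \<le>
    2 powr (2 * \<alpha> * kp) * geom_const (2 * \<alpha> * kp - 1) * B powr (2 * kp) * h powr (2 * \<alpha> * kp)"
proof -
  obtain m where m: "T/2^Suc m < h" "h \<le> T/2^m" using dyadic_scale[OF assms(1,2)] .
  have "(\<Sum>k<N. 2 powr - (real k * (2 * \<alpha> * kp - 1)) * \<beta> (m + k) powr (2 * kp)) \<le> geom_const (2 * \<alpha> * kp - 1) * B powr (2 * kp)"
    by (rule weighted_sum_\<beta>_le) (use kp crit in auto)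
  then have "2 powr (2 * \<alpha> * kp) * h powr (2 * \<alpha> * kp) * (\<Sum>k<N. 2 powr - (real k * (2 * \<alpha> * kp - 1)) * \<beta> (m + k) powr (2 * kp))
     \<le> 2 powr (2 * \<alpha> * kp) * h powr (2 * \<alpha> * kp) * (geom_const (2 * \<alpha> * kp - 1) * B powr (2 * kp))"
    by (intro mult_left_mono) auto
  then show ?thesis using level_sum_le[OF m, of N] by (simp add: mult_ac)
qed

text \<open>In the critical case the sums are of order h, and over a partition they would only give
  a total of order 1. The missing smallness is taken from the tail of the series of powers of
  \<open>\<beta>\<close>: a short h meets only scales beyond \<open>M\<close>.\<close>

lemma level_sum_small:
  assumes "2 * \<alpha> * kp = 1" "q \<le> ennreal (2 * kp)" "0 < \<epsilon>"
  obtains h0 where "0 < h0" "\<And>h N. 0 < h \<Longrightarrow> h \<le> h0 \<Longrightarrow> h \<le> T \<Longrightarrow> (\<Sum>k<N. 2^k * w (h/2^k) powr (2 * kp)) \<le> \<epsilon> * h"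
proof -
  have s: "summable (\<lambda>n. \<beta> n powr (2 * kp))"
    by (rule bounded_imp_summable[of _ "B powr (2 * kp)"]) (use sum_\<beta>_powr[OF assms(2)] in auto)
  have "\<forall>\<^sub>F M in sequentially. suminf (\<lambda>n. \<beta> n powr (2 * kp)) - (\<Sum>n<M. \<beta> n powr (2 * kp)) < \<epsilon>/2"
    using assms(3) by (intro order_tendstoD(2)[OF suminf_tail_tendsto_0[OF s]]) auto
  then obtain M where M: "suminf (\<lambda>n. \<beta> n powr (2 * kp)) - (\<Sum>n<M. \<beta> n powr (2 * kp)) < \<epsilon>/2"
    by (auto simp: eventually_sequentially)
  show thesis
  proof (rule that)
    show "0 < T/2^Suc M" using T by simp
    fix h N assume h: "0 < h" "h \<le> T/2^Suc M" "h \<le> T"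
    obtain m where m: "T/2^Suc m < h" "h \<le> T/2^m" using dyadic_scale[OF h(1,3)] .
    have "M \<le> m"
    proof (rule ccontr)
      assume "\<not> M \<le> m"
      then have "T/2^Suc M \<le> T/2^Suc m" using T by (intro divide_left_mono power_increasing) auto
      then show False using m h by simp
    qed
    have "(\<Sum>k<N. \<beta> (m + k) powr (2 * kp)) = (\<Sum>n\<in>(+) m ` {..<N}. \<beta> n powr (2 * kp))"
      by (simp add: sum.reindex)
    also have "\<dots> = (\<Sum>n\<in>(+) m ` {..<N} \<union> {..<M}. \<beta> n powr (2 * kp)) - (\<Sum>n<M. \<beta> n powr (2 * kp))"
      using \<open>M \<le> m\<close> by (subst sum.union_disjoint) auto
    also have "\<dots> \<le> suminf (\<lambda>n. \<beta> n powr (2 * kp)) - (\<Sum>n<M. \<beta> n powr (2 * kp))"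
      by (intro diff_right_mono sum_le_suminf s) auto
    finally have *: "(\<Sum>k<N. \<beta> (m + k) powr (2 * kp)) \<le> \<epsilon>/2" using M by simp
    have "(\<Sum>k<N. 2^k * w (h/2^k) powr (2 * kp)) \<le> 2 * h * (\<Sum>k<N. \<beta> (m + k) powr (2 * kp))"
      using level_sum_le[OF m, of N] h by (simp add: assms(1))
    also have "\<dots> \<le> 2 * h * (\<epsilon>/2)" using h by (intro mult_left_mono *) auto
    finally show "(\<Sum>k<N. 2^k * w (h/2^k) powr (2 * kp)) \<le> \<epsilon> * h" by (simp add: mult.commute)
  qed
qed

lemma dpow_Lpc:
  assumes "0 < \<eta>" "\<eta> \<le> T"
  shows "Lpc (p/2) 0 (T - \<eta>) (\<lambda>s. dpow 2 X s \<eta>) (w \<eta> powr (2 * kp))"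
proof (cases "p = top")
  case True
  have "dpow 2 X s \<eta> \<le> w \<eta> powr (2 * kp)" if "0 < T - \<eta>" "s \<in> {0..T - \<eta>}" for s
  proof -
    have "norm (X (s + \<eta>) - X s) \<le> w \<eta>" by (rule w_sup_le[OF True]) (use that assms in auto)
    then have "norm (X (s + \<eta>) - X s) powr 2 \<le> w \<eta> powr 2" by (intro powr_mono2) auto
    then show ?thesis by (simp add: dpow_def kp(4)[OF True])
  qed
  then show ?thesis using True by (simp add: Lpc_def half_eq_top_iff)
next
  case False
  have P: "0 < enn2real p" using p_real_1[OF False] by simp
  have "integral {0..T - \<eta>} (\<lambda>s. dpow 2 X s \<eta> powr (enn2real p / 2)) = integral {0..T - \<eta>} (\<lambda>s. norm (X (s + \<eta>) - X s) powr enn2real p)"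
    unfolding dpow_def powr_powr by simp
  also have "\<dots> \<le> w \<eta> powr enn2real p" by (rule w_integral_le[OF False assms])
  also have "\<dots> = (w \<eta> powr (2 * kp)) powr max 1 (enn2real p / 2)"
  proof -
    have "2 * kp * max 1 (enn2real p / 2) = enn2real p" using kp(5)[OF False] by (simp add: mult_ac)
    then show ?thesis unfolding powr_powr by (simp only:)
  qed
  finally show ?thesis using False by (simp add: Lpc_def half_eq_top_iff enn2real_half)
qed

text \<open>By translation each of the \<open>2^k\<close> squared increments of level
  \<open>k\<close> has the same bound, and bounds in \<open>Lpc\<close> add.\<close>

lemma level_sums_Lpc:
  assumes "0 < h" "h \<le> T"
  shows "Lpc (p/2) 0 (T - h) (\<lambda>s. \<Sum>k<N. lev (dpow 2 X) k s h) (\<Sum>k<N. 2^k * w (h/2^k) powr (2 * kp))"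
proof (rule Lpc_sum)
  fix k assume "k \<in> {..<N}"
  have c: "continuous_on {0..T - h} (\<lambda>s. lev (dpow 2 X) k s h)"
    by (rule continuous_on_lev_dpow[OF cont]) (use assms in \<open>auto intro: continuous_intros\<close>)
  then show "continuous_on {0..T - h} (\<lambda>s. lev (dpow 2 X) k s h)" .
  have \<eta>: "0 < h/2^k" "h/2^k \<le> T" 
  proof -
    have "h/2^k \<le> h/1" using assms one_le_power[of "2::real" k] by (intro divide_left_mono) auto
    then show "h/2^k \<le> T" using assms by simp
  qed (use assms in simp)
  have "Lpc (p/2) 0 (T - h) (\<lambda>s. \<Sum>j<(2::nat)^k. dpow 2 X (s + real j * (h/2^k)) (h/2^k)) (\<Sum>j<(2::nat)^k. w (h/2^k) powr (2 * kp))"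
  proof (rule Lpc_sum)
    fix j assume j: "j \<in> {..<(2::nat)^k}"
    have cd: "continuous_on {0..T - h/2^k} (\<lambda>s. dpow 2 X s (h/2^k))"
      by (rule continuous_on_dpow[OF cont]) (use \<eta> in \<open>auto intro: continuous_intros\<close>)
    have pt: "real j * (h/2^k) + h/2^k \<le> h" using dyadic_point(2)[of h j k 0] j assms by simp
    show "Lpc (p/2) 0 (T - h) (\<lambda>s. dpow 2 X (s + real j * (h/2^k)) (h/2^k)) (w (h/2^k) powr (2 * kp))"
      by (rule Lpc_shift[OF dpow_Lpc[OF \<eta>] half_pos[OF p_pos(1)] cd]) (use pt assms in auto)
    show "continuous_on {0..T - h} (\<lambda>s. dpow 2 X (s + real j * (h/2^k)) (h/2^k))"
    proof (rule continuous_on_compose2[OF cd])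
      have nn: "0 \<le> real j * (h/2^k)" using assms by simp
      show "(\<lambda>s. s + real j * (h/2^k)) ` {0..T - h} \<subseteq> {0..T - h/2^k}"
      proof (rule image_subsetI)
        fix s assume "s \<in> {0..T - h}"
        then show "s + real j * (h/2^k) \<in> {0..T - h/2^k}"
          unfolding atLeastAtMost_iff using pt nn by linarith
      qed
    qed (intro continuous_intros)
  qed (use half_pos[OF p_pos(1)] in auto)
  then show "Lpc (p/2) 0 (T - h) (\<lambda>s. lev (dpow 2 X) k s h) (2^k * w (h/2^k) powr (2 * kp))"
    unfolding lev_eq_sum by simp
qed (use half_pos[OF p_pos(1)] in \<open>auto intro: lev_nonneg\<close>)

end

subsection \<open>Regularity of solutions\<close>

locale driven = besov_path T \<alpha> p q X + bounded_lipschitz f F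
  for T \<alpha> p q and X :: "real \<Rightarrow> real^'n" and f :: "real^'m \<Rightarrow> real^'n^'m" and F +
  assumes crit: "\<alpha> = 1/2 \<Longrightarrow> q \<le> 2"
begin

abbreviation "\<gamma> \<equiv> \<alpha> - ip"

lemma \<gamma>_pos: "0 < \<gamma>" using inv_p(2) by simp

lemma crit_half: "\<alpha> * 2 - max 1 (2 * ip) = 0 \<Longrightarrow> \<alpha> = 1/2"
  using inv_p(2) \<alpha> by (simp add: max_def split: if_splits)

lemma kappa_2: "0 < \<alpha> * 2 - max 1 (2 * ip) \<or> (\<alpha> * 2 - max 1 (2 * ip) = 0 \<and> q \<le> ennreal 2)"
proof -
  have "max 1 (2 * ip) \<le> \<alpha> * 2" using inv_p(2) \<alpha> by simp
  then show ?thesis using crit crit_half by (cases "\<alpha> * 2 - max 1 (2 * ip) = 0") auto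
qed

text \<open>Equality needs \<open>kp = 1\<close>, because \<open>kp = p/2\<close> would give
  \<open>\<alpha> * p = 1\<close>.\<close>

lemma crit_kp: "2 * \<alpha> * kp = 1 \<Longrightarrow> \<alpha> = 1/2 \<and> kp = 1"
proof (cases "kp = 1")
  case False
  then have "p \<noteq> top" using kp(4) by blast
  then have "kp = enn2real p / 2" using False by (simp add: kp_def kap_def half_eq_top_iff enn2real_half min_def split: if_splits)
  moreover have "1 < enn2real p * \<alpha>" using p_real[OF \<open>p \<noteq> top\<close>] \<alpha> by (simp add: pos_divide_less_eq)
  moreover assume "2 * \<alpha> * kp = 1"
  moreover from calculation have "enn2real p = 2 * kp" by simp
  then have "enn2real p * \<alpha> = 2 * \<alpha> * kp" by simp
  ultimately show ?thesis by simp
qed auto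

lemma crit_q: "2 * \<alpha> * kp = 1 \<Longrightarrow> q \<le> ennreal (2 * kp)"
  using crit crit_kp by auto

definition "C2 = dyadic_const \<alpha> ip 2 * B powr 2"

lemma X_var: "dyadic_var T 2 \<gamma> C2 X"
  unfolding C2_def by (rule dyadic_var_X) (use kappa_2 in auto)

lemma X_dominated: "dyadic_dominated T X"
  by (rule dyadic_dominated_X[OF kappa_2])

lemma C2_nonneg: "0 \<le> C2" using dyadic_var_nonneg[OF X_var T] .

definition "G = gronwall T \<gamma> C2 * F\<^sup>2"

lemma G_nonneg: "0 \<le> G" by (simp add: G_def)

definition "E = 2 powr (2 * \<alpha> * kp) * geom_const (2 * \<alpha> * kp - 1) * B powr (2 * kp)"

lemma E_nonneg: "0 \<le> E"
  using kp(3) by (auto simp: E_def intro!: mult_nonneg_nonneg geom_const_nonneg)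

text \<open>Geometric mean of two constants for the remainder: \<open>G * C2\<close> in the supremum
  norm and \<open>G * E powr (1/kp)\<close> in L^{p/2}, the power 1/\<open>kp\<close> undoing the
  additive form of the latter bound.\<close>

definition "Q = G * sqrt (C2 * E powr (1/kp))"

lemma continuous_rem:
  assumes Y: "continuous_on {0..T} Y" and "0 \<le> h" "h \<le> T"
  shows "continuous_on {0..T - h} (\<lambda>s. rem f X Y s h)"
  unfolding rem_def using assms
  by (intro continuous_intros bounded_bilinear.continuous_on[OF bounded_bilinear_matrix_vector_mult]
      continuous_on_compose2[OF Y] continuous_on_compose2[OF cont] continuous_on_subset[OF Y] continuous_on_subset[OF cont]
      continuous_on_compose2[OF continuous_on_f[of UNIV]]) auto

context
  fixes Y :: "real \<Rightarrow> real^'m"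
  assumes Y: "continuous_on {0..T} Y" and sewn: "sewn T (rem f X Y)"
begin

lemma rem_sup:
  assumes "0 \<le> s" "0 < h" "s + h \<le> T" "h < T"
  shows "norm (rem f X Y s h) \<le> G * C2 * h powr (2 * \<gamma>)"
proof -
  have "norm (rem f X Y s h) \<le> gronwall T \<gamma> C2 * (F\<^sup>2 * (C2 * h powr (2 * \<gamma>)))"
    using sewn assms by (intro rem_le[OF X_var \<gamma>_pos]) (auto simp: sewn_def)
  then show ?thesis by (simp add: G_def mult_ac)
qed

text \<open>The infinite sum over levels is cut at a finite level: the finite part is estimated in
  L^{p/2}, the rest by a constant, a tail of the dominating series that is uniform in s. Letting the
  cut tend to infinity removes this constant.\<close>

lemma rem_Lpc:
  assumes h: "0 < h" "h < T" and e: "0 \<le> e" "\<And>N. (\<Sum>k<N. 2^k * w (h/2^k) powr (2 * kp)) \<le> e"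
  shows "Lpc (p/2) 0 (T - h) (\<lambda>s. norm (rem f X Y s h)) (G powr kp * e)"
proof -
  have p2: "0 < p/2" by (rule half_pos[OF p_pos(1)])
  obtain c where c: "summable c" "\<And>k::nat. 0 \<le> c k"
      "\<And>h' s k. h/2 \<le> h' \<Longrightarrow> h' \<le> h \<Longrightarrow> 0 \<le> s \<Longrightarrow> s + h' \<le> T \<Longrightarrow> lev (dpow 2 X) k s h' \<le> c k"
    using X_dominated h unfolding dyadic_dominated_def by (metis less_imp_le)
  define t where "t N = suminf c - (\<Sum>k<N. c k)" for N
  have t0: "0 \<le> t N" for N unfolding t_def using c by (simp add: sum_le_suminf)
  have tlim: "t \<longlonglongrightarrow> 0"
    unfolding t_def[abs_def] by (rule suminf_tail_tendsto_0[OF c(1)])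
  define \<rho> where "\<rho> N s = (\<Sum>k<Suc N. lev (dpow 2 X) k s h)" for N s
  have \<rho>0: "0 \<le> \<rho> N s" for N s unfolding \<rho>_def by (intro sum_nonneg lev_nonneg) auto
  have \<rho>c: "continuous_on {0..T - h} (\<rho> N)" for N
    unfolding \<rho>_def by (intro continuous_on_sum continuous_on_lev_dpow[OF cont]) (use h in \<open>auto intro: continuous_intros\<close>)
  have le: "norm (rem f X Y s h) \<le> G * (\<rho> N s + t (Suc N))" if s: "s \<in> {0..T - h}" for s N
  proof -
    have sh: "0 \<le> s" "s + h \<le> T" using s by auto
    have "norm (rem f X Y s h) \<le> gronwall T \<gamma> C2 * (F\<^sup>2 * (\<rho> N s + t (Suc N)))"
    proof (rule lev_rem_le[OF X_var \<gamma>_pos sh(1) h(1) sh(2), of Y 0, simplified lev.simps])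
      show "(\<lambda>k. lev (\<lambda>s h. norm (rem f X Y s h)) k s h) \<longlonglongrightarrow> 0"
        using sewn sh h by (simp add: sewn_def)
      fix N'
      have "(\<Sum>k<N'. lev (dpow 2 X) (Suc k + 0) s h) \<le> (\<Sum>k<Suc N'. lev (dpow 2 X) k s h)"
        unfolding sum.lessThan_Suc_shift by simp
      also have "\<dots> \<le> (\<Sum>k<Suc N' + Suc N. lev (dpow 2 X) k s h)"
        by (intro sum_mono2 lev_nonneg) auto
      also have "\<dots> = \<rho> N s + (\<Sum>k\<in>{Suc N..<Suc N' + Suc N}. lev (dpow 2 X) k s h)"
      proof -
        have U: "{..<Suc N' + Suc N} = {..<Suc N} \<union> {Suc N..<Suc N' + Suc N}" by auto
        show ?thesis unfolding U \<rho>_def by (rule sum.union_disjoint) auto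
      qed
      also have "(\<Sum>k\<in>{Suc N..<Suc N' + Suc N}. lev (dpow 2 X) k s h) \<le> (\<Sum>k\<in>{Suc N..<Suc N' + Suc N}. c k)"
        using c(3)[of h s] sh h by (intro sum_mono) auto
      also have "\<dots> = (\<Sum>k<Suc N' + Suc N. c k) - (\<Sum>k<Suc N. c k)"
      proof -
        have U: "{..<Suc N' + Suc N} = {..<Suc N} \<union> {Suc N..<Suc N' + Suc N}" by auto
        show ?thesis unfolding U by (subst sum.union_disjoint) auto
      qed
      also have "\<dots> \<le> t (Suc N)"
        unfolding t_def by (intro diff_right_mono sum_le_suminf c) auto
      finally show "(\<Sum>k<N'. lev (dpow 2 X) (Suc k + 0) s h) \<le> \<rho> N s + t (Suc N)" by simp
    qed
    then show ?thesis by (simp add: G_def mult_ac)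
  qed
  have e_N: "Lpc (p/2) 0 (T - h) (\<lambda>s. norm (rem f X Y s h)) (G powr kp * (e + (1 + T) * t (Suc N) powr kp))" for N
  proof (rule Lpc_mono[OF _ p2])
    have 1: "Lpc (p/2) 0 (T - h) (\<rho> N) e"
      unfolding \<rho>_def
      by (rule Lpc_mono[OF level_sums_Lpc[of h "Suc N"] p2 _ e(2)[of "Suc N"]])
        (use h \<rho>c[of N] \<rho>0[of N] in \<open>auto simp: \<rho>_def simp del: sum.lessThan_Suc intro!: sum_nonneg\<close>)
    have 2: "Lpc (p/2) 0 (T - h) (\<lambda>s. t (Suc N)) ((1 + T) * t (Suc N) powr kp)"
      unfolding kp_def by (rule Lpc_const[OF p2 t0]) (use h in auto)
    have "Lpc (p/2) 0 (T - h) (\<lambda>s. \<rho> N s + t (Suc N)) (e + (1 + T) * t (Suc N) powr kp)"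
      by (rule Lpc_add[OF 1 2 p2 e(1)]) (use T \<rho>c \<rho>0 t0 in auto)
    then show "Lpc (p/2) 0 (T - h) (\<lambda>s. G * (\<rho> N s + t (Suc N))) (G powr kp * (e + (1 + T) * t (Suc N) powr kp))"
      unfolding kp_def by (rule Lpc_cmult[OF _ p2 G_nonneg]) (use e(1) T \<rho>0 t0 in auto)
    show "norm (rem f X Y s h) \<le> G * (\<rho> N s + t (Suc N))" if "s \<in> {0..T - h}" for s by (rule le[OF that])
  qed (use h e(1) T \<rho>c in \<open>auto intro!: continuous_intros continuous_rem[OF Y]\<close>)
  show ?thesis
  proof (rule Lpc_closed)
    fix d :: real assume d: "0 < d"
    have "(\<lambda>N. G powr kp * (e + (1 + T) * t (Suc N) powr kp)) \<longlonglongrightarrow> G powr kp * (e + (1 + T) * 0)"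
      using kp(1) by (intro tendsto_intros tendsto_zero_powrI[where b=kp] LIMSEQ_Suc[OF tlim]) (auto simp: t0)
    then have "\<forall>\<^sub>F N in sequentially. G powr kp * (e + (1 + T) * t (Suc N) powr kp) < G powr kp * e + d"
      using d by (intro order_tendstoD(2)) auto
    then obtain N where N: "G powr kp * (e + (1 + T) * t (Suc N) powr kp) < G powr kp * e + d"
      by (auto simp: eventually_sequentially)
    show "Lpc (p/2) 0 (T - h) (\<lambda>s. norm (rem f X Y s h)) (G powr kp * e + d)"
      by (rule Lpc_mono[OF e_N[of N] p2]) (use N h e(1) T in \<open>auto intro!: continuous_intros continuous_rem[OF Y]\<close>)
  qed (use e(1) in auto)
qed

lemma rem_Lpc_E:
  assumes "0 < h" "h < T"
  shows "Lpc (p/2) 0 (T - h) (\<lambda>s. norm (rem f X Y s h)) (G powr kp * (E * h powr (2 * \<alpha> * kp)))"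
  by (rule rem_Lpc[OF assms]) (use assms E_nonneg level_sum_bound[of h, OF _ _ crit_q] in \<open>auto simp: E_def\<close>)

text \<open>Half of the power is estimated by the supremum, the other half is integrated. The
  exponent \<open>\<alpha> + \<gamma>\<close> exceeds \<open>\<alpha>\<close> by
  \<open>\<gamma> > 0\<close>, so the remainder contributes a geometric sequence over the dyadic
  scales, whatever \<open>q\<close> is.\<close>

lemma rem_Lp:
  assumes h: "0 < h" "h < T"
  shows "Lpc p 0 (T - h) (\<lambda>s. norm (rem f X Y s h)) ((G * C2 + Q) * h powr (\<alpha> + \<gamma>))"
proof (cases "p = top")
  case True
  have "norm (rem f X Y s h) \<le> (G * C2 + Q) * h powr (\<alpha> + \<gamma>)" if "s \<in> {0..T - h}" for s
  proof -
    have "norm (rem f X Y s h) \<le> G * C2 * h powr (2 * \<gamma>)" by (rule rem_sup) (use that h in auto)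
    also have "2 * \<gamma> = \<alpha> + \<gamma>" using True by simp
    also have "G * C2 * h powr (\<alpha> + \<gamma>) \<le> (G * C2 + Q) * h powr (\<alpha> + \<gamma>)"
      using G_nonneg C2_nonneg by (intro mult_right_mono) (auto simp: Q_def)
    finally show ?thesis .
  qed
  then show ?thesis using True by (simp add: Lpc_def)
next
  case False
  define P where "P = enn2real p"
  have P: "1 < P" using p_real_1[OF False] by (simp add: P_def)
  have c: "continuous_on {0..T - h} (\<lambda>s. norm (rem f X Y s h))"
    using h by (intro continuous_intros continuous_rem[OF Y]) auto
  define S where "S = G * C2 * h powr (2 * \<gamma>)"
  have S0: "0 \<le> S" using G_nonneg C2_nonneg by (simp add: S_def)
  have i: "(\<lambda>s. norm (rem f X Y s h) powr r) integrable_on {0..T - h}" if "0 < r" for r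
    using that by (intro integrable_continuous_real continuous_on_powr' c continuous_intros) auto
  have "integral {0..T - h} (\<lambda>s. norm (rem f X Y s h) powr P) \<le> integral {0..T - h} (\<lambda>s. S powr (P/2) * norm (rem f X Y s h) powr (P/2))"
  proof (rule integral_le)
    fix s assume s: "s \<in> {0..T - h}"
    have "norm (rem f X Y s h) powr P = norm (rem f X Y s h) powr (P/2) * norm (rem f X Y s h) powr (P/2)"
      by (simp add: powr_add[symmetric])
    also have "\<dots> \<le> S powr (P/2) * norm (rem f X Y s h) powr (P/2)"
      using rem_sup[of s h] s h P by (intro mult_right_mono powr_mono2) (auto simp: S_def)
    finally show "norm (rem f X Y s h) powr P \<le> S powr (P/2) * norm (rem f X Y s h) powr (P/2)" .
  qed (use P i[of P] i[of "P/2"] in \<open>auto intro: integrable_on_mult_right\<close>)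
  also have "\<dots> = S powr (P/2) * integral {0..T - h} (\<lambda>s. norm (rem f X Y s h) powr (P/2))" by simp
  also have "\<dots> \<le> S powr (P/2) * (G powr kp * (E * h powr (2 * \<alpha> * kp))) powr max 1 (P/2)"
    using rem_Lpc_E[OF h] False by (intro mult_left_mono) (auto simp: Lpc_def half_eq_top_iff enn2real_half P_def)
  also have "(G powr kp * (E * h powr (2 * \<alpha> * kp))) powr max 1 (P/2) = (G * E powr (1/kp) * h powr (2 * \<alpha>)) powr (P/2)"
  proof -
    have k: "kp * max 1 (P/2) = P/2" using kp(5)[OF False] by (simp add: P_def)
    have k': "2 * \<alpha> * kp * max 1 (P/2) = 2 * \<alpha> * (P/2)" using k by (simp add: mult.assoc)
    have k'': "1/kp * (P/2) = max 1 (P/2)" using k kp(1) by (simp add: field_simps)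
    show ?thesis unfolding powr_mult powr_powr k k' k'' by simp
  qed
  also have "S powr (P/2) * (G * E powr (1/kp) * h powr (2 * \<alpha>)) powr (P/2) = (Q * h powr (\<alpha> + \<gamma>)) powr P"
  proof -
    have "S * (G * E powr (1/kp) * h powr (2 * \<alpha>)) = (G * G) * (C2 * E powr (1/kp)) * (h powr (2 * \<gamma>) * h powr (2 * \<alpha>))"
      unfolding S_def by (simp only: mult_ac)
    also have "h powr (2 * \<gamma>) * h powr (2 * \<alpha>) = h powr (\<alpha> + \<gamma>) * h powr (\<alpha> + \<gamma>)"
      unfolding powr_add[symmetric] by simp
    also have "C2 * E powr (1/kp) = sqrt (C2 * E powr (1/kp)) * sqrt (C2 * E powr (1/kp))"
      using C2_nonneg by simp
    also have "(G * G) * (sqrt (C2 * E powr (1/kp)) * sqrt (C2 * E powr (1/kp))) * (h powr (\<alpha> + \<gamma>) * h powr (\<alpha> + \<gamma>))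
        = (Q * h powr (\<alpha> + \<gamma>)) * (Q * h powr (\<alpha> + \<gamma>))"
      unfolding Q_def by (simp only: mult_ac)
    finally have e: "S * (G * E powr (1/kp) * h powr (2 * \<alpha>)) = (Q * h powr (\<alpha> + \<gamma>)) * (Q * h powr (\<alpha> + \<gamma>))" .
    have "S powr (P/2) * (G * E powr (1/kp) * h powr (2 * \<alpha>)) powr (P/2) = ((Q * h powr (\<alpha> + \<gamma>)) * (Q * h powr (\<alpha> + \<gamma>))) powr (P/2)"
      by (simp only: powr_mult[symmetric] e)
    also have "\<dots> = (Q * h powr (\<alpha> + \<gamma>)) powr (P/2) * (Q * h powr (\<alpha> + \<gamma>)) powr (P/2)"
      by (rule powr_mult)
    also have "\<dots> = (Q * h powr (\<alpha> + \<gamma>)) powr P"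
      unfolding powr_add[symmetric] by simp
    finally show ?thesis .
  qed
  also have "\<dots> \<le> ((G * C2 + Q) * h powr (\<alpha> + \<gamma>)) powr P"
    using P G_nonneg C2_nonneg by (intro powr_mono2 mult_right_mono) (auto simp: Q_def)
  finally show ?thesis using False P by (simp add: Lpc_def P_def max_absorb2)
qed

end

end

section \<open>Riemann sums along arbitrary partitions\<close>

lemma Lpc_degenerate: "Lpc p a a g e"
  by (simp add: Lpc_def)

lemma unit_partition_mono:
  assumes "unit_partition N \<tau>" "j \<le> k" "k \<le> N"
  shows "\<tau> j \<le> \<tau> k"
  using assms(2,3)
proof (induction k rule: dec_induct)
  case (step n)
  then have "\<tau> n < \<tau> (Suc n)" using assms(1) by (simp add: unit_partition_def)
  then show ?case using step by simp
qed simp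

lemma unit_partition_bounds:
  assumes "unit_partition N \<tau>" "k \<le> N"
  shows "0 \<le> \<tau> k" "\<tau> k \<le> 1"
  using unit_partition_mono[OF assms(1), of 0 k] unit_partition_mono[OF assms(1), of k N] assms
  by (auto simp: unit_partition_def)

lemma mesh_ge: "k < N \<Longrightarrow> \<tau> (Suc k) - \<tau> k \<le> mesh N \<tau>"
  unfolding mesh_def by (intro Max_ge) auto

text \<open>The increments of \<open>Y\<close> telescope along the partition, so the error of the
  Riemann sum is minus the sum of the remainders.\<close>

lemma riemann_sum_minus_incr:
  assumes "unit_partition N \<tau>" and I: "\<And>t. t \<in> {s..s+h} \<Longrightarrow> Y t = y + I t" and h: "0 \<le> h"
  shows "riemann_sum N \<tau> (\<lambda>t. f (Y t)) X s (s + h) - incr I s (s + h) =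
    - (\<Sum>k<N. rem f X Y (s + \<tau> k * h) ((\<tau> (Suc k) - \<tau> k) * h))"
proof -
  have e: "s + \<tau> k * h + (\<tau> (Suc k) - \<tau> k) * h = s + \<tau> (Suc k) * h" for k
    by (simp add: algebra_simps)
  have 01: "\<tau> 0 = 0" "\<tau> N = 1" using assms(1) by (auto simp: unit_partition_def)
  have "(\<Sum>k<N. Y (s + \<tau> (Suc k) * h) - Y (s + \<tau> k * h)) = Y (s + \<tau> N * h) - Y (s + \<tau> 0 * h)"
    by (rule sum_lessThan_telescope)
  also have "\<dots> = incr I s (s + h)"
    using I[of s] I[of "s + h"] h by (simp add: 01 incr_def)
  finally show ?thesis
    unfolding rem_def e sum_subtractf by (simp add: riemann_sum_def)
qed

text \<open>Bounds the l^q norm of a sum of two sequences over dyadic scales: a multiple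
  \<open>F2\<close> of the normalised moduli, whose l^q norm is at most \<open>Bv\<close>, and
  \<open>C * (T/2^n) powr \<gamma>\<close>. The factor \<open>2 powr r\<close> is the quasi-triangle
  inequality for r-th powers, valid for all r > 0.\<close>

definition "besov_bound_rate q r F2 Bv C T \<gamma> =
  (if q = (top::ennreal) then F2 * Bv + C * T powr \<gamma>
   else (2 powr r * (F2 powr r * Bv powr r + C powr r * T powr (\<gamma> * r) * geom_const (\<gamma> * r))) powr (1/r))" for r F2 Bv C T \<gamma> :: real

text \<open>The upper counterpart of the discretisation in \<open>sum_\<beta>_powr_q\<close>: each
  dyadic interval has length \<open>T/2^Suc n\<close>, which cancels the denominator.\<close>

lemma nn_integral_dyadic_le:
  fixes g :: "real \<Rightarrow> ennreal"
  assumes T: "0 < T" and v: "\<And>n. 0 \<le> v n" "summable v"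
    and g: "\<And>n \<tau>. T/2^Suc n < \<tau> \<Longrightarrow> \<tau> \<le> T/2^n \<Longrightarrow> g \<tau> \<le> ennreal (v n / (T/2^Suc n))"
  shows "(\<integral>\<^sup>+\<tau>\<in>{0<..T}. g \<tau> \<partial>lborel) \<le> ennreal (suminf v)"
proof -
  have "(\<integral>\<^sup>+\<tau>\<in>{0<..T}. g \<tau> \<partial>lborel) \<le> (\<integral>\<^sup>+\<tau>. (\<Sum>n. ennreal (v n / (T/2^Suc n)) * indicator {T/2^Suc n<..T/2^n} \<tau>) \<partial>lborel)"
  proof (rule nn_integral_mono)
    fix \<tau> :: real
    show "g \<tau> * indicator {0<..T} \<tau> \<le> (\<Sum>n. ennreal (v n / (T/2^Suc n)) * indicator {T/2^Suc n<..T/2^n} \<tau>)"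
    proof (cases "\<tau> \<in> {0<..T}")
      case True
      obtain k :: nat where "T/\<tau> < 2^k" using real_arch_pow[of 2 "T/\<tau>"] by auto
      then have "T/2^k < \<tau>" using True by (simp add: field_simps)
      moreover have "T/2^Suc k \<le> T/2^k" using T by (intro divide_left_mono power_increasing) auto
      ultimately have ex: "T/2^Suc k < \<tau>" by linarith
      define n where "n = (LEAST k. T/2^Suc k < \<tau>)"
      have 1: "T/2^Suc n < \<tau>" unfolding n_def by (rule LeastI[of _ k]) (rule ex)
      have 2: "\<tau> \<le> T/2^n"
      proof (cases n)
        case (Suc n')
        then have "\<not> T/2^Suc n' < \<tau>" using not_less_Least[of n' "\<lambda>k. T/2^Suc k < \<tau>"] by (simp add: n_def)
        then show ?thesis using Suc by simp
      qed (use True in simp)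
      have "g \<tau> * indicator {0<..T} \<tau> \<le> ennreal (v n / (T/2^Suc n)) * indicator {T/2^Suc n<..T/2^n} \<tau>"
        using g[OF 1 2] 1 2 True by simp
      also have "\<dots> \<le> (\<Sum>n. ennreal (v n / (T/2^Suc n)) * indicator {T/2^Suc n<..T/2^n} \<tau>)"
      proof -
        define b where "b n = ennreal (v n / (T/2^Suc n)) * indicator {T/2^Suc n<..T/2^n} \<tau>" for n
        have "b n \<le> suminf b" using sum_le_suminf[OF summableI, of "{n}" b] by simp
        then show ?thesis unfolding b_def[abs_def] .
      qed
      finally show ?thesis .
    qed simp
  qed
  also have "\<dots> = (\<Sum>n. ennreal (v n / (T/2^Suc n)) * emeasure lborel {T/2^Suc n<..T/2^n})"
    by (subst nn_integral_suminf) (auto simp: nn_integral_cmult_indicator)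
  also have "\<dots> = (\<Sum>n. ennreal (v n))"
  proof (intro suminf_cong)
    fix n
    have a: "T/2^n - T/2^Suc n = T/2^Suc n" "0 < T/2^Suc n" "T/2^Suc n \<le> T/2^n" using T by (auto simp: field_simps)
    have "emeasure lborel {T/2^Suc n<..T/2^n} = ennreal (T/2^Suc n)"
      using emeasure_lborel_Ioc[OF a(3)] unfolding a(1) .
    then show "ennreal (v n / (T/2^Suc n)) * emeasure lborel {T/2^Suc n<..T/2^n} = ennreal (v n)"
      using a(2) v(1)[of n] T by (simp only: ennreal_mult[symmetric] divide_nonneg_pos less_imp_le) simp
  qed
  also have "\<dots> = ennreal (suminf v)" using v by (intro suminf_ennreal2) auto
  finally show ?thesis .
qed

context driven
begin

text \<open>The bound is linear in \<open>\<theta>\<close> with a small factor, so over a partition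
  with \<open>\<theta>\<close> summing to 1 it adds up to something small. Above the critical
  exponent the factor is a positive power of \<open>\<theta>\<close>; at the critical exponent it is
  the tail in \<open>level_sum_small\<close>.\<close>

lemma level_sum_partition:
  assumes "0 < d"
  obtains \<eta> where "0 < \<eta>" "\<And>\<theta> h N. 0 < \<theta> \<Longrightarrow> \<theta> < \<eta> \<Longrightarrow> \<theta> \<le> 1 \<Longrightarrow> 0 < h \<Longrightarrow> h \<le> T \<Longrightarrow>
    (\<Sum>k<N. 2^k * w (\<theta> * h/2^k) powr (2 * kp)) \<le> d * \<theta> * h powr (2 * \<alpha> * kp)"
proof (cases "2 * \<alpha> * kp = 1")
  case True
  obtain h0 where h0: "0 < h0" "\<And>h N. 0 < h \<Longrightarrow> h \<le> h0 \<Longrightarrow> h \<le> T \<Longrightarrow> (\<Sum>k<N. 2^k * w (h/2^k) powr (2 * kp)) \<le> d * h"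
    using level_sum_small[OF True crit_q[OF True] assms] by blast
  show thesis
  proof (rule that)
    show "0 < h0 / T" using h0 T by simp
    fix \<theta> h :: real and N assume *: "0 < \<theta>" "\<theta> < h0 / T" "\<theta> \<le> 1" "0 < h" "h \<le> T"
    have "\<theta> * h \<le> \<theta> * T" using * by (intro mult_left_mono) auto
    also have "\<dots> < h0" using *(2) T by (simp add: field_simps)
    finally have 1: "\<theta> * h \<le> h0" by simp
    have 2: "\<theta> * h \<le> T" using mult_mono[of \<theta> 1 h T] * by simp
    have "(\<Sum>k<N. 2^k * w (\<theta> * h/2^k) powr (2 * kp)) \<le> d * (\<theta> * h)"
      by (rule h0(2)) (use * 1 2 in auto)
    then show "(\<Sum>k<N. 2^k * w (\<theta> * h/2^k) powr (2 * kp)) \<le> d * \<theta> * h powr (2 * \<alpha> * kp)"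
      using * True by (simp add: mult.assoc)
  qed
next
  case False
  define x where "x = 2 * \<alpha> * kp"
  have x: "1 < x" using False kp(3) by (simp add: x_def)
  show thesis
  proof (rule that)
    \<comment> \<open>This threshold for \<open>\<theta>\<close> makes
      \<open>E * \<theta> powr (x - 1) \<le> d\<close>; the summand 1 covers
      \<open>E = 0\<close>.\<close>
    show "0 < (d / (E + 1)) powr (1 / (x - 1))" using assms E_nonneg by simp
    fix \<theta> h :: real and N assume *: "0 < \<theta>" "\<theta> < (d / (E + 1)) powr (1 / (x - 1))" "\<theta> \<le> 1" "0 < h" "h \<le> T"
    have 2: "\<theta> * h \<le> T" using mult_mono[of \<theta> 1 h T] * by simp
    have "(\<Sum>k<N. 2^k * w (\<theta> * h/2^k) powr (2 * kp)) \<le> E * (\<theta> * h) powr x"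
      unfolding E_def x_def by (rule level_sum_bound) (use * 2 False in auto)
    also have "\<dots> = E * \<theta> powr (x - 1) * \<theta> * h powr x"
      using * powr_mult_base[of \<theta> "x - 1"] by (simp add: powr_mult mult_ac)
    also have "\<dots> \<le> d * \<theta> * h powr x"
    proof (intro mult_right_mono)
      have "\<theta> powr (x - 1) \<le> ((d / (E + 1)) powr (1 / (x - 1))) powr (x - 1)"
        using * x by (intro powr_mono2) auto
      also have "\<dots> = d / (E + 1)" using x assms E_nonneg by (simp add: powr_powr)
      finally have "E * \<theta> powr (x - 1) \<le> E * (d / (E + 1))" by (intro mult_left_mono E_nonneg)
      also have "\<dots> \<le> d" using assms E_nonneg by (simp add: field_simps)
      finally show "E * \<theta> powr (x - 1) \<le> d" .
    qed (use * in auto)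
    finally show "(\<Sum>k<N. 2^k * w (\<theta> * h/2^k) powr (2 * kp)) \<le> d * \<theta> * h powr (2 * \<alpha> * kp)" by (simp add: x_def)
  qed
qed

context
  fixes Y :: "real \<Rightarrow> real^'m"
  assumes Y: "continuous_on {0..T} Y" and sewn: "sewn T (rem f X Y)"
begin

lemma young_integral:
  "has_young_integral T \<alpha> p (\<lambda>t. f (Y t)) X (\<lambda>t. Y t - Y 0)"
  unfolding has_young_integral_def
proof (intro conjI allI impI)
  show "continuous_on {0..T} (\<lambda>t. Y t - Y 0)" by (intro continuous_intros Y)
  show "Y 0 - Y 0 = 0" by simp
  have p2: "0 < p/2" by (rule half_pos[OF p_pos(1)])
  fix \<epsilon> :: real assume "0 < \<epsilon>"
  \<comment> \<open>The half gives the strict inequality at the end.\<close>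
  define \<delta> where "\<delta> = \<epsilon>/2"
  have \<delta>: "0 < \<delta>" using \<open>0 < \<epsilon>\<close> by (simp add: \<delta>_def)
  \<comment> \<open>Chosen so that \<open>G powr kp * d \<le> \<delta> powr kp\<close>; the summand
    1 covers \<open>G = 0\<close>.\<close>
  define d where "d = \<delta> powr kp / (G powr kp + 1)"
  have Gk: "0 < G powr kp + 1" by (rule add_nonneg_pos) auto
  have d: "0 < d" using \<delta> Gk by (simp add: d_def)
  obtain \<eta> where \<eta>: "0 < \<eta>" "\<And>\<theta> h N. 0 < \<theta> \<Longrightarrow> \<theta> < \<eta> \<Longrightarrow> \<theta> \<le> 1 \<Longrightarrow> 0 < h \<Longrightarrow> h \<le> T \<Longrightarrow>
    (\<Sum>k<N. 2^k * w (\<theta> * h/2^k) powr (2 * kp)) \<le> d * \<theta> * h powr (2 * \<alpha> * kp)"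
    using level_sum_partition[OF d] by blast
  show "\<exists>\<eta>>0. \<forall>N \<tau>. unit_partition N \<tau> \<and> mesh N \<tau> < \<eta> \<longrightarrow>
     besov2 T (2 * \<alpha>) (p/2) top (\<lambda>s t. riemann_sum N \<tau> (\<lambda>t. f (Y t)) X s t - incr (\<lambda>t. Y t - Y 0) s t) < ennreal \<epsilon>"
  proof (intro exI[of _ \<eta>] conjI \<eta>(1) allI impI, elim conjE)
    fix N \<tau> assume \<tau>: "unit_partition N \<tau>" and m: "mesh N \<tau> < \<eta>"
    define A where "A s t = riemann_sum N \<tau> (\<lambda>t. f (Y t)) X s t - incr (\<lambda>t. Y t - Y 0) s t" for s t
    define \<theta> where "\<theta> k = \<tau> (Suc k) - \<tau> k" for k
    have \<theta>: "0 < \<theta> k" "\<theta> k < \<eta>" "\<theta> k \<le> 1" if "k < N" for k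
      using \<tau> mesh_ge[OF that, of \<tau>] m that unit_partition_bounds[OF \<tau>, of k] unit_partition_bounds[OF \<tau>, of "Suc k"]
      by (auto simp: \<theta>_def unit_partition_def)
    have \<theta>sum: "(\<Sum>k<N. \<theta> k) = 1"
      unfolding \<theta>_def sum_lessThan_telescope using \<tau> by (simp add: unit_partition_def)
    have Aeq: "A s (s + h) = - (\<Sum>k<N. rem f X Y (s + \<tau> k * h) (\<theta> k * h))" if "0 \<le> h" for s h
      unfolding A_def \<theta>_def by (rule riemann_sum_minus_incr[OF \<tau> _ that, of _ Y "Y 0"]) simp
    have L: "Lpc (p/2) 0 (T - h) (\<lambda>s. norm (A s (s + h))) ((\<delta> * h powr (2 * \<alpha>)) powr kp) \<and> continuous_on {0..T - h} (\<lambda>s. A s (s + h))"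
      if h: "0 \<le> h" "h \<le> T" for h
    proof -
      have \<theta>h: "\<tau> k * h + \<theta> k * h \<le> h" "0 \<le> \<tau> k * h" "0 \<le> \<theta> k * h" "\<theta> k * h \<le> T" if "k < N" for k
      proof -
        have "\<tau> (Suc k) * h \<le> 1 * h" using unit_partition_bounds[OF \<tau>, of "Suc k"] that h by (intro mult_right_mono) auto
        then show 1: "\<tau> k * h + \<theta> k * h \<le> h" by (simp add: \<theta>_def algebra_simps)
        show 2: "0 \<le> \<tau> k * h" "0 \<le> \<theta> k * h" using unit_partition_bounds[OF \<tau>, of k] \<theta>[OF that] that h by auto
        show "\<theta> k * h \<le> T" using 1 2 h by linarith
      qed
      have cr: "continuous_on {0..T - \<theta> k * h} (\<lambda>s. rem f X Y s (\<theta> k * h))" if "k < N" for k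
        by (rule continuous_rem[OF Y \<theta>h(3)[OF that] \<theta>h(4)[OF that]])
      have crs: "continuous_on {0..T - h} (\<lambda>s. rem f X Y (s + \<tau> k * h) (\<theta> k * h))" if "k < N" for k
      proof (rule continuous_on_compose2[OF cr[OF that]])
        show "(\<lambda>s. s + \<tau> k * h) ` {0..T - h} \<subseteq> {0..T - \<theta> k * h}"
          using \<theta>h[OF that] by (auto simp del: mult_nonneg_nonneg)
      qed (intro continuous_intros)
      have c: "continuous_on {0..T - h} (\<lambda>s. A s (s + h))"
        unfolding Aeq[OF h(1)] by (intro continuous_on_minus continuous_on_sum crs) auto
      moreover have "Lpc (p/2) 0 (T - h) (\<lambda>s. norm (A s (s + h))) ((\<delta> * h powr (2 * \<alpha>)) powr kp)"
      proof -
        \<comment> \<open>At \<open>h = 0\<close> the remainders vanish, and at \<open>h = T\<close>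
          the norm is over one point; in between \<open>rem_Lpc\<close> applies to every
          piece.\<close>
        consider "h = 0" | "h = T" | "0 < h" "h < T" using h by linarith
        then show ?thesis
        proof cases
          case 1
          then show ?thesis using Lpc_zero[OF p2] Aeq[of 0] by (simp add: rem_def)
        next
          case 2
          then show ?thesis using Lpc_degenerate[of "p/2" 0] by simp
        next
          case 3
          have "Lpc (p/2) 0 (T - h) (\<lambda>s. norm (rem f X Y (s + \<tau> k * h) (\<theta> k * h))) (G powr kp * (d * \<theta> k * h powr (2 * \<alpha> * kp)))" if k: "k < N" for k
          proof (rule Lpc_shift[OF rem_Lpc[OF Y sewn] p2])
            show "0 < \<theta> k * h" using \<theta>[OF k] 3 by simp
            have "\<theta> k * h \<le> 1 * h" using \<theta>(3)[OF k] 3 by (intro mult_right_mono) auto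
            then show "\<theta> k * h < T" using 3 by linarith
            show "0 \<le> d * \<theta> k * h powr (2 * \<alpha> * kp)" using d \<theta>[OF k] by simp
            show "(\<Sum>i<M. 2^i * w (\<theta> k * h/2^i) powr (2 * kp)) \<le> d * \<theta> k * h powr (2 * \<alpha> * kp)" for M
              by (rule \<eta>(2)) (use \<theta>[OF k] 3 in auto)
            show "continuous_on {0..T - \<theta> k * h} (\<lambda>s. norm (rem f X Y s (\<theta> k * h)))"
              by (intro continuous_on_norm cr k)
            show "0 \<le> 0 + \<tau> k * h" "T - h + \<tau> k * h \<le> T - \<theta> k * h" using \<theta>h[OF k] by linarith+
          qed simp
          then have s: "Lpc (p/2) 0 (T - h) (\<lambda>s. \<Sum>k<N. norm (rem f X Y (s + \<tau> k * h) (\<theta> k * h))) (\<Sum>k<N. G powr kp * (d * \<theta> k * h powr (2 * \<alpha> * kp)))"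
            using d less_imp_le[OF \<theta>(1)] by (intro Lpc_sum p2 continuous_on_norm crs) (auto intro!: mult_nonneg_nonneg)
          show ?thesis
          proof (rule Lpc_mono[OF s p2])
            have eq: "(\<Sum>k<N. G powr kp * (d * \<theta> k * h powr (2 * \<alpha> * kp))) = G powr kp * d * h powr (2 * \<alpha> * kp)"
            proof -
              have "(\<Sum>k<N. G powr kp * (d * \<theta> k * h powr (2 * \<alpha> * kp))) = (\<Sum>k<N. (G powr kp * d * h powr (2 * \<alpha> * kp)) * \<theta> k)"
                by (intro sum.cong refl) (simp only: mult_ac)
              then show ?thesis unfolding sum_distrib_left[symmetric] \<theta>sum by simp
            qed
            show "0 \<le> (\<Sum>k<N. G powr kp * (d * \<theta> k * h powr (2 * \<alpha> * kp)))" unfolding eq using d by simp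
            have "G powr kp * d \<le> \<delta> powr kp"
              using Gk unfolding d_def by (simp add: field_simps)
            then have "G powr kp * d * h powr (2 * \<alpha> * kp) \<le> \<delta> powr kp * h powr (2 * \<alpha> * kp)"
              by (intro mult_right_mono) auto
            then show "(\<Sum>k<N. G powr kp * (d * \<theta> k * h powr (2 * \<alpha> * kp))) \<le> (\<delta> * h powr (2 * \<alpha>)) powr kp"
              unfolding eq powr_mult powr_powr .
            show "norm (A s (s + h)) \<le> (\<Sum>k<N. norm (rem f X Y (s + \<tau> k * h) (\<theta> k * h)))" for s
              unfolding Aeq[OF h(1)] norm_minus_cancel by (rule norm_sum)
            show "continuous_on {0..T - h} (\<lambda>s. norm (A s (s + h)))" by (intro continuous_on_norm c)
            show "continuous_on {0..T - h} (\<lambda>s. \<Sum>k<N. norm (rem f X Y (s + \<tau> k * h) (\<theta> k * h)))"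
              by (intro continuous_on_sum continuous_on_norm crs) auto
          qed simp
        qed
      qed
      ultimately show ?thesis by blast
    qed
    have "besov2 T (2 * \<alpha>) (p/2) top A \<le> ennreal \<delta>"
      unfolding besov2_def if_P[OF refl]
    proof (rule SUP_least)
      fix t assume t: "t \<in> {0<..T}"
      have "modulus2 T (p/2) A t \<le> ennreal (\<delta> * t powr (2 * \<alpha>))"
        unfolding modulus2_def
      proof (rule SUP_least)
        fix h assume h: "h \<in> {0..t}"
        have "Lp_norm (p/2) (lebesgue_on {0..T - h}) (\<lambda>s. A s (s + h)) \<le> ennreal (\<delta> * h powr (2 * \<alpha>))"
          by (subst Lp_norm_le_iff[OF p2]) (use L[of h] h t \<delta> in \<open>auto simp: kp_def[symmetric]\<close>)
        also have "\<dots> \<le> ennreal (\<delta> * t powr (2 * \<alpha>))"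
          using h \<delta> \<alpha> by (intro ennreal_leI mult_left_mono powr_mono2) auto
        finally show "Lp_norm (p/2) (lebesgue_on {0..T - h}) (\<lambda>s. A s (s + h)) \<le> ennreal (\<delta> * t powr (2 * \<alpha>))" .
      qed
      then have "modulus2 T (p/2) A t / ennreal (t powr (2 * \<alpha>)) \<le> ennreal (\<delta> * t powr (2 * \<alpha>)) / ennreal (t powr (2 * \<alpha>))"
        by (rule divide_right_mono_ennreal)
      also have "\<dots> = ennreal \<delta>" using t \<delta> by (simp add: divide_ennreal)
      finally show "modulus2 T (p/2) A t / ennreal (t powr (2 * \<alpha>)) \<le> ennreal \<delta>" .
    qed
    also have "ennreal \<delta> < ennreal \<epsilon>" using \<open>0 < \<epsilon>\<close> by (simp add: \<delta>_def ennreal_less_iff)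
    finally show "besov2 T (2 * \<alpha>) (p/2) top (\<lambda>s t. riemann_sum N \<tau> (\<lambda>t. f (Y t)) X s t - incr (\<lambda>t. Y t - Y 0) s t) < ennreal \<epsilon>"
      unfolding A_def .
  qed
qed

end

end

section \<open>The Besov bound for solutions\<close>

lemma powr_add_le_two:
  fixes a b r :: real
  assumes "0 \<le> a" "0 \<le> b" "0 < r"
  shows "(a + b) powr r \<le> 2 powr r * (a powr r + b powr r)"
proof -
  have "(a + b) powr r \<le> (2 * max a b) powr r" using assms by (intro powr_mono2) auto
  also have "\<dots> = 2 powr r * max a b powr r" by (rule powr_mult)
  also have "\<dots> \<le> 2 powr r * (a powr r + b powr r)" by (intro mult_left_mono) (auto simp: max_def)
  finally show ?thesis .
qed

context driven
begin

definition "C3 = G * C2 + Q"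

lemma C3_nonneg: "0 \<le> C3"
  using G_nonneg C2_nonneg by (simp add: C3_def Q_def)

context
  fixes Y :: "real \<Rightarrow> real^'m"
  assumes Y: "continuous_on {0..T} Y" and sewn: "sewn T (rem f X Y)"
begin

lemma rem_Lp_C3:
  "0 < h \<Longrightarrow> h < T \<Longrightarrow> Lpc p 0 (T - h) (\<lambda>s. norm (rem f X Y s h)) (C3 * h powr (\<alpha> + \<gamma>))"
  unfolding C3_def by (rule rem_Lp[OF Y sewn])

lemma continuous_incr_Y: "0 \<le> h \<Longrightarrow> h \<le> T \<Longrightarrow> continuous_on {0..T - h} (\<lambda>s. incr Y s (s + h))"
  unfolding incr_def
  by (intro continuous_intros continuous_on_compose2[OF Y] continuous_on_subset[OF Y]) auto

lemma modulus2_solution_le: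
  assumes "0 < \<tau>" "\<tau> \<le> T"
  shows "modulus2 T p (incr Y) \<tau> \<le> ennreal (F * w \<tau> + C3 * \<tau> powr (\<alpha> + \<gamma>))"
  unfolding modulus2_def
proof (rule SUP_least)
  fix h assume h: "h \<in> {0..\<tau>}"
  define e where "e = F * w \<tau> + C3 * \<tau> powr (\<alpha> + \<gamma>)"
  have e0: "0 \<le> e" using F_nonneg C3_nonneg by (simp add: e_def)
  have "Lpc p 0 (T - h) (\<lambda>s. norm (incr Y s (s + h))) e"
  proof -
    consider "h = 0" | "h = T" | "0 < h" "h < T" using h assms by force
    then show ?thesis
    proof cases
      case 1
      then show ?thesis using Lpc_zero[OF p_pos(1) e0] by (simp add: incr_def)
    next
      case 2
      then show ?thesis using Lpc_degenerate[of p 0] by simp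
    next
      case 3
      have hT: "0 \<le> h" "h \<le> T" using 3 by auto
      have cX: "continuous_on {0..T - h} (\<lambda>s. norm (X (s + h) - X s))" by (rule continuous_on_norm_incr[OF hT])
      have cR: "continuous_on {0..T - h} (\<lambda>s. norm (rem f X Y s h))"
        by (intro continuous_on_norm continuous_rem[OF Y] hT)
      have 1: "Lpc p 0 (T - h) (\<lambda>s. F * norm (X (s + h) - X s)) (F powr kap p * w \<tau>)"
        by (rule Lpc_cmult[OF w_Lpc p_pos(1) F_nonneg]) (use h assms in auto)
      have 2: "Lpc p 0 (T - h) (\<lambda>s. F * norm (X (s + h) - X s) + norm (rem f X Y s h)) (F powr kap p * w \<tau> + C3 * h powr (\<alpha> + \<gamma>))"
        by (rule Lpc_add[OF 1 rem_Lp_C3[OF 3] p_pos(1)])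
          (use C3_nonneg F_nonneg cX cR in \<open>auto intro!: continuous_intros\<close>)
      show ?thesis
      proof (rule Lpc_mono[OF 2 p_pos(1)])
        show "0 \<le> F powr kap p * w \<tau> + C3 * h powr (\<alpha> + \<gamma>)" using C3_nonneg by simp
        have "h powr (\<alpha> + \<gamma>) \<le> \<tau> powr (\<alpha> + \<gamma>)"
          using h 3 \<gamma>_pos \<alpha> by (intro powr_mono2) auto
        then show "F powr kap p * w \<tau> + C3 * h powr (\<alpha> + \<gamma>) \<le> e"
          using F_nonneg C3_nonneg by (simp add: e_def mult_left_mono)
        show "continuous_on {0..T - h} (\<lambda>s. norm (incr Y s (s + h)))"
          by (intro continuous_on_norm continuous_incr_Y hT)
        show "continuous_on {0..T - h} (\<lambda>s. F * norm (X (s + h) - X s) + norm (rem f X Y s h))"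
          by (intro continuous_on_add continuous_on_mult_left cX cR)
        show "norm (incr Y s (s + h)) \<le> F * norm (X (s + h) - X s) + norm (rem f X Y s h)" for s
          unfolding incr_def by (rule incr_le_rem)
      qed simp
    qed
  qed
  then show "Lp_norm p (lebesgue_on {0..T - h}) (\<lambda>s. incr Y s (s + h)) \<le> ennreal (F * w \<tau> + C3 * \<tau> powr (\<alpha> + \<gamma>))"
    using h assms e0 unfolding e_def[symmetric]
    by (subst Lp_norm_le_iff[OF p_pos(1) continuous_incr_Y]) auto
qed

text \<open>On the dyadic interval of index n the normalised modulus of \<open>Y\<close> is at most
  \<open>u n\<close>: the first-order term enters through \<open>\<beta> n\<close>, the remainder
  through the surplus exponent \<open>\<gamma>\<close>. The first sequence is in l^q because
  \<open>X\<close> is in the Besov space, the second is geometric.\<close>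

lemma besov_seminorm_solution_le:
  "besov_seminorm T \<alpha> p q Y \<le> ennreal (besov_bound_rate q (enn2real q) (F * 2 powr \<alpha>) B C3 T \<gamma>)"
proof -
  define u where "u n = F * 2 powr \<alpha> * \<beta> n + C3 * (T/2^n) powr \<gamma>" for n
  have u0: "0 \<le> u n" for n using F_nonneg C3_nonneg by (simp add: u_def)
  have ratio: "modulus2 T p (incr Y) \<tau> / ennreal (\<tau> powr \<alpha>) \<le> ennreal (u n)" if "T/2^Suc n < \<tau>" "\<tau> \<le> T/2^n" for n \<tau>
  proof -
    have "0 < T/2^Suc n" using T by simp
    moreover have "T/2^n \<le> T/1" using T one_le_power[of "2::real" n] by (intro divide_left_mono) auto
    ultimately have \<tau>: "0 < \<tau>" "\<tau> \<le> T" using that by auto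
    have "F * w \<tau> + C3 * \<tau> powr (\<alpha> + \<gamma>) \<le> F * (2 powr \<alpha> * \<tau> powr \<alpha> * \<beta> n) + C3 * (\<tau> powr \<alpha> * (T/2^n) powr \<gamma>)"
    proof (intro add_mono mult_left_mono F_nonneg C3_nonneg)
      show "w \<tau> \<le> 2 powr \<alpha> * \<tau> powr \<alpha> * \<beta> n" using w_le_\<beta>[OF that, of 0] by simp
      show "\<tau> powr (\<alpha> + \<gamma>) \<le> \<tau> powr \<alpha> * (T/2^n) powr \<gamma>"
        unfolding powr_add using that \<tau> \<gamma>_pos by (intro mult_left_mono powr_mono2) auto
    qed
    also have "\<dots> = u n * \<tau> powr \<alpha>" by (simp add: u_def algebra_simps)
    finally have "modulus2 T p (incr Y) \<tau> \<le> ennreal (u n * \<tau> powr \<alpha>)"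
      using modulus2_solution_le[OF \<tau>] by (meson ennreal_leI order_trans)
    then have "modulus2 T p (incr Y) \<tau> / ennreal (\<tau> powr \<alpha>) \<le> ennreal (u n * \<tau> powr \<alpha>) / ennreal (\<tau> powr \<alpha>)"
      by (rule divide_right_mono_ennreal)
    also have "\<dots> = ennreal (u n)" using \<tau> u0[of n] by (simp add: divide_ennreal)
    finally show ?thesis .
  qed
  show ?thesis
  proof (cases "q = top")
    case True
    have "modulus2 T p (incr Y) \<tau> / ennreal (\<tau> powr \<alpha>) \<le> ennreal (F * 2 powr \<alpha> * B + C3 * T powr \<gamma>)" if "\<tau> \<in> {0<..T}" for \<tau>
    proof -
      have \<tau>: "0 < \<tau>" "\<tau> \<le> T" using that by auto
      obtain n where n: "T/2^Suc n < \<tau>" "\<tau> \<le> T/2^n"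
        by (rule dyadic_scale[OF \<tau>])
      have "T/2^n \<le> T/1" using T one_le_power[of "2::real" n] by (intro divide_left_mono) auto
      then have "u n \<le> F * 2 powr \<alpha> * B + C3 * T powr \<gamma>"
        unfolding u_def using F_nonneg C3_nonneg T \<gamma>_pos by (intro add_mono mult_left_mono \<beta>_le powr_mono2) auto
      then show ?thesis using ratio[OF n] by (meson ennreal_leI order_trans)
    qed
    then have "(SUP \<tau>\<in>{0<..T}. modulus2 T p (incr Y) \<tau> / ennreal (\<tau> powr \<alpha>)) \<le> ennreal (F * 2 powr \<alpha> * B + C3 * T powr \<gamma>)"
      by (rule SUP_least)
    then show ?thesis
      unfolding besov_seminorm_def besov2_def besov_bound_rate_def if_P[OF True] .
  next
    case False
    define r where "r = enn2real q"
    have r: "0 < r" using enn2real_pos[OF q False] by (simp add: r_def)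
    define S where "S = 2 powr r * ((F * 2 powr \<alpha>) powr r * B powr r + C3 powr r * T powr (\<gamma> * r) * geom_const (\<gamma> * r))"
    have partial: "(\<Sum>n<N. u n powr r) \<le> S" for N
    proof -
      have "(\<Sum>n<N. u n powr r) \<le> (\<Sum>n<N. 2 powr r * ((F * 2 powr \<alpha>) powr r * \<beta> n powr r + C3 powr r * (T powr (\<gamma> * r) * 2 powr - (real n * (\<gamma> * r)))))"
      proof (rule sum_mono)
        fix n
        have "u n powr r \<le> 2 powr r * ((F * 2 powr \<alpha> * \<beta> n) powr r + (C3 * (T/2^n) powr \<gamma>) powr r)"
          unfolding u_def using F_nonneg C3_nonneg by (intro powr_add_le_two r) auto
        also have "(C3 * (T/2^n) powr \<gamma>) powr r = C3 powr r * (T powr (\<gamma> * r) * 2 powr - (real n * (\<gamma> * r)))"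
          unfolding powr_mult powr_powr dyadic_powr by (simp add: mult.assoc)
        also have "(F * 2 powr \<alpha> * \<beta> n) powr r = (F * 2 powr \<alpha>) powr r * \<beta> n powr r" by (rule powr_mult)
        finally show "u n powr r \<le> 2 powr r * ((F * 2 powr \<alpha>) powr r * \<beta> n powr r + C3 powr r * (T powr (\<gamma> * r) * 2 powr - (real n * (\<gamma> * r))))" .
      qed
      also have "\<dots> = 2 powr r * ((F * 2 powr \<alpha>) powr r * (\<Sum>n<N. \<beta> n powr r) + C3 powr r * T powr (\<gamma> * r) * (\<Sum>n<N. 2 powr - (real n * (\<gamma> * r))))"
        by (simp add: sum_distrib_left sum.distrib distrib_left mult.assoc)
      also have "\<dots> \<le> S"
        unfolding S_def
      proof (intro mult_left_mono add_mono)
        show "(\<Sum>n<N. \<beta> n powr r) \<le> B powr r"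
          using False by (intro sum_\<beta>_powr) (auto simp: r_def less_top)
        show "(\<Sum>n<N. 2 powr - (real n * (\<gamma> * r))) \<le> geom_const (\<gamma> * r)"
        proof -
          define x where "x = 2 powr - (\<gamma> * r)"
          have x: "0 < x" "x < 1" using \<gamma>_pos r by (auto simp: x_def powr_less_one)
          have "2 powr - (real n * (\<gamma> * r)) = x ^ n" for n
            using powr_realpow[OF x(1), of n] by (simp add: x_def powr_powr mult_ac)
          then have "(\<Sum>n<N. 2 powr - (real n * (\<gamma> * r))) = (1 - x^N) / (1 - x)" using x by (simp add: sum_gp_strict)
          also have "\<dots> \<le> 1 / (1 - x)" using x by (intro divide_right_mono) auto
          finally show ?thesis using \<gamma>_pos r by (simp add: geom_const_def x_def)
        qed
      qed auto
      finally show ?thesis .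
    qed
    have su: "summable (\<lambda>n. u n powr r)"
      by (rule bounded_imp_summable[where B=S]) (simp, metis partial lessThan_Suc_atMost)
    have "(\<integral>\<^sup>+\<tau>\<in>{0<..T}. (enn_powr (modulus2 T p (incr Y) \<tau> / ennreal (\<tau> powr \<alpha>)) r / ennreal \<tau>) \<partial>lborel) \<le> ennreal (suminf (\<lambda>n. u n powr r))"
    proof (rule nn_integral_dyadic_le[OF T _ su])
      fix n \<tau> assume n: "T/2^Suc n < \<tau>" "\<tau> \<le> T/2^n"
      have Tn: "0 < T/2^Suc n" using T by simp
      have "modulus2 T p (incr Y) \<tau> / ennreal (\<tau> powr \<alpha>) \<le> ennreal (u n)" by (rule ratio[OF n])
      then have "enn_powr (modulus2 T p (incr Y) \<tau> / ennreal (\<tau> powr \<alpha>)) r \<le> ennreal (u n powr r)"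
        using enn_powr_le_iff[of "1/r" "u n powr r"] r u0[of n] by (simp add: powr_powr)
      then have "enn_powr (modulus2 T p (incr Y) \<tau> / ennreal (\<tau> powr \<alpha>)) r / ennreal \<tau> \<le> ennreal (u n powr r) / ennreal \<tau>"
        by (rule divide_right_mono_ennreal)
      also have "\<dots> = ennreal (u n powr r / \<tau>)" using Tn n by (simp add: divide_ennreal)
      also have "\<dots> \<le> ennreal (u n powr r / (T/2^Suc n))"
        using Tn n by (intro ennreal_leI frac_le) auto
      finally show "enn_powr (modulus2 T p (incr Y) \<tau> / ennreal (\<tau> powr \<alpha>)) r / ennreal \<tau> \<le> ennreal (u n powr r / (T/2^Suc n))" .
    qed simp
    also have "\<dots> \<le> ennreal S" by (intro ennreal_leI suminf_le_const su partial)
    also have "S = (S powr (1/r)) powr r" using partial[of 0] r by (simp add: powr_powr)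
    finally have "enn_powr (\<integral>\<^sup>+\<tau>\<in>{0<..T}. (enn_powr (modulus2 T p (incr Y) \<tau> / ennreal (\<tau> powr \<alpha>)) r / ennreal \<tau>) \<partial>lborel) (1/r) \<le> ennreal (S powr (1/r))"
      by (subst enn_powr_le_iff[OF r]) auto
    then show ?thesis
      unfolding besov_seminorm_def besov2_def besov_bound_rate_def if_not_P[OF False] S_def r_def .
  qed
qed

lemma solution_in_besov_space: "Y \<in> besov_space T \<alpha> p q"
  unfolding besov_space_def
proof (intro CollectI conjI)
  show "Y \<in> borel_measurable (lebesgue_on {0..T})"
    by (rule continuous_imp_measurable_on_sets_lebesgue[OF Y]) simp
  show "besov_seminorm T \<alpha> p q Y < top"
    using besov_seminorm_solution_le ennreal_less_top le_less_trans by blast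
  have "bounded (Y ` {0..T})"
    by (intro compact_imp_bounded compact_continuous_image Y) simp
  then obtain b where b: "\<And>x. x \<in> {0..T} \<Longrightarrow> norm (Y x) \<le> b" unfolding bounded_iff by blast
  have b0: "0 \<le> b" using order_trans[OF norm_ge_zero b[of 0]] T by simp
  have "Lpc p 0 T (\<lambda>x. norm (Y x)) ((1 + T) * b powr kap p)"
    by (rule Lpc_mono[OF Lpc_const[OF p_pos(1) b0, of 0 T T] p_pos(1)])
      (use T b b0 Y in \<open>auto intro!: continuous_intros\<close>)
  then have "Lp_norm p (lebesgue_on {0..T}) Y \<le> ennreal ((1 + T) * b)"
    using b0 T by (subst Lp_norm_le_iff[OF p_pos(1) Y]) auto
  then show "Lp_norm p (lebesgue_on {0..T}) Y < top"
    using ennreal_less_top le_less_trans by blast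
qed

lemma sewn_imp_young_solution: "young_solution T \<alpha> p q f X (Y 0) Y"
  unfolding young_solution_def
  using solution_in_besov_space Y young_integral[OF Y sewn] by (auto intro!: exI[of _ "\<lambda>t. Y t - Y 0"])

end

section \<open>From Young integrals to the pointwise condition\<close>

lemma dyadic_unit_partition:
  "unit_partition (2^i) (\<lambda>j. real j / 2^i)" "mesh (2^i) (\<lambda>j. real j / 2^i) = 1/2^i"
proof -
  show "unit_partition (2^i) (\<lambda>j. real j / 2^i)"
    by (auto simp: unit_partition_def divide_strict_right_mono)
  have "(\<lambda>k. real (Suc k) / 2^i - real k / 2^i) ` {..<2^i} = {1/2^i :: real}"
    by (auto simp: diff_divide_distrib[symmetric] image_def intro!: exI[of _ 0] bexI[of _ 0])
  then show "mesh (2^i) (\<lambda>j. real j / 2^i) = 1/2^i"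
    by (simp add: mesh_def)
qed

text \<open>On dyadic partitions of depth \<open>i\<close> the error of the Riemann sum is exactly
  minus \<open>lev (rem f X Y) i\<close>, so its L^{p/2} norm tends to 0. By
  \<open>lev_telescope\<close> a remainder is this sum plus the defects of the first
  \<open>i\<close> levels, which are bounded by squared increments of \<open>X\<close> and of
  \<open>Y\<close>, both paths being in the same Besov space. Summed over the subintervals of level
  \<open>k\<close>, the defects stay below a tail \<open>F * t k\<close> independent of
  \<open>i\<close>; letting \<open>i\<close> grow leaves only this tail.\<close>

lemma young_imp_sewn:
  fixes Y I :: "real \<Rightarrow> real^'m"
  assumes bY: "besov_path T \<alpha> p q Y" and yi: "has_young_integral T \<alpha> p (\<lambda>t. f (Y t)) X I"
    and YI: "\<And>t. t \<in> {0..T} \<Longrightarrow> Y t = y + I t"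
  shows "sewn T (rem f X Y)"
  unfolding sewn_def
proof (intro allI impI, elim conjE)
  have p2: "0 < p/2" by (rule half_pos[OF p_pos(1)])
  have Y: "continuous_on {0..T} Y" using besov_path.cont[OF bY] .
  fix s0 h assume s0: "0 \<le> s0" "0 < h" "s0 + h \<le> T" "h < T"
  have Yd: "dyadic_dominated T Y"
    by (rule besov_path.dyadic_dominated_X[OF bY kappa_2])
  obtain cX where cX: "summable cX" "\<And>k::nat. 0 \<le> cX k"
      "\<And>h' s k. h/2 \<le> h' \<Longrightarrow> h' \<le> h \<Longrightarrow> 0 \<le> s \<Longrightarrow> s + h' \<le> T \<Longrightarrow> lev (dpow 2 X) k s h' \<le> cX k"
    using X_dominated s0 unfolding dyadic_dominated_def by (metis less_imp_le)
  obtain cY where cY: "summable cY" "\<And>k::nat. 0 \<le> cY k"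
      "\<And>h' s k. h/2 \<le> h' \<Longrightarrow> h' \<le> h \<Longrightarrow> 0 \<le> s \<Longrightarrow> s + h' \<le> T \<Longrightarrow> lev (dpow 2 Y) k s h' \<le> cY k"
    using Yd s0 unfolding dyadic_dominated_def by (metis less_imp_le)
  define c where "c k = cX k + cY k" for k
  have c: "summable c" "\<And>k. 0 \<le> c k" using cX cY by (auto simp: c_def[abs_def] intro: summable_add)
  define t where "t N = suminf c - (\<Sum>k<N. c k)" for N
  have tlim: "t \<longlonglongrightarrow> 0"
    unfolding t_def[abs_def] by (rule suminf_tail_tendsto_0[OF c(1)])
  let ?R = "\<lambda>s h. norm (rem f X Y s h)"
  define A where "A s h = (f (Y (s + h/2)) - f (Y s)) *v (X (s + h) - X (s + h/2))" for s h
  have A: "norm (A s h) \<le> F * (lev (dpow 2 X) 1 s h + lev (dpow 2 Y) 1 s h)" for s h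
  proof -
    have "norm (A s h) \<le> norm (f (Y (s + h/2)) - f (Y s)) * norm (X (s + h) - X (s + h/2))"
      unfolding A_def by (rule norm_matrix_vector_mult_le)
    also have "\<dots> \<le> (F * norm (Y (s + h/2) - Y s)) * norm (X (s + h) - X (s + h/2))"
      by (intro mult_right_mono lipschitz) simp
    also have "\<dots> = F * (norm (Y (s + h/2) - Y s) * norm (X (s + h) - X (s + h/2)))" by simp
    also have "\<dots> \<le> F * ((norm (Y (s + h/2) - Y s))\<^sup>2 + (norm (X (s + h) - X (s + h/2)))\<^sup>2)"
      by (intro mult_left_mono mult_le_sum_squares F_nonneg) auto
    also have "\<dots> \<le> F * (lev (dpow 2 X) 1 s h + lev (dpow 2 Y) 1 s h)"
      by (intro mult_left_mono F_nonneg) (simp add: dpow_2 add_ac)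
    finally show ?thesis .
  qed
  have local: "?R s h \<le> norm (lev (rem f X Y) i s h) + F * (\<Sum>k<i. lev (dpow 2 X) (Suc k) s h + lev (dpow 2 Y) (Suc k) s h)"
    if "0 < h" for i s h
  proof -
    have "rem f X Y s h = lev (rem f X Y) i s h + (\<Sum>k<i. lev A k s h)"
      by (rule lev_telescope) (unfold A_def, rule rem_midpoint)
    then have "?R s h \<le> norm (lev (rem f X Y) i s h) + (\<Sum>k<i. norm (lev A k s h))"
      by (metis norm_triangle_le add_left_mono norm_sum)
    also have "(\<Sum>k<i. norm (lev A k s h)) \<le> (\<Sum>k<i. F * (lev (dpow 2 X) (Suc k) s h + lev (dpow 2 Y) (Suc k) s h))"
    proof (rule sum_mono)
      fix k
      have "norm (lev A k s h) \<le> lev (\<lambda>s h. norm (A s h)) k s h" by (rule norm_lev_le)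
      also have "\<dots> \<le> lev (\<lambda>s h. F * (lev (dpow 2 X) 1 s h + lev (dpow 2 Y) 1 s h)) k s h"
        by (rule lev_mono[OF that]) (rule A)
      also have "\<dots> = F * (lev (dpow 2 X) (Suc k) s h + lev (dpow 2 Y) (Suc k) s h)"
        unfolding lev_cmult lev_add lev_lev by simp
      finally show "norm (lev A k s h) \<le> F * (lev (dpow 2 X) (Suc k) s h + lev (dpow 2 Y) (Suc k) s h)" .
    qed
    finally show ?thesis by (simp add: sum_distrib_left)
  qed
  \<comment> \<open>The norm stays outside the inner sum \<open>lev (rem f X Y) i\<close>, because
    it is that sum, not the sum of norms, whose smallness the Young integral provides.\<close>
  have key: "lev ?R k s h \<le> lev (\<lambda>s h. norm (lev (rem f X Y) i s h)) k s h + F * t k"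
    if s: "s \<in> {0..T - h}" for s k i
  proof -
    have "lev ?R k s h \<le> lev (\<lambda>s h. norm (lev (rem f X Y) i s h) + F * (\<Sum>k<i. lev (dpow 2 X) (Suc k) s h + lev (dpow 2 Y) (Suc k) s h)) k s h"
      by (rule lev_mono[OF s0(2)]) (rule local)
    also have "\<dots> = lev (\<lambda>s h. norm (lev (rem f X Y) i s h)) k s h + F * (\<Sum>l<i. lev (dpow 2 X) (Suc l + k) s h + lev (dpow 2 Y) (Suc l + k) s h)"
      unfolding lev_add lev_cmult lev_sum lev_lev ..
    also have "\<dots> \<le> lev (\<lambda>s h. norm (lev (rem f X Y) i s h)) k s h + F * t k"
    proof (intro add_left_mono mult_left_mono F_nonneg)
      have "(\<Sum>l<i. lev (dpow 2 X) (Suc l + k) s h + lev (dpow 2 Y) (Suc l + k) s h) \<le> (\<Sum>l<i. c (Suc l + k))"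
        unfolding c_def using s s0 by (intro sum_mono add_mono cX(3) cY(3)) auto
      also have "\<dots> = (\<Sum>n\<in>(\<lambda>l. Suc l + k) ` {..<i}. c n)" by (simp add: sum.reindex inj_on_def)
      also have "\<dots> = (\<Sum>n\<in>(\<lambda>l. Suc l + k) ` {..<i} \<union> {..<k}. c n) - (\<Sum>n<k. c n)"
        by (subst sum.union_disjoint) auto
      also have "\<dots> \<le> t k"
        unfolding t_def by (intro diff_right_mono sum_le_suminf c) auto
      finally show "(\<Sum>l<i. lev (dpow 2 X) (Suc l + k) s h + lev (dpow 2 Y) (Suc l + k) s h) \<le> t k" .
    qed
    finally show ?thesis .
  qed
  have small: "\<exists>i. Lpc (p/2) 0 (T - h) (\<lambda>s. lev (\<lambda>s h. norm (lev (rem f X Y) i s h)) k s h) d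
      \<and> continuous_on {0..T - h} (\<lambda>s. lev (\<lambda>s h. norm (lev (rem f X Y) i s h)) k s h)" if d: "0 < d" for d k
  proof -
    define \<eta> where "\<eta> = h/2^k"
    have \<eta>: "0 < \<eta>" "\<eta> \<le> T"
    proof -
      have "h/2^k \<le> h/1" using s0 one_le_power[of "2::real" k] by (intro divide_left_mono) auto
      then show "\<eta> \<le> T" using s0 by (simp add: \<eta>_def)
    qed (use s0 in \<open>simp add: \<eta>_def\<close>)
    \<comment> \<open>Scaled so that the resulting \<open>Lpc\<close> bound on one subinterval is
      \<open>d/2^k\<close>; the \<open>2^k\<close> subintervals then contribute \<open>d\<close> in
      total.\<close>
    define \<epsilon> where "\<epsilon> = (d/2^k) powr (1/kp) / \<eta> powr (2 * \<alpha>)"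
    have \<epsilon>: "0 < \<epsilon>" using d \<eta> by (simp add: \<epsilon>_def)
    have "\<exists>m>0. \<forall>N \<tau>. unit_partition N \<tau> \<and> mesh N \<tau> < m \<longrightarrow>
        besov2 T (2 * \<alpha>) (p/2) top (\<lambda>s t. riemann_sum N \<tau> (\<lambda>t. f (Y t)) X s t - incr I s t) < ennreal \<epsilon>"
      using yi \<epsilon> unfolding has_young_integral_def by blast
    then obtain m where m: "0 < m" "\<And>N \<tau>. unit_partition N \<tau> \<Longrightarrow> mesh N \<tau> < m \<Longrightarrow>
        besov2 T (2 * \<alpha>) (p/2) top (\<lambda>s t. riemann_sum N \<tau> (\<lambda>t. f (Y t)) X s t - incr I s t) < ennreal \<epsilon>"
      by blast
    obtain i where i: "(1/2)^i < m" using real_arch_pow_inv[OF m(1), of "1/2"] by auto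
    define g where "g s t = riemann_sum (2^i) (\<lambda>j. real j / 2^i) (\<lambda>t. f (Y t)) X s t - incr I s t" for s t
    have "besov2 T (2 * \<alpha>) (p/2) top g < ennreal \<epsilon>"
      unfolding g_def using i by (intro m(2) dyadic_unit_partition) (simp add: dyadic_unit_partition power_divide)
    then have "modulus2 T (p/2) g \<eta> / ennreal (\<eta> powr (2 * \<alpha>)) \<le> ennreal \<epsilon>"
      unfolding besov2_def if_P[OF refl] using \<eta> by (meson SUP_upper greaterThanAtMost_iff less_imp_le order_trans)
    then have "Lp_norm (p/2) (lebesgue_on {0..T - \<eta>}) (\<lambda>s. g s (s + \<eta>)) / ennreal (\<eta> powr (2 * \<alpha>)) \<le> ennreal \<epsilon>"
      unfolding modulus2_def using \<eta>
      by (elim order_trans[rotated]) (intro divide_right_mono_ennreal SUP_upper, auto)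
    then have L: "Lp_norm (p/2) (lebesgue_on {0..T - \<eta>}) (\<lambda>s. g s (s + \<eta>)) \<le> ennreal (\<epsilon> * \<eta> powr (2 * \<alpha>))" (is "?N \<le> _")
    proof -
      let ?e = "ennreal (\<eta> powr (2 * \<alpha>))"
      assume *: "?N / ?e \<le> ennreal \<epsilon>"
      have e: "?e \<noteq> 0" "?e \<noteq> top" using \<eta> by auto
      have "?N = ?N * ?e / ?e" using ennreal_mult_divide_eq[OF e] by simp
      also have "\<dots> = ?N / ?e * ?e" by (simp add: ennreal_divide_times ennreal_times_divide)
      also have "\<dots> \<le> ennreal \<epsilon> * ?e" by (rule mult_right_mono[OF *]) simp
      also have "\<dots> = ennreal (\<epsilon> * \<eta> powr (2 * \<alpha>))" using \<epsilon> by (simp add: ennreal_mult)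
      finally show ?thesis .
    qed
    have geq: "g s (s + \<eta>) = - lev (rem f X Y) i s \<eta>" if "s \<in> {0..T - \<eta>}" for s
    proof -
      have "g s (s + \<eta>) = - (\<Sum>k<2^i. rem f X Y (s + real k / 2^i * \<eta>) ((real (Suc k) / 2^i - real k / 2^i) * \<eta>))"
        unfolding g_def by (rule riemann_sum_minus_incr[OF dyadic_unit_partition(1), where y=y])
          (use that \<eta> YI in auto)
      then show ?thesis by (simp add: lev_eq_sum diff_divide_distrib[symmetric])
    qed
    have cr: "continuous_on {0..T - \<eta>} (\<lambda>s. lev (rem f X Y) i s \<eta>)"
      by (rule continuous_on_lev[OF continuous_rem[OF Y]]) (use \<eta> in auto)
    have cg: "continuous_on {0..T - \<eta>} (\<lambda>s. g s (s + \<eta>))"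
      using continuous_on_minus[OF cr] by (rule continuous_on_eq) (simp add: geq)
    have "Lpc (p/2) 0 (T - \<eta>) (\<lambda>s. norm (g s (s + \<eta>))) ((\<epsilon> * \<eta> powr (2 * \<alpha>)) powr kp)"
      using L \<epsilon> unfolding kp_def by (subst (asm) Lp_norm_le_iff[OF p2 cg]) auto
    also have "(\<epsilon> * \<eta> powr (2 * \<alpha>)) powr kp = d/2^k"
      using \<eta> d kp(1) by (simp add: \<epsilon>_def powr_powr)
    finally have Lg: "Lpc (p/2) 0 (T - \<eta>) (\<lambda>s. norm (lev (rem f X Y) i s \<eta>)) (d/2^k)"
      by (rule Lpc_mono[OF _ p2]) (use d cr cg in \<open>auto simp: geq intro!: continuous_intros\<close>)
    have pt: "0 \<le> real j * \<eta>" "real j * \<eta> + \<eta> \<le> h" if "j < 2^k" for j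
      using dyadic_point[of h j k 0] that s0 by (auto simp: \<eta>_def)
    have cs: "continuous_on {0..T - h} (\<lambda>s. norm (lev (rem f X Y) i (s + real j * \<eta>) \<eta>))" if "j < 2^k" for j
    proof (rule continuous_on_compose2[OF continuous_on_norm[OF cr]])
      have "x + real j * \<eta> \<in> {0..T - \<eta>}" if "x \<in> {0..T - h}" for x
        using that pt[OF \<open>j < 2^k\<close>] unfolding atLeastAtMost_iff by linarith
      then show "(\<lambda>s. s + real j * \<eta>) ` {0..T - h} \<subseteq> {0..T - \<eta>}" by blast
    qed (intro continuous_intros)
    have L1: "Lpc (p/2) 0 (T - h) (\<lambda>s. \<Sum>j<(2::nat)^k. norm (lev (rem f X Y) i (s + real j * \<eta>) \<eta>)) (\<Sum>j<(2::nat)^k. d/2^k)"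
    proof (rule Lpc_sum)
      fix j assume j: "j \<in> {..<(2::nat)^k}"
      show "Lpc (p/2) 0 (T - h) (\<lambda>s. norm (lev (rem f X Y) i (s + real j * \<eta>) \<eta>)) (d/2^k)"
      proof (rule Lpc_shift[OF Lg p2 continuous_on_norm[OF cr]])
        show "0 \<le> 0 + real j * \<eta>" "T - h + real j * \<eta> \<le> T - \<eta>" using pt[of j] j by auto
      qed simp
    qed (use p2 d cs in auto)
    have L2: "continuous_on {0..T - h} (\<lambda>s. \<Sum>j<(2::nat)^k. norm (lev (rem f X Y) i (s + real j * \<eta>) \<eta>))"
      by (intro continuous_on_sum cs) auto
    have L3: "(\<lambda>s. \<Sum>j<(2::nat)^k. norm (lev (rem f X Y) i (s + real j * \<eta>) \<eta>)) = (\<lambda>s. lev (\<lambda>s h. norm (lev (rem f X Y) i s h)) k s h)"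
      unfolding lev_eq_sum[of "\<lambda>s h. norm (lev (rem f X Y) i s h)"] \<eta>_def ..
    have "(\<Sum>j<(2::nat)^k. d/2^k) = d" by simp
    then show ?thesis using L1 L2 unfolding L3 by (intro exI[of _ i] conjI) (simp_all only:)
  qed
  have le: "lev ?R k s0 h \<le> F * t k" for k
  proof -
    \<comment> \<open>The positive part is bounded in L^{p/2} by every \<open>d > 0\<close>. It is
      continuous and \<open>[0, T - h]\<close> is nondegenerate, so it vanishes at every left
      endpoint, in particular at \<open>s0\<close>.\<close>
    define \<phi> where "\<phi> s = max 0 (lev ?R k s h - F * t k)" for s
    have cR: "continuous_on {0..T - h} (\<lambda>s. lev ?R k s h)"
      by (rule continuous_on_lev[OF continuous_on_norm[OF continuous_rem[OF Y]]]) (use s0 in auto)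
    have c\<phi>: "continuous_on {0..T - h} \<phi>" unfolding \<phi>_def by (intro continuous_intros cR)
    have "Lpc (p/2) 0 (T - h) \<phi> (0 + d)" if d: "0 < d" for d
    proof -
      obtain i where i: "Lpc (p/2) 0 (T - h) (\<lambda>s. lev (\<lambda>s h. norm (lev (rem f X Y) i s h)) k s h) d"
        "continuous_on {0..T - h} (\<lambda>s. lev (\<lambda>s h. norm (lev (rem f X Y) i s h)) k s h)"
        using small[OF d] by blast
      show ?thesis
      proof (rule Lpc_mono[OF i(1) p2])
        show "\<phi> s \<le> lev (\<lambda>s h. norm (lev (rem f X Y) i s h)) k s h" if "s \<in> {0..T - h}" for s
          using key[OF that, of k i] lev_nonneg[of "\<lambda>s h. norm (lev (rem f X Y) i s h)" k s h] by (simp add: \<phi>_def)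
      qed (use d c\<phi> i in \<open>auto simp: \<phi>_def\<close>)
    qed
    then have L0: "Lpc (p/2) 0 (T - h) \<phi> 0" by (rule Lpc_closed[OF _ order_refl])
    have "\<phi> s0 \<le> 0"
    proof (cases "p = top")
      case True
      then show ?thesis using L0 s0 by (simp add: Lpc_def half_eq_top_iff)
    next
      case False
      have P: "0 < enn2real p / 2" using p_real_1[OF False] by simp
      have c: "continuous_on {0..T - h} (\<lambda>s. \<phi> s powr (enn2real p / 2))"
        using P by (intro continuous_on_powr' c\<phi> continuous_intros) (auto simp: \<phi>_def)
      have "integral {0..T - h} (\<lambda>s. \<phi> s powr (enn2real p / 2)) \<le> 0"
        using L0 False by (simp add: Lpc_def half_eq_top_iff enn2real_half)
      moreover have "0 \<le> integral {0..T - h} (\<lambda>s. \<phi> s powr (enn2real p / 2))"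
        by (intro integral_nonneg integrable_continuous_real c) auto
      ultimately have "integral {0..T - h} (\<lambda>s. \<phi> s powr (enn2real p / 2)) = 0" by simp
      then have "\<forall>s\<in>{0..T - h}. \<phi> s powr (enn2real p / 2) = 0"
        using integral_eq_0_iff[OF c] s0 by simp
      then have "\<phi> s0 powr (enn2real p / 2) = 0" using s0 by simp
      then show ?thesis by simp
    qed
    then show ?thesis by (simp add: \<phi>_def)
  qed
  show "(\<lambda>k. lev ?R k s0 h) \<longlonglongrightarrow> 0"
    by (rule tendsto_0_le_real[OF _ le]) (use tendsto_mult_right_zero[OF tlim] in \<open>auto intro!: lev_nonneg\<close>)
qed

end

subsection \<open>The differential equation\<close>

text \<open>Restated outside the locale, so that the final bound is visibly a function of the
  quantities on which \<open>M\<close> may depend.\<close>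

definition "besov_B q x = (if q = top then enn2real x else 2 powr ((enn2real q + 1) / enn2real q) * enn2real x)"
  for q x :: ennreal

text \<open>\<open>C3\<close> with all intermediate constants written out; the driver and the
  coefficient enter through \<open>Bv\<close> and \<open>F\<close> only.\<close>

definition "driven_C3 \<alpha> p T F Bv =
  (let ip = 1 / enn2real p; k = kap (p/2); \<gamma> = \<alpha> - ip; C2 = dyadic_const \<alpha> ip 2 * Bv powr 2;
       G = exp (F * sqrt C2 * T powr \<gamma> / (1 - 2 powr - \<gamma>)) * F\<^sup>2;
       E = 2 powr (2 * \<alpha> * k) * geom_const (2 * \<alpha> * k - 1) * Bv powr (2 * k)
   in G * C2 + G * sqrt (C2 * E powr (1/k)))" for \<alpha> T F Bv :: real and p :: ennreal

definition "besov_bound \<alpha> p q T c x =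
  besov_bound_rate q (enn2real q) (c * 2 powr \<alpha>) (besov_B q x) (driven_C3 \<alpha> p T c (besov_B q x)) T (\<alpha> - 1 / enn2real p)"
  for \<alpha> T c :: real and p q x :: ennreal

context driven
begin

lemma B_eq: "B = besov_B q (besov_seminorm T \<alpha> p q X)"
  by (simp only: B_def K_def besov_B_def)

lemma C3_eq: "C3 = driven_C3 \<alpha> p T F B"
  unfolding C3_def Q_def G_def gronwall_def E_def C2_def kp_def driven_C3_def Let_def ..

lemma besov_seminorm_solution_le_bound:
  assumes "continuous_on {0..T} Y" "sewn T (rem f X Y)"
  shows "besov_seminorm T \<alpha> p q Y \<le> ennreal (besov_bound \<alpha> p q T F (besov_seminorm T \<alpha> p q X))"
  using besov_seminorm_solution_le[OF assms] unfolding besov_bound_def B_eq[symmetric] C3_eq[symmetric] .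

end

theorem theorem4p2:
  shows "\<exists>M :: real \<Rightarrow> ennreal \<Rightarrow> ennreal \<Rightarrow> real \<Rightarrow> real \<Rightarrow> ennreal \<Rightarrow> real.
    \<forall>(T::real) (\<alpha>::real) (p::ennreal) (q::ennreal)
      (X :: real \<Rightarrow> real^'n) (f :: real^'m \<Rightarrow> real^'n^'m).
      0 < T \<longrightarrow> 1/2 \<le> \<alpha> \<longrightarrow> \<alpha> < 1 \<longrightarrow> ennreal (1/\<alpha>) < p \<longrightarrow> 0 < q \<longrightarrow> (\<alpha> = 1/2 \<longrightarrow> q \<le> 2) \<longrightarrow>
      X \<in> besov_space T \<alpha> p q \<longrightarrow> continuous_on {0..T} X \<longrightarrow>
      (\<alpha> > 1/2 \<longrightarrow> (\<exists>\<delta>::real. 0 < \<delta> \<and> \<delta> \<le> 1 \<and> (1 + \<delta>) * \<alpha> > 1 \<and> ennreal (\<delta> * \<alpha>) > 1 / p \<and>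
                         Cb1_Hoelder \<delta> f)) \<longrightarrow>
      (\<alpha> = 1/2 \<longrightarrow> Cb2 f) \<longrightarrow>
      (\<forall>y::real^'m.
        (\<exists>Y. young_solution T \<alpha> p q f X y Y) \<and>
        (\<forall>Y Y'. young_solution T \<alpha> p q f X y Y \<longrightarrow> young_solution T \<alpha> p q f X y Y' \<longrightarrow>
           (\<forall>t\<in>{0..T}. Y t = Y' t)) \<and>
        (\<forall>Y. young_solution T \<alpha> p q f X y Y \<longrightarrow>
           besov_seminorm T \<alpha> p q Y
             \<le> ennreal (M \<alpha> p q T (C1_norm f) (besov_seminorm T \<alpha> p q X))))"
proof (intro exI[of _ besov_bound] allI impI)
  fix T \<alpha> :: real and p q :: ennreal and X :: "real \<Rightarrow> real^'n" and f :: "real^'m \<Rightarrow> real^'n^'m" and y :: "real^'m"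
  assume T: "0 < T" and \<alpha>: "1/2 \<le> \<alpha>" "\<alpha> < 1" and p: "ennreal (1/\<alpha>) < p" and q: "0 < q" and crit: "\<alpha> = 1/2 \<longrightarrow> q \<le> 2"
    and X: "X \<in> besov_space T \<alpha> p q" "continuous_on {0..T} X"
    and sub: "\<alpha> > 1/2 \<longrightarrow> (\<exists>\<delta>::real. 0 < \<delta> \<and> \<delta> \<le> 1 \<and> (1 + \<delta>) * \<alpha> > 1 \<and> ennreal (\<delta> * \<alpha>) > 1 / p \<and> Cb1_Hoelder \<delta> f)"
    and crit_f: "\<alpha> = 1/2 \<longrightarrow> Cb2 f"
  \<comment> \<open>The endpoint is treated as \<delta> = 1: a \<open>Cb2\<close> function has a
    Lipschitz derivative, and 2 is then the borderline exponent of the dyadic sums.\<close>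
  obtain \<delta> where \<delta>: "0 < \<delta>" "Cb1_Hoelder \<delta> f" "1 < \<alpha> * (1 + \<delta>) \<or> (\<alpha> = 1/2 \<and> \<delta> = 1)"
  proof (cases "\<alpha> = 1/2")
    case True
    then show thesis using crit_f Cb2_imp_Cb1_Hoelder[of f] that[of 1] by simp
  next
    case False
    then have "\<alpha> > 1/2" using \<alpha> by simp
    then show thesis using sub that by (auto simp: mult.commute)
  qed
  obtain L where L: "bounded_hoelder f (C1_norm f) \<delta> L"
    by (rule Cb1_Hoelder_bounded_hoelder[OF \<delta>(2,1)])
  interpret h: bounded_hoelder f "C1_norm f" \<delta> L by (rule L)
  interpret driven T \<alpha> p q X f "C1_norm f"
    by unfold_locales (use T \<alpha> p q crit X in auto)
  have r: "0 < 1 + \<delta>" using \<delta> by simp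
  \<comment> \<open>The condition for finite dyadic sums of exponent \<open>1 + \<delta>\<close>, at
    which uniqueness is run: strict if \<alpha> (1 + \<delta>) > 1, borderline with
    \<open>q \<le> 2\<close> at the endpoint.\<close>
  have \<kappa>: "0 < \<alpha> * (1 + \<delta>) - max 1 ((1 + \<delta>) * ip) \<or> (\<alpha> * (1 + \<delta>) - max 1 ((1 + \<delta>) * ip) = 0 \<and> q \<le> ennreal (1 + \<delta>))"
    using \<delta>(3)
  proof
    assume *: "1 < \<alpha> * (1 + \<delta>)"
    have "(1 + \<delta>) * ip < (1 + \<delta>) * \<alpha>" using r inv_p(2) by (intro mult_strict_left_mono)
    then show ?thesis using * by (simp add: mult.commute)
  next
    assume "\<alpha> = 1/2 \<and> \<delta> = 1"
    then show ?thesis using kappa_2 by simp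
  qed
  \<comment> \<open>Every Young solution is itself a Besov path and \<open>sewn\<close>, so
    uniqueness and the bound reach all solutions and not only the constructed one.\<close>
  have sol: "besov_path T \<alpha> p q Y \<and> continuous_on {0..T} Y \<and> sewn T (rem f X Y) \<and> Y 0 = y"
    if Y: "young_solution T \<alpha> p q f X y Y" for Y
  proof -
    obtain I where I: "has_young_integral T \<alpha> p (\<lambda>t. f (Y t)) X I" "\<forall>t\<in>{0..T}. Y t = y + I t"
      using Y unfolding young_solution_def by blast
    have b: "besov_path T \<alpha> p q Y"
      by unfold_locales (use T \<alpha> p q Y in \<open>auto simp: young_solution_def\<close>)
    have "I 0 = 0" using I(1) by (simp add: has_young_integral_def)
    then show ?thesis
      using b young_imp_sewn[OF b I(1), of y] I(2) T Y by (simp add: young_solution_def)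
  qed
  show "(\<exists>Y. young_solution T \<alpha> p q f X y Y) \<and>
        (\<forall>Y Y'. young_solution T \<alpha> p q f X y Y \<longrightarrow> young_solution T \<alpha> p q f X y Y' \<longrightarrow>
           (\<forall>t\<in>{0..T}. Y t = Y' t)) \<and>
        (\<forall>Y. young_solution T \<alpha> p q f X y Y \<longrightarrow>
           besov_seminorm T \<alpha> p q Y
             \<le> ennreal (besov_bound \<alpha> p q T (C1_norm f) (besov_seminorm T \<alpha> p q X)))"
  proof (intro conjI allI impI ballI)
    obtain Y where "continuous_on {0..T} Y" "Y 0 = y" "sewn T (rem f X Y)"
      using h.sewn_solution_exists[OF T \<gamma>_pos cont X_var X_dominated, of y] by blast
    then show "\<exists>Y. young_solution T \<alpha> p q f X y Y"
      using sewn_imp_young_solution by blast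
  next
    fix Y Y' t
    assume Y: "young_solution T \<alpha> p q f X y Y" and Y': "young_solution T \<alpha> p q f X y Y'" and t: "t \<in> {0..T}"
    show "Y t = Y' t"
      by (rule h.solution_unique[OF T \<gamma>_pos X_var dyadic_var_X[OF r \<kappa>]
          besov_path.dyadic_var_X[OF conjunct1[OF sol[OF Y]] r \<kappa>] _ _
          besov_path.dyadic_var_X[OF conjunct1[OF sol[OF Y']] r \<kappa>] _ _ _ t])
        (use sol[OF Y] sol[OF Y'] in auto)
  next
    fix Y assume "young_solution T \<alpha> p q f X y Y"
    then show "besov_seminorm T \<alpha> p q Y \<le> ennreal (besov_bound \<alpha> p q T (C1_norm f) (besov_seminorm T \<alpha> p q X))"
      using sol besov_seminorm_solution_le_bound by blast
  qed
qed

end
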